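(* Let $p\ge2$, $0<s<1$, $\Lambda\ge1$, let $\Omega\subset\mathbb{R}^N$ be an open set, let $K:\mathbb{R}^N\to[0,+\infty)$ be measurable with $\frac1\Lambda|z|^{N+sp}\le K(z)\le\Lambda|z|^{N+sp}$ for all $z\in\mathbb{R}^N$, and let $f\in W^{s,p'}_{loc}(\Omega)$. Let $u\in W^{s,p}_{loc}(\Omega)\cap L^\infty(\mathbb{R}^N)$ be a local weak solution of $(-\Delta_{p,K})^su=f$ in $\Omega$. Then: (i) if $s\le\frac{p-1}{p}$, then $u\in W^{\tau,p}_{loc}(\Omega)$ for every $0<\tau<\frac{sp}{p-1}$; (ii) if $s>\frac{p-1}{p}$, then $u\in W^{1,p}_{loc}(\Omega)$ and $\nabla u\in W^{\tau,p}_{loc}(\Omega)$ for every $0<\tau<s-\frac{p-1}{p}$.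
   Context: Here $p'=p/(p-1)$. $\Omega'\Subset\Omega$ means that $\Omega'$ is open and its closure is a compact subset of $\Omega$. For $0<\alpha<1$ and $1\le q<\infty$, $W^{\alpha,q}(E)$ is the set of $\psi\in L^q(E)$ with $\int_E\int_E\frac{|\psi(x)-\psi(y)|^q}{|x-y|^{N+\alpha q}}dx\,dy<\infty$, and $W^{\alpha,q}_{loc}(\Omega)$ is the corresponding local space. $u$ is a local weak solution of $(-\Delta_{p,K})^su=f$ in $\Omega$ if $$\int_{\mathbb{R}^N}\int_{\mathbb{R}^N}\frac{|u(x)-u(y)|^{p-2}(u(x)-u(y))}{K(x-y)}(\varphi(x)-\varphi(y))\,dx\,dy=\int_{\Omega'}f\varphi\,dx$$ for every $\Omega'\Subset\Omega$ and every $\varphi\in W^{s,p}(\Omega)$ with $\varphi\equiv0$ in $\Omega\setminus\Omega'$ ($\varphi$ is extended by $0$ outside $\Omega$). (In general the definition requires $u\in W^{s,p}_{loc}(\Omega)$ and $\int_{\mathbb{R}^N}|u(x)|^p(1+|x|)^{-N-sp}dx<\infty$; the latter holds for bounded $u$.) *)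

theory Defs
  imports "HOL-Analysis.Analysis"
begin

definition compactly_contained :: "'a::euclidean_space set \<Rightarrow> 'a set \<Rightarrow> bool" where
  "compactly_contained \<Omega>' \<Omega> \<longleftrightarrow> open \<Omega>' \<and> compact (closure \<Omega>') \<and> closure \<Omega>' \<subseteq> \<Omega>"

text \<open>
  Elements of the function spaces below are total functions, of which only the restriction to the
  set in question matters; functions that agree almost everywhere are not identified.
  The codomain is a Euclidean space so that the spaces apply both to scalar functions and to
  gradients.
\<close>

definition Lp_space :: "real \<Rightarrow> 'a::euclidean_space set \<Rightarrow> ('a \<Rightarrow> 'b::euclidean_space) set" where
  "Lp_space q E = {\<psi>. \<psi> \<in> borel_measurable (lebesgue_on E) \<and>
                      integrable (lebesgue_on E) (\<lambda>x. norm (\<psi> x) powr q)}"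

definition L_infinity :: "('a::euclidean_space \<Rightarrow> real) set" where
  "L_infinity = {u. u \<in> borel_measurable lebesgue \<and> (\<exists>C. AE x in lebesgue. \<bar>u x\<bar> \<le> C)}"

definition fractional_W ::
  "real \<Rightarrow> real \<Rightarrow> 'a::euclidean_space set \<Rightarrow> ('a \<Rightarrow> 'b::euclidean_space) set" where
  "fractional_W \<alpha> q E = {\<psi> \<in> Lp_space q E.
     (\<integral>\<^sup>+ x. (\<integral>\<^sup>+ y. ennreal (norm (\<psi> x - \<psi> y) powr q / norm (x - y) powr (real DIM('a) + \<alpha> * q))
        \<partial>lebesgue_on E) \<partial>lebesgue_on E) < \<infinity>}"

definition local_space ::
  "('a::euclidean_space set \<Rightarrow> ('a \<Rightarrow> 'b) set) \<Rightarrow> 'a set \<Rightarrow> ('a \<Rightarrow> 'b) set" where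
  "local_space X \<Omega> = {\<psi>. \<forall>\<Omega>'. compactly_contained \<Omega>' \<Omega> \<longrightarrow> \<psi> \<in> X \<Omega>'}"

primrec C_k :: "nat \<Rightarrow> ('a::euclidean_space \<Rightarrow> real) \<Rightarrow> bool" where
  "C_k 0 \<phi> \<longleftrightarrow> continuous_on UNIV \<phi>"
| "C_k (Suc k) \<phi> \<longleftrightarrow> (\<forall>x. \<phi> differentiable (at x)) \<and>
     (\<forall>i\<in>Basis. C_k k (\<lambda>x. frechet_derivative \<phi> (at x) i))"

definition test_functions :: "'a::euclidean_space set \<Rightarrow> ('a \<Rightarrow> real) set" where
  "test_functions \<Omega> = {\<phi>. (\<forall>k. C_k k \<phi>) \<and>
     compact (closure {x. \<phi> x \<noteq> 0}) \<and> closure {x. \<phi> x \<noteq> 0} \<subseteq> \<Omega>}"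

definition weak_gradient ::
  "'a::euclidean_space set \<Rightarrow> ('a \<Rightarrow> real) \<Rightarrow> ('a \<Rightarrow> 'a) \<Rightarrow> bool" where
  "weak_gradient \<Omega> u G \<longleftrightarrow>
     u \<in> local_space (Lp_space 1) \<Omega> \<and> G \<in> local_space (Lp_space 1) \<Omega> \<and>
     (\<forall>\<phi>\<in>test_functions \<Omega>. \<forall>i\<in>Basis.
        (LINT x|lebesgue_on \<Omega>. u x * frechet_derivative \<phi> (at x) i)
          = - (LINT x|lebesgue_on \<Omega>. (G x \<bullet> i) * \<phi> x))"

definition W1 :: "real \<Rightarrow> 'a::euclidean_space set \<Rightarrow> ('a \<Rightarrow> real) set" where
  "W1 q E = {u \<in> Lp_space q E. \<exists>G \<in> Lp_space q E. weak_gradient E u G}"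

text \<open>
  In the weak formulation \<open>\<phi>\<close> is extended by \<open>0\<close> outside \<open>\<Omega>\<close>; this is the function
  \<open>\<lambda>x. indicator \<Omega> x * \<phi> x\<close>. For \<open>u\<close> as required in the definition and \<open>K z\<close> comparable to
  \<open>norm z powr (N + s * p)\<close>, the double integral converges absolutely, so the iterated Bochner
  integral does not fall back on its default value. The same holds for the right-hand side when
  \<open>f\<close> is locally in \<open>L\<close> to the power \<open>p / (p - 1)\<close>. On the diagonal,
  where \<open>K 0\<close> may vanish, the convention \<open>a / 0 = 0\<close> only affects a null set.
\<close>

definition local_weak_solution ::
  "real \<Rightarrow> real \<Rightarrow> ('a::euclidean_space \<Rightarrow> real) \<Rightarrow> 'a set \<Rightarrow> ('a \<Rightarrow> real) \<Rightarrow> ('a \<Rightarrow> real) \<Rightarrow> bool" where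
  "local_weak_solution s p K \<Omega> f u \<longleftrightarrow>
     u \<in> local_space (fractional_W s p) \<Omega> \<and>
     integrable lebesgue (\<lambda>x. \<bar>u x\<bar> powr p * (1 + norm x) powr (- real DIM('a) - s * p)) \<and>
     (\<forall>\<Omega>' \<phi>. compactly_contained \<Omega>' \<Omega> \<longrightarrow> \<phi> \<in> fractional_W s p \<Omega> \<longrightarrow>
        (AE x in lebesgue. x \<in> \<Omega> - \<Omega>' \<longrightarrow> \<phi> x = 0) \<longrightarrow>
        (LINT x|lebesgue. LINT y|lebesgue.
           (\<bar>u x - u y\<bar> powr (p - 2) * (u x - u y)) / K (x - y)
             * (indicator \<Omega> x * \<phi> x - indicator \<Omega> y * \<phi> y))
        = (LINT x|lebesgue_on \<Omega>'. f x * \<phi> x))"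

end

theory Submission
  imports Defs
begin

text \<open>
  Write \<open>w\<^sub>h x = u (x + h) - u x\<close>. Subtracting the equation from its translate by \<open>h\<close> and testing with
  \<open>\<eta> w\<^sub>h\<close> for a cutoff function \<open>\<eta>\<close>, strong monotonicity of \<open>t \<mapsto> |t|\<^bsup>p-2\<^esup>t\<close> bounds the fractional energy of
  \<open>w\<^sub>h\<close> on a compact set by a constant times the \<open>L\<^sup>p\<close> norm of \<open>w\<^sub>h\<close> on a slightly larger one. The power of
  the norm is one rather than \<open>p\<close> because far from the cutoff \<open>u\<close> is merely bounded. If therefore
  \<open>w\<^sub>h\<close> is \<open>O(|h|\<^bsup>\<sigma>\<^esup>)\<close> in \<open>L\<^sup>p\<close>, then second differences of \<open>u\<close> are of order \<open>s + \<sigma> / p\<close>, and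
  so are first differences as long as this number is below one. The fixed point of the iteration is
  \<open>s p / (p - 1)\<close>. When it exceeds one, the order of the second differences eventually exceeds one,
  so that dyadic difference quotients converge strongly in \<open>L\<^sup>p\<close> to a gradient which inherits the
  excess order \<open>s + 1 / p - 1 = s - (p - 1) / p\<close>.
\<close>

section \<open>Powers and power kernels\<close>

text \<open>Estimates are kept on p-th power integrals rather than norms and are organised by one
  scale, \<open>t = norm h powr \<sigma>\<close>, the assumed L^p size of \<open>w\<^sub>h\<close>.
  Young's inequality with weight \<open>t\<close> makes each error (cutoff gradient, long-range
  tail, source) \<open>t\<close> times a constant independent of \<open>h\<close>; the source is
  absorbed by |f \<phi>| \<le> t (|f|^p' + |\<phi> / t|^p). The passage from second to first
  differences loses its geometric series at order one, so orders of first differences stay strictly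
  below one. The second regime therefore uses a bound for two independent steps \<open>h\<close> and
  \<open>j\<close>: \<open>\<sigma> < 1\<close> is admissible there while
  \<open>s + \<sigma> / p\<close> exceeds one. The analysis runs on Borel functions with bounds at
  every point: \<open>u\<close> is replaced by a truncated representative and \<open>1 / K\<close>
  by a clamped kernel. The product of two copies of \<open>lborel\<close> is then again
  \<open>lborel\<close>, and translating pairs by \<open>(h, h)\<close> moves the shift from the
  solution to the test function, so the translated equation is never stated separately.\<close>

lemma powr_add_le_powr_add:
  fixes x y q :: real
  assumes "0 \<le> x" "0 \<le> y" "1 \<le> q"
  shows "x powr q + y powr q \<le> (x + y) powr q"
proof (cases "x + y = 0")
  case False
  then have pos: "0 < x + y" using assms by simp
  have e: "z powr q = z * z powr (q - 1)" if "0 \<le> z" for z :: real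
    using that by (cases "z = 0") (auto simp: powr_mult_base)
  have "x powr q + y powr q \<le> x * (x + y) powr (q - 1) + y * (x + y) powr (q - 1)"
    using assms by (auto simp: e intro!: add_mono mult_left_mono powr_mono2)
  also have "\<dots> = (x + y) powr q" using pos by (simp add: e algebra_simps)
  finally show ?thesis .
next
  case True
  then have "x = 0" "y = 0" using assms by auto
  then show ?thesis by simp
qed

text \<open>With \<open>m = max (x / l) (y / (1 - l))\<close> one has
  \<open>x + y \<le> l * m + (1 - l) * m = m\<close>. The weight \<open>l\<close> stays free because
  the later iterations contract only for a suitable choice of it.\<close>

lemma powr_add_le_split:
  fixes x y l p :: real
  assumes "0 \<le> x" "0 \<le> y" "0 \<le> p" "0 < l" "l < 1"
  shows "(x + y) powr p \<le> (x / l) powr p + (y / (1 - l)) powr p"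
proof -
  define m where "m = max (x / l) (y / (1 - l))"
  have "x \<le> l * m" "y \<le> (1 - l) * m"
    using assms by (auto simp: m_def field_simps max_def not_le intro: mult_mono)
  then have "x + y \<le> m" by (simp add: algebra_simps)
  then have "(x + y) powr p \<le> m powr p" using assms by (intro powr_mono2) auto
  also have "\<dots> \<le> (x / l) powr p + (y / (1 - l)) powr p" by (auto simp: m_def max_def)
  finally show ?thesis .
qed

lemma powr_add_le_double:
  fixes x y p :: real
  assumes "0 \<le> x" "0 \<le> y" "0 \<le> p"
  shows "(x + y) powr p \<le> 2 powr p * (x powr p + y powr p)"
  using powr_add_le_split[OF assms, of "1/2"] assms
  by (simp add: powr_mult algebra_simps)

text \<open>Both \<open>a\<close> and \<open>b / t\<close> are at most their maximum, so no
  convexity is involved. The constant is not sharp; what matters is that the right side is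
  \<open>t\<close> times quantities of order one as soon as \<open>b\<close> has size
  \<open>t\<close>.\<close>

lemma young_weighted:
  fixes a b t p :: real
  assumes "0 \<le> a" "0 \<le> b" "0 < t" "1 \<le> p"
  shows "a powr (p - 1) * b \<le> t * (a powr p + (b / t) powr p)"
proof -
  have e: "z powr (p - 1) * z = z powr p" if "0 \<le> z" for z :: real
    using that by (cases "z = 0") (auto simp: powr_mult_base mult.commute)
  define c where "c = max a (b / t)"
  have "a powr (p - 1) * (b / t) \<le> c powr (p - 1) * c"
    using assms by (intro mult_mono powr_mono2) (auto simp: c_def)
  also have "\<dots> = c powr p" using assms by (intro e) (auto simp: c_def)
  also have "\<dots> \<le> a powr p + (b / t) powr p" by (auto simp: c_def max_def)
  finally show ?thesis using assms by (simp add: field_simps)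
qed

text \<open>Form of Young's inequality that pairs the source in L^p' with a test function in
  L^p.\<close>

lemma young_weighted_conjugate:
  fixes a b t p :: real
  assumes "0 \<le> a" "0 \<le> b" "0 < t" "1 < p"
  shows "a * b \<le> t * (a powr (p / (p - 1)) + (b / t) powr p)"
  using young_weighted[of "a powr (1 / (p - 1))" b t p] assms by (simp add: powr_powr)

section \<open>The nonlinearity of the p-Laplacian and its strong monotonicity\<close>

definition signed_powr :: "real \<Rightarrow> real \<Rightarrow> real" where
  "signed_powr p t = \<bar>t\<bar> powr (p - 2) * t"

lemma abs_signed_powr: "\<bar>signed_powr p t\<bar> = \<bar>t\<bar> powr (p - 1)"
proof (cases "t = 0")
  case False
  then have "\<bar>t\<bar> powr (p - 2) * \<bar>t\<bar> powr 1 = \<bar>t\<bar> powr (p - 1)"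
    by (subst powr_add[symmetric]) simp
  then show ?thesis using False by (simp add: signed_powr_def abs_mult)
qed (simp add: signed_powr_def)

lemma signed_powr_nonneg_eq: "0 \<le> t \<Longrightarrow> signed_powr p t = t powr (p - 1)"
  using abs_signed_powr[of p t] by (auto simp: signed_powr_def)

lemma signed_powr_minus: "signed_powr p (- t) = - signed_powr p t"
  by (simp add: signed_powr_def)

text \<open>For arguments of equal sign this is superadditivity of the power \<open>p - 1\<close>;
  for opposite signs \<open>a - b\<close> is the sum of the nonnegative numbers \<open>a\<close> and
  \<open>- b\<close>, and the doubling inequality applies. The second case dictates
  \<open>(1/2) powr (p - 1)\<close>, weakened at the end to \<open>(1/2) powr p\<close>.\<close>

lemma signed_powr_strongly_monotone:
  fixes a b p :: real
  assumes "2 \<le> p"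
  shows "(1/2) powr p * \<bar>a - b\<bar> powr p \<le> (signed_powr p a - signed_powr p b) * (a - b)"
proof -
  have key: "(1/2) powr (p - 1) * (a - b) powr (p - 1) \<le> signed_powr p a - signed_powr p b"
    if "b \<le> a" for a b :: real
  proof -
    have same: "(1/2) powr (p - 1) * (y - x) powr (p - 1) \<le> y powr (p - 1) - x powr (p - 1)"
      if "0 \<le> x" "x \<le> y" for x y :: real
    proof -
      have "(y - x) powr (p - 1) + x powr (p - 1) \<le> (y - x + x) powr (p - 1)"
        using assms that by (intro powr_add_le_powr_add) auto
      moreover have "(1/2) powr (p - 1) * (y - x) powr (p - 1) \<le> 1 * (y - x) powr (p - 1)"
        using assms by (intro mult_right_mono powr_le1) auto
      ultimately show ?thesis by simp
    qed
    consider "0 \<le> b" | "a \<le> 0" | "b \<le> 0" "0 \<le> a" by linarith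
    then show ?thesis
    proof cases
      case 1 then show ?thesis using same[of b a] that by (simp add: signed_powr_nonneg_eq)
    next
      case 2
      have "signed_powr p a = - ((- a) powr (p - 1))" "signed_powr p b = - ((- b) powr (p - 1))"
        using 2 that signed_powr_minus[of p a] signed_powr_minus[of p b]
          signed_powr_nonneg_eq[of "- a" p] signed_powr_nonneg_eq[of "- b" p] by auto
      then show ?thesis using same[of "- a" "- b"] 2 that by simp
    next
      case 3
      have "signed_powr p a = a powr (p - 1)" "signed_powr p b = - ((- b) powr (p - 1))"
        using 3 signed_powr_minus[of p b] signed_powr_nonneg_eq[of a p]
          signed_powr_nonneg_eq[of "- b" p] by auto
      moreover have "(a + - b) powr (p - 1) \<le> 2 powr (p - 1) * (a powr (p - 1) + (- b) powr (p - 1))"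
        using 3 assms by (intro powr_add_le_double) auto
      ultimately show ?thesis using assms by (simp add: powr_divide field_simps)
    qed
  qed
  have e: "(1/2) powr p * z powr p \<le> (1/2) powr (p - 1) * z powr (p - 1) * z" if "0 \<le> z" for z :: real
  proof (cases "z = 0")
    case False
    have "(1/2) powr p * (z powr (p - 1) * z) \<le> (1/2) powr (p - 1) * (z powr (p - 1) * z)"
      using that by (intro mult_right_mono powr_mono') auto
    moreover have "z powr (p - 1) * z = z powr p"
      using False that by (simp add: powr_mult_base mult.commute)
    ultimately show ?thesis by (simp add: mult.assoc)
  qed simp
  show ?thesis
  proof (cases "b \<le> a")
    case True
    then show ?thesis using mult_right_mono[OF key[OF True], of "a - b"] e[of "a - b"] by simp
  next
    case False
    then have "a \<le> b" by simp
    from mult_right_mono[OF key[OF this], of "b - a"] e[of "b - a"] this False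
    show ?thesis by (simp add: algebra_simps)
  qed
qed

lemma ex_dyadic_scale:
  fixes x :: real assumes "1 \<le> x"
  shows "\<exists>k::nat. 2 ^ k \<le> x \<and> x \<le> 2 ^ (k + 1)"
proof -
  define k where "k = nat \<lfloor>log 2 x\<rfloor>"
  have l: "0 \<le> log 2 x" using assms by simp
  then have "real k \<le> log 2 x" "log 2 x \<le> real (k + 1)"
    unfolding k_def by linarith+
  then have "2 powr real k \<le> x" "x \<le> 2 powr real (k + 1)"
    using assms by (simp_all only: le_log_iff log_le_iff)
  then have "2 ^ k \<le> x \<and> x \<le> 2 ^ (k + 1)" by (simp add: powr_realpow powr_add)
  then show ?thesis by blast
qed

section \<open>Translation, reflection and Tonelli for Lebesgue measure\<close>

lemma nn_integral_lborel_shift: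
  fixes f :: "'a::euclidean_space \<Rightarrow> ennreal"
  assumes [measurable]: "f \<in> borel_measurable borel"
  shows "(\<integral>\<^sup>+x. f (x + h) \<partial>lborel) = (\<integral>\<^sup>+x. f x \<partial>lborel)"
proof -
  have "(\<integral>\<^sup>+x. f x \<partial>lborel) = (\<integral>\<^sup>+x. f x \<partial>distr lborel borel ((+) h))"
    by (simp add: lborel_distr_plus)
  also have "\<dots> = (\<integral>\<^sup>+x. f (h + x) \<partial>lborel)" by (subst nn_integral_distr) auto
  finally show ?thesis by (simp add: add.commute)
qed

lemma lborel_distr_reflect:
  fixes a :: "'a::euclidean_space"
  shows "distr lborel borel (\<lambda>x. a - x) = lborel"
  using lborel_affine[of "-1" a] by (simp add: density_1)

lemma nn_integral_lborel_reflect: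
  fixes f :: "'a::euclidean_space \<Rightarrow> ennreal"
  assumes [measurable]: "f \<in> borel_measurable borel"
  shows "(\<integral>\<^sup>+x. f (a - x) \<partial>lborel) = (\<integral>\<^sup>+x. f x \<partial>lborel)"
proof -
  have "(\<integral>\<^sup>+x. f x \<partial>lborel) = (\<integral>\<^sup>+x. f x \<partial>distr lborel borel (\<lambda>x. a - x))"
    by (simp add: lborel_distr_reflect)
  also have "\<dots> = (\<integral>\<^sup>+x. f (a - x) \<partial>lborel)" by (subst nn_integral_distr) auto
  finally show ?thesis by simp
qed

text \<open>For fixed \<open>x\<close> the kernel is evaluated at \<open>x - y\<close>, so a null
  set of kernel arguments has to become a null set of points \<open>y\<close>.\<close>

lemma AE_lborel_reflect:
  fixes a :: "'a::euclidean_space"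
  assumes "AE z in lborel. P z"
  shows "AE x in lborel. P (a - x)"
proof -
  obtain N where N: "{z. \<not> P z} \<subseteq> N" "N \<in> sets lborel" "emeasure lborel N = 0"
    using assms by (auto elim!: AE_E)
  then have "AE z in distr lborel borel (\<lambda>x. a - x). z \<notin> N"
    unfolding lborel_distr_reflect by (auto intro!: AE_I'[of N] simp: null_sets_def)
  then have "AE x in lborel. a - x \<notin> N"
    using N by (subst (asm) AE_distr_iff) auto
  then show ?thesis using N by (auto elim!: eventually_mono)
qed

lemma nn_integral_lborel_pair:
  fixes f :: "'a::euclidean_space \<Rightarrow> 'a \<Rightarrow> ennreal"
  assumes [measurable]: "case_prod f \<in> borel_measurable borel"
  shows "(\<integral>\<^sup>+z. f (fst z) (snd z) \<partial>lborel) = (\<integral>\<^sup>+x. \<integral>\<^sup>+y. f x y \<partial>lborel \<partial>lborel)"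
proof -
  have "(\<integral>\<^sup>+z. f (fst z) (snd z) \<partial>lborel) = (\<integral>\<^sup>+z. case_prod f z \<partial>(lborel \<Otimes>\<^sub>M lborel))"
    by (simp add: lborel_prod case_prod_beta')
  also have "\<dots> = (\<integral>\<^sup>+x. \<integral>\<^sup>+y. f x y \<partial>lborel \<partial>lborel)"
    using assms by (subst lborel.nn_integral_fst[symmetric]) (auto simp: borel_prod[symmetric] lborel_prod)
  finally show ?thesis .
qed

section \<open>Integrability of powers of the norm near zero and near infinity\<close>

text \<open>On the annulus \<open>norm z\<close> and \<open>r\<close> differ by a factor of at most
  2, so \<open>norm z powr b\<close> is at most \<open>2 powr \<bar>b\<bar> * r powr b\<close> for
  either sign of \<open>b\<close>; the volume of the ball supplies the remaining power of
  \<open>r\<close>.\<close>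

lemma nn_integral_annulus_le:
  fixes b :: real
  shows "\<exists>C\<ge>0. \<forall>r>0. (\<integral>\<^sup>+z. ennreal (indicator {z. r / 2 \<le> norm z \<and> norm z \<le> r} z * norm z powr b)
      \<partial>(lborel :: 'a::euclidean_space measure)) \<le> ennreal (C * r powr (b + real DIM('a)))"
proof (intro exI conjI allI impI)
  let ?V = "measure lborel (cball (0::'a) 1)"
  let ?C = "2 powr \<bar>b\<bar> * ?V"
  show "0 \<le> ?C" by simp
  fix r :: real assume r: "0 < r"
  have le: "indicator {z. r / 2 \<le> norm z \<and> norm z \<le> r} z * norm z powr b
      \<le> 2 powr \<bar>b\<bar> * r powr b * indicator (cball 0 r) z" for z :: 'a
  proof (cases "r / 2 \<le> norm z \<and> norm z \<le> r")
    case True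
    have "norm z powr b \<le> 2 powr \<bar>b\<bar> * r powr b"
    proof (cases "0 \<le> b")
      case pos: True
      have "norm z powr b \<le> r powr b" using True pos by (intro powr_mono2) auto
      also have "\<dots> \<le> 2 powr \<bar>b\<bar> * r powr b"
        using mult_right_mono[of 1 "2 powr \<bar>b\<bar>" "r powr b"] by (simp add: ge_one_powr_ge_zero)
      finally show ?thesis .
    next
      case False
      have "norm z powr b \<le> (r / 2) powr b" using True False r by (intro powr_mono2') auto
      also have "\<dots> = 2 powr \<bar>b\<bar> * r powr b"
        using False r by (simp add: powr_divide powr_minus_divide)
      finally show ?thesis .
    qed
    then show ?thesis using True by simp
  qed simp
  have "(\<integral>\<^sup>+z. ennreal (indicator {z. r / 2 \<le> norm z \<and> norm z \<le> r} z * norm z powr b) \<partial>(lborel :: 'a measure))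
    \<le> (\<integral>\<^sup>+z. ennreal (2 powr \<bar>b\<bar> * r powr b) * indicator (cball 0 r) z \<partial>(lborel :: 'a measure))"
    using le by (intro nn_integral_mono) (auto simp: ennreal_mult[symmetric] ennreal_indicator[symmetric] simp del: ennreal_indicator intro!: ennreal_leI)
  also have "\<dots> = ennreal (2 powr \<bar>b\<bar> * r powr b) * emeasure lborel (cball (0::'a) r)"
    by (simp add: nn_integral_cmult_indicator)
  also have "emeasure lborel (cball (0::'a) r) = ennreal (?V * r powr real DIM('a))"
    using r by (subst emeasure_cball) (auto simp: content_cball powr_realpow)
  also have "ennreal (2 powr \<bar>b\<bar> * r powr b) * \<dots> = ennreal (?C * r powr (b + real DIM('a)))"
    by (simp add: ennreal_mult[symmetric] powr_add mult_ac)
  finally show "(\<integral>\<^sup>+z. ennreal (indicator {z. r / 2 \<le> norm z \<and> norm z \<le> r} z * norm z powr b) \<partial>(lborel :: 'a measure))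
    \<le> ennreal (?C * r powr (b + real DIM('a)))" .
qed

text \<open>One summation serves both ends: \<open>q = 1/2\<close> exhausts a punctured ball,
  \<open>q = 2\<close> the outside of a ball. The k-th annulus contributes a constant times
  \<open>(q powr (b + DIM('a))) ^ k\<close>, a convergent geometric series by the hypothesis on
  \<open>q\<close>.\<close>

lemma nn_integral_dyadic_annuli_finite:
  fixes b q :: real and S :: "'a::euclidean_space set"
  assumes r0: "0 < r0" and q: "0 < q" "q powr (b + real DIM('a)) < 1"
    and cover: "\<And>z. z \<in> S \<Longrightarrow> z = 0 \<or> (\<exists>k::nat. r0 * q ^ k / 2 \<le> norm z \<and> norm z \<le> r0 * q ^ k)"
  shows "(\<integral>\<^sup>+z. ennreal (indicator S z * norm z powr b) \<partial>lborel) < \<infinity>"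
proof -
  obtain C where C: "0 \<le> C" "\<And>r. 0 < r \<Longrightarrow>
      (\<integral>\<^sup>+z. ennreal (indicator {z. r / 2 \<le> norm z \<and> norm z \<le> r} z * norm z powr b)
      \<partial>(lborel :: 'a measure)) \<le> ennreal (C * r powr (b + real DIM('a)))"
    using nn_integral_annulus_le[where 'a='a, of b] by blast
  let ?g = "\<lambda>k (z::'a). ennreal (indicator {z. r0 * q ^ k / 2 \<le> norm z \<and> norm z \<le> r0 * q ^ k} z * norm z powr b)"
  let ?e = "b + real DIM('a)"
  have "(\<integral>\<^sup>+z. ennreal (indicator S z * norm z powr b) \<partial>lborel) \<le> (\<integral>\<^sup>+z. (\<Sum>k. ?g k z) \<partial>(lborel :: 'a measure))"
  proof (rule nn_integral_mono)
    fix z :: 'a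
    show "ennreal (indicator S z * norm z powr b) \<le> (\<Sum>k. ?g k z)"
    \<comment> \<open>Since \<open>0 powr b = 0\<close>, the origin contributes nothing, whatever
      the sign of \<open>b\<close>.\<close>
    proof (cases "z \<in> S \<and> z \<noteq> 0")
      case True
      then obtain k where k: "r0 * q ^ k / 2 \<le> norm z \<and> norm z \<le> r0 * q ^ k" using cover by blast
      have "ennreal (indicator S z * norm z powr b) = (\<Sum>j\<in>{k}. ?g j z)" using True k by simp
      also have "\<dots> \<le> (\<Sum>j. ?g j z)" by (rule sum_le_suminf) auto
      finally show ?thesis .
    qed auto
  qed
  also have "\<dots> = (\<Sum>k. \<integral>\<^sup>+z. ?g k z \<partial>lborel)" by (rule nn_integral_suminf) measurable
  also have "\<dots> \<le> (\<Sum>k. ennreal (C * (r0 powr ?e * (q powr ?e) ^ k)))"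
  proof (intro suminf_le)
    fix k
    have "(r0 * q ^ k) powr ?e = r0 powr ?e * (q powr ?e) ^ k"
      using r0 q by (simp add: powr_mult powr_realpow[symmetric] powr_powr mult.commute)
    then show "(\<integral>\<^sup>+z. ?g k z \<partial>lborel) \<le> ennreal (C * (r0 powr ?e * (q powr ?e) ^ k))"
      using C(2)[of "r0 * q ^ k"] r0 q by simp
  qed auto
  also have "\<dots> < \<infinity>"
  proof -
    have "(\<Sum>k. ennreal (C * (r0 powr ?e * (q powr ?e) ^ k))) \<noteq> top"
      using C(1) q by (intro ennreal_suminf_neq_top summable_mult summable_geometric) auto
    then show ?thesis by (simp add: less_top)
  qed
  finally show ?thesis .
qed

lemma nn_integral_kernel_near_finite:
  fixes a R :: real
  assumes "0 < a"
  shows "(\<integral>\<^sup>+z. ennreal (indicator (cball 0 R) z * norm z powr (a - real DIM('a))) \<partial>(lborel :: 'a::euclidean_space measure)) < \<infinity>"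
proof -
  define r where "r = max R 1"
  have r: "0 < r" "R \<le> r" by (auto simp: r_def)
  have "(\<integral>\<^sup>+z. ennreal (indicator (cball 0 R) z * norm z powr (a - real DIM('a))) \<partial>(lborel :: 'a measure))
     < \<infinity>"
  proof (rule nn_integral_dyadic_annuli_finite[where q = "1/2" and ?r0.0 = r])
    show "(1/2::real) powr (a - real DIM('a) + real DIM('a)) < 1"
      using assms powr_less_mono2[of a "1/2" 1] by simp
    fix z :: 'a assume z: "z \<in> cball 0 R"
    show "z = 0 \<or> (\<exists>k::nat. r * (1/2) ^ k / 2 \<le> norm z \<and> norm z \<le> r * (1/2) ^ k)"
    proof (cases "z = 0")
      case False
      then have "1 \<le> r / norm z" using z r by (simp add: field_simps)
      from ex_dyadic_scale[OF this] False show ?thesis by (auto simp: field_simps power_one_over)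
    qed simp
  qed (use r in auto)
  then show ?thesis .
qed

lemma nn_integral_kernel_far_finite:
  fixes a \<rho> :: real
  assumes "0 < a" "0 < \<rho>"
  shows "(\<integral>\<^sup>+z. ennreal (indicator {z. \<rho> \<le> norm z} z * norm z powr (- (real DIM('a) + a))) \<partial>(lborel :: 'a::euclidean_space measure)) < \<infinity>"
proof (rule nn_integral_dyadic_annuli_finite[where q = 2 and ?r0.0 = "2 * \<rho>"])
  show "(2::real) powr (- (real DIM('a) + a) + real DIM('a)) < 1"
    using assms powr_less_mono[of "- a" 0 2] by simp
  fix z :: 'a assume z: "z \<in> {z. \<rho> \<le> norm z}"
  then have "1 \<le> norm z / \<rho>" using assms by simp
  from ex_dyadic_scale[OF this] assms
  show "z = 0 \<or> (\<exists>k::nat. 2 * \<rho> * 2 ^ k / 2 \<le> norm z \<and> norm z \<le> 2 * \<rho> * 2 ^ k)"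
    by (auto simp: field_simps)
qed (use assms in auto)

section \<open>Fractional energies\<close>

lemma borel_measurable_fst_euclidean [measurable]:
  "fst \<in> borel_measurable (borel :: ('a::euclidean_space \<times> 'b::euclidean_space) measure)"
  by (intro borel_measurable_continuous_onI continuous_intros)

lemma borel_measurable_snd_euclidean [measurable]:
  "snd \<in> borel_measurable (borel :: ('a::euclidean_space \<times> 'b::euclidean_space) measure)"
  by (intro borel_measurable_continuous_onI continuous_intros)

lemma nn_integral_lborel_pair_swap:
  fixes f :: "'a::euclidean_space \<Rightarrow> 'a \<Rightarrow> ennreal"
  assumes [measurable]: "case_prod f \<in> borel_measurable borel"
  shows "(\<integral>\<^sup>+z. f (fst z) (snd z) \<partial>lborel) = (\<integral>\<^sup>+y. \<integral>\<^sup>+x. f x y \<partial>lborel \<partial>lborel)"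
  unfolding nn_integral_lborel_pair[OF assms]
  using assms by (subst lborel_pair.Fubini') (auto simp: borel_prod[symmetric] lborel_prod)

text \<open>Integrating out the second point first leaves the full integral of \<open>k\<close>, by
  reflection invariance. Together with its twin for \<open>snd\<close> this integrates every error
  term that is a function of one point times a kernel in the difference.\<close>

lemma has_bochner_integral_fst_kernel:
  fixes g k :: "'a::euclidean_space \<Rightarrow> real"
  assumes g: "integrable lborel g" "\<And>x. 0 \<le> g x" and k: "integrable lborel k" "\<And>x. 0 \<le> k x"
  shows "has_bochner_integral lborel (\<lambda>z. g (fst z) * k (fst z - snd z)) (integral\<^sup>L lborel g * integral\<^sup>L lborel k)"
proof (rule has_bochner_integral_nn_integral)
  have [measurable]: "g \<in> borel_measurable borel" "k \<in> borel_measurable borel"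
    using g k by auto
  show "(\<lambda>z. g (fst z) * k (fst z - snd z)) \<in> borel_measurable lborel" by measurable
  have "(\<integral>\<^sup>+z. ennreal (g (fst z) * k (fst z - snd z)) \<partial>lborel)
    = (\<integral>\<^sup>+x. \<integral>\<^sup>+y. ennreal (g x * k (x - y)) \<partial>lborel \<partial>lborel)"
    by (rule nn_integral_lborel_pair) (simp add: case_prod_beta')
  also have "\<dots> = (\<integral>\<^sup>+x. ennreal (g x) * (\<integral>\<^sup>+y. ennreal (k (x - y)) \<partial>lborel) \<partial>lborel)"
    using g k by (simp add: ennreal_mult nn_integral_cmult)
  also have "\<dots> = (\<integral>\<^sup>+x. ennreal (g x) * (\<integral>\<^sup>+y. ennreal (k y) \<partial>lborel) \<partial>lborel)"
    using nn_integral_lborel_reflect[of "\<lambda>z. ennreal (k z)"] by simp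
  also have "\<dots> = (\<integral>\<^sup>+x. ennreal (g x) \<partial>lborel) * (\<integral>\<^sup>+y. ennreal (k y) \<partial>lborel)"
    by (simp add: nn_integral_multc)
  also have "\<dots> = ennreal (integral\<^sup>L lborel g * integral\<^sup>L lborel k)"
    using g k by (simp add: nn_integral_eq_integral ennreal_mult)
  finally show "(\<integral>\<^sup>+z. ennreal (g (fst z) * k (fst z - snd z)) \<partial>lborel) = ennreal (integral\<^sup>L lborel g * integral\<^sup>L lborel k)" .
qed (use g k in \<open>auto intro!: mult_nonneg_nonneg integral_nonneg\<close>)

lemma has_bochner_integral_snd_kernel:
  fixes g k :: "'a::euclidean_space \<Rightarrow> real"
  assumes g: "integrable lborel g" "\<And>x. 0 \<le> g x" and k: "integrable lborel k" "\<And>x. 0 \<le> k x"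
  shows "has_bochner_integral lborel (\<lambda>z. g (snd z) * k (fst z - snd z)) (integral\<^sup>L lborel g * integral\<^sup>L lborel k)"
proof (rule has_bochner_integral_nn_integral)
  have [measurable]: "g \<in> borel_measurable borel" "k \<in> borel_measurable borel"
    using g k by auto
  show "(\<lambda>z. g (snd z) * k (fst z - snd z)) \<in> borel_measurable lborel" by measurable
  have "(\<integral>\<^sup>+z. ennreal (g (snd z) * k (fst z - snd z)) \<partial>lborel)
    = (\<integral>\<^sup>+y. \<integral>\<^sup>+x. ennreal (g y * k (x - y)) \<partial>lborel \<partial>lborel)"
    by (rule nn_integral_lborel_pair_swap) (simp add: case_prod_beta')
  also have "\<dots> = (\<integral>\<^sup>+y. ennreal (g y) * (\<integral>\<^sup>+x. ennreal (k (x - y)) \<partial>lborel) \<partial>lborel)"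
    using g k by (simp add: ennreal_mult nn_integral_cmult)
  also have "\<dots> = (\<integral>\<^sup>+x. ennreal (g x) * (\<integral>\<^sup>+y. ennreal (k y) \<partial>lborel) \<partial>lborel)"
    using nn_integral_lborel_shift[of "\<lambda>z. ennreal (k z)" "- _"] by simp
  also have "\<dots> = (\<integral>\<^sup>+x. ennreal (g x) \<partial>lborel) * (\<integral>\<^sup>+y. ennreal (k y) \<partial>lborel)"
    by (simp add: nn_integral_multc)
  also have "\<dots> = ennreal (integral\<^sup>L lborel g * integral\<^sup>L lborel k)"
    using g k by (simp add: nn_integral_eq_integral ennreal_mult)
  finally show "(\<integral>\<^sup>+z. ennreal (g (snd z) * k (fst z - snd z)) \<partial>lborel) = ennreal (integral\<^sup>L lborel g * integral\<^sup>L lborel k)" .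
qed (use g k in \<open>auto intro!: mult_nonneg_nonneg integral_nonneg\<close>)

lemma integrable_kernel_near:
  fixes a R :: real
  assumes "0 < a"
  shows "integrable (lborel :: 'a::euclidean_space measure) (\<lambda>z. indicator (cball 0 R) z * norm z powr (a - real DIM('a)))"
proof (rule integrableI_bounded)
  have [measurable]: "cball (0::'a) R \<in> sets borel" by simp
  show "(\<lambda>z::'a. indicator (cball 0 R) z * norm z powr (a - real DIM('a))) \<in> borel_measurable lborel"
    by measurable
qed (use nn_integral_kernel_near_finite[OF assms, of R, where 'a='a] in \<open>auto simp: abs_mult\<close>)

lemma integrable_kernel_far:
  fixes a \<rho> :: real
  assumes "0 < a" "0 < \<rho>"
  shows "integrable (lborel :: 'a::euclidean_space measure) (\<lambda>z. indicator {z. \<rho> \<le> norm z} z * norm z powr (- (real DIM('a) + a)))"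
  using nn_integral_kernel_far_finite[OF assms, where 'a='a]
  by (intro integrableI_bounded) (auto simp: abs_mult)

section \<open>Gagliardo energies as integrals over pairs of points\<close>

text \<open>The Gagliardo density of order \<open>s\<close> on \<open>A\<close>. Because
  \<open>0 powr _ = 0\<close> it vanishes on the diagonal. As a function of the pair it is
  integrated against \<open>lborel\<close> on the product space, where the translation by
  \<open>(h, h)\<close> is available.\<close>

definition energy_density ::
  "real \<Rightarrow> real \<Rightarrow> 'a::euclidean_space set \<Rightarrow> ('a \<Rightarrow> 'b::euclidean_space) \<Rightarrow> 'a \<times> 'a \<Rightarrow> real" where
  "energy_density s p A v z = indicator A (fst z) * indicator A (snd z)
     * norm (v (fst z) - v (snd z)) powr p * norm (fst z - snd z) powr (- (real DIM('a) + s * p))"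

text \<open>Kept apart from \<open>energy\<close>, whose Bochner integral would be 0 in the
  divergent case.\<close>

definition finite_energy ::
  "real \<Rightarrow> real \<Rightarrow> 'a::euclidean_space set \<Rightarrow> ('a \<Rightarrow> 'b::euclidean_space) \<Rightarrow> bool" where
  "finite_energy s p A v \<longleftrightarrow> integrable lborel (energy_density s p A v)"

definition energy ::
  "real \<Rightarrow> real \<Rightarrow> 'a::euclidean_space set \<Rightarrow> ('a \<Rightarrow> 'b::euclidean_space) \<Rightarrow> real" where
  "energy s p A v = integral\<^sup>L lborel (energy_density s p A v)"

lemma energy_density_nonneg [simp]: "0 \<le> energy_density s p A v z"
  by (simp add: energy_density_def)

lemma energy_nonneg [simp]: "0 \<le> energy s p A v"
  by (simp add: energy_def)

lemma energy_density_measurable [measurable]: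
  assumes [measurable]: "A \<in> sets borel" "v \<in> borel_measurable borel"
  shows "energy_density s p A v \<in> borel_measurable borel"
  unfolding energy_density_def[abs_def] by measurable

lemma energy_density_subset: "A \<subseteq> B \<Longrightarrow> energy_density s p A v z \<le> energy_density s p B v z"
  unfolding energy_density_def by (intro mult_right_mono mult_mono) (auto simp: indicator_def)

lemma finite_energy_subset:
  assumes "finite_energy s p B v" "A \<subseteq> B" "A \<in> sets borel" "v \<in> borel_measurable borel"
  shows "finite_energy s p A v" "energy s p A v \<le> energy s p B v"
proof -
  show "finite_energy s p A v"
    unfolding finite_energy_def
    by (rule Bochner_Integration.integrable_bound[OF assms(1)[unfolded finite_energy_def]])
       (use assms in \<open>auto simp: energy_density_subset intro!: energy_density_measurable\<close>)
  then show "energy s p A v \<le> energy s p B v"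
    using assms unfolding finite_energy_def energy_def
    by (intro integral_mono) (auto simp: energy_density_subset)
qed

lemma integrable_lborel_shift_iff:
  fixes f :: "'a::euclidean_space \<Rightarrow> 'b::{banach, second_countable_topology}"
  shows "f \<in> borel_measurable borel \<Longrightarrow> integrable lborel (\<lambda>x. f (x + h)) \<longleftrightarrow> integrable lborel f"
  using integrable_distr_eq[of "(+) h" lborel borel f]
  by (simp add: lborel_distr_plus add.commute)

lemma integral_lborel_shift:
  fixes f :: "'a::euclidean_space \<Rightarrow> 'b::{banach, second_countable_topology}"
  shows "f \<in> borel_measurable borel \<Longrightarrow> (LINT x|lborel. f (x + h)) = (LINT x|lborel. f x)"
  using integral_distr[of "(+) h" lborel borel f]
  by (simp add: lborel_distr_plus add.commute)

text \<open>Shifting pairs by \<open>(h, h)\<close> leaves the difference of the two points fixed,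
  so only the indicators change.\<close>

lemma finite_energy_shift:
  assumes fin: "finite_energy s p B v" and AB: "\<And>x. x \<in> A \<Longrightarrow> x + h \<in> B"
    and [measurable]: "A \<in> sets borel" "B \<in> sets borel" "v \<in> borel_measurable borel"
  shows "finite_energy s p A (\<lambda>x. v (x + h))" "energy s p A (\<lambda>x. v (x + h)) \<le> energy s p B v"
proof -
  have i: "integrable lborel (\<lambda>z. energy_density s p B v (z + (h, h)))"
    and e: "(LINT z|lborel. energy_density s p B v (z + (h, h))) = energy s p B v"
    using fin integrable_lborel_shift_iff[of "energy_density s p B v" "(h, h)"]
      integral_lborel_shift[of "energy_density s p B v" "(h, h)"]
    by (auto simp: finite_energy_def energy_def)
  have le: "energy_density s p A (\<lambda>x. v (x + h)) z \<le> energy_density s p B v (z + (h, h))" for z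
    using AB unfolding energy_density_def
    by (intro mult_mono) (auto simp: indicator_def)
  show "finite_energy s p A (\<lambda>x. v (x + h))"
    unfolding finite_energy_def
    by (rule Bochner_Integration.integrable_bound[OF i])
       (use le in \<open>auto intro!: energy_density_measurable\<close>)
  then show "energy s p A (\<lambda>x. v (x + h)) \<le> energy s p B v"
    using le i unfolding e[symmetric] unfolding finite_energy_def
    by (subst energy_def, intro integral_mono) auto
qed

lemma finite_energy_diff:
  assumes "finite_energy s p A v" "finite_energy s p A w" "0 \<le> p"
    and [measurable]: "A \<in> sets borel" "v \<in> borel_measurable borel" "w \<in> borel_measurable borel"
  shows "finite_energy s p A (\<lambda>x. v x - w x)"
  unfolding finite_energy_def
proof (rule Bochner_Integration.integrable_bound)
  show "integrable lborel (\<lambda>z. 2 powr p * (energy_density s p A v z + energy_density s p A w z))"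
    using assms by (auto simp: finite_energy_def)
  have "energy_density s p A (\<lambda>x. v x - w x) z
     \<le> 2 powr p * (energy_density s p A v z + energy_density s p A w z)" for z
  proof -
    have "norm (v (fst z) - w (fst z) - (v (snd z) - w (snd z))) powr p
       \<le> (norm (v (fst z) - v (snd z)) + norm (w (fst z) - w (snd z))) powr p"
      using norm_triangle_ineq4[of "v (fst z) - v (snd z)" "w (fst z) - w (snd z)"] assms(3)
      by (intro powr_mono2) (auto simp: algebra_simps)
    also have "\<dots> \<le> 2 powr p * (norm (v (fst z) - v (snd z)) powr p + norm (w (fst z) - w (snd z)) powr p)"
      using assms(3) by (intro powr_add_le_double) auto
    finally have "(indicator A (fst z) * indicator A (snd z) * norm (fst z - snd z) powr (- (real DIM('a) + s * p))) *
       norm (v (fst z) - w (fst z) - (v (snd z) - w (snd z))) powr p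
       \<le> (indicator A (fst z) * indicator A (snd z) * norm (fst z - snd z) powr (- (real DIM('a) + s * p))) *
        (2 powr p * (norm (v (fst z) - v (snd z)) powr p + norm (w (fst z) - w (snd z)) powr p))"
      by (rule mult_left_mono) simp
    then show ?thesis by (simp add: energy_density_def algebra_simps)
  qed
  then show "AE z in lborel. norm (energy_density s p A (\<lambda>x. v x - w x) z)
     \<le> norm (2 powr p * (energy_density s p A v z + energy_density s p A w z))"
    by (auto simp: abs_of_nonneg)
qed (auto intro!: energy_density_measurable)

section \<open>The localized energy estimate\<close>

text \<open>Integrand of the weak formulation, with \<open>k\<close> in the role of
  \<open>1 / K\<close>.\<close>

definition pairing_density ::
  "real \<Rightarrow> ('a::euclidean_space \<Rightarrow> real) \<Rightarrow> ('a \<Rightarrow> real) \<Rightarrow> ('a \<Rightarrow> real) \<Rightarrow> 'a \<times> 'a \<Rightarrow> real" where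
  "pairing_density p k u \<phi> z
     = signed_powr p (u (fst z) - u (snd z)) * k (fst z - snd z) * (\<phi> (fst z) - \<phi> (snd z))"

lemma pairing_density_measurable [measurable]:
  assumes [measurable]: "k \<in> borel_measurable borel" "u \<in> borel_measurable borel" "\<phi> \<in> borel_measurable borel"
  shows "pairing_density p k u \<phi> \<in> borel_measurable borel"
  unfolding pairing_density_def[abs_def] signed_powr_def by measurable

text \<open>Three nested sets, \<open>L \<subseteq> B \<subseteq> A\<close>: the energy is estimated
  on \<open>L\<close>, where \<open>\<eta>\<close> is 1; \<open>\<eta>\<close> vanishes off
  \<open>B\<close>; the gap \<open>\<rho>\<close> between \<open>B\<close> and the complement of
  \<open>A\<close> keeps every pair joining them away from the diagonal. \<open>R\<close> bounds the
  diameter of \<open>A\<close>, so that kernels on \<open>A \<times> A\<close> may be truncated to a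
  ball.\<close>

locale cutoff =
  fixes s p \<rho> R :: real and L B A :: "'a::euclidean_space set" and \<eta> :: "'a \<Rightarrow> real"
  assumes s: "0 < s" "s < 1" and p: "2 \<le> p" and \<rho>: "0 < \<rho>"
    and meas [measurable]: "L \<in> sets borel" "A \<in> sets borel"
    and \<eta>_measurable [measurable]: "\<eta> \<in> borel_measurable borel"
    and finite_A: "emeasure lborel A < \<infinity>"
    and diam: "\<And>x y. x \<in> A \<Longrightarrow> y \<in> A \<Longrightarrow> norm (x - y) \<le> R"
    and sep: "\<And>x y. x \<in> B \<Longrightarrow> y \<notin> A \<Longrightarrow> \<rho> \<le> norm (x - y)"
    and \<eta>_nonneg: "\<And>x. 0 \<le> \<eta> x" and \<eta>_le_1: "\<And>x. \<eta> x \<le> 1"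
    and lip: "\<And>x y. \<bar>\<eta> x - \<eta> y\<bar> \<le> norm (x - y) / \<rho>"
    and off: "\<And>x. x \<notin> B \<Longrightarrow> \<eta> x = 0" and on: "\<And>x. x \<in> L \<Longrightarrow> \<eta> x = 1"
begin

lemma B_subset_A: "B \<subseteq> A"
  using sep \<rho> by fastforce

lemma L_subset_B: "L \<subseteq> B"
  using off on by fastforce

abbreviation kern :: "'a \<Rightarrow> real" where
  "kern z \<equiv> norm z powr (- (real DIM('a) + s * p))"

text \<open>What remains of the singular kernel once a Lipschitz cutoff has contributed
  \<open>norm z powr p\<close>; it is integrable at the origin because \<open>(1 - s) * p\<close> is
  positive.\<close>

definition near_kernel :: "'a \<Rightarrow> real" where
  "near_kernel z = indicator (cball 0 R) z * norm z powr ((1 - s) * p - real DIM('a))"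

text \<open>The kernel as seen by pairs with one point in \<open>B\<close> and the other outside
  \<open>A\<close>.\<close>

definition far_kernel :: "'a \<Rightarrow> real" where
  "far_kernel z = indicator {z. \<rho> \<le> norm z} z * kern z"

lemma integrable_near: "integrable lborel near_kernel"
  unfolding near_kernel_def[abs_def] using s p by (intro integrable_kernel_near) auto

lemma integrable_far: "integrable lborel far_kernel"
  unfolding far_kernel_def[abs_def] using s p \<rho> by (intro integrable_kernel_far) auto

lemma kernel_nonneg [simp]: "0 \<le> near_kernel z" "0 \<le> far_kernel z"
  by (auto simp: near_kernel_def far_kernel_def)

lemma integrable_indicator_A: "integrable lborel (indicator A :: 'a \<Rightarrow> real)"
  using finite_A by simp

lemma norm_powr_kern: "norm z powr p * kern z = norm z powr ((1 - s) * p - real DIM('a))" for z :: 'a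
  using p by (cases "z = 0") (auto simp: powr_add[symmetric] algebra_simps)

text \<open>Off \<open>A \<times> A\<close> there are two kinds of pairs. If one point lies in
  \<open>B\<close>, the other lies outside \<open>A\<close>, hence at distance at least
  \<open>\<rho>\<close>, and the kernel tail times the indicator of \<open>A\<close> dominates; if
  neither does, the integrand is zero.\<close>

lemma integrable_pairs:
  fixes F G :: "'a \<times> 'a \<Rightarrow> real"
  assumes [measurable]: "F \<in> borel_measurable borel"
    and G: "integrable lborel G" "\<And>z. 0 \<le> G z"
    and near: "\<And>x y. x \<in> A \<Longrightarrow> y \<in> A \<Longrightarrow> \<bar>F (x, y)\<bar> \<le> G (x, y)"
    and far: "\<And>x y. \<bar>F (x, y)\<bar> \<le> c * kern (x - y)"
    and F0: "\<And>x y. x \<notin> B \<Longrightarrow> y \<notin> B \<Longrightarrow> F (x, y) = 0"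
  shows "integrable lborel F"
proof (rule Bochner_Integration.integrable_bound)
  let ?far = "\<lambda>z. \<bar>c\<bar> * (indicator A (fst z) * far_kernel (fst z - snd z)
                  + indicator A (snd z) * far_kernel (fst z - snd z))"
  show "integrable lborel (\<lambda>z. G z + ?far z)"
    using has_bochner_integral_fst_kernel[OF integrable_indicator_A _ integrable_far]
      has_bochner_integral_snd_kernel[OF integrable_indicator_A _ integrable_far] G
    by (auto simp: has_bochner_integral_iff)
  have nn: "0 \<le> ?far z" for z by simp
  have "\<bar>F (x, y)\<bar> \<le> G (x, y) + ?far (x, y)" for x y
  proof (cases "x \<in> A \<and> y \<in> A")
    case True
    then show ?thesis using near[of x y] nn[of "(x, y)"] by linarith
  next
    case False
    show ?thesis
    proof (cases "x \<in> B \<or> y \<in> B")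
      case True
      then have d: "\<rho> \<le> norm (x - y)" and AA: "x \<in> A \<or> y \<in> A"
        using False B_subset_A sep[of x y] sep[of y x] by (auto simp: norm_minus_commute)
      have "c * kern (x - y) \<le> \<bar>c\<bar> * far_kernel (x - y)"
        using d by (auto simp: far_kernel_def intro: mult_right_mono)
      also have "\<dots> \<le> ?far (x, y)" using AA False by auto
      finally show ?thesis using far[of x y] G(2)[of "(x, y)"] by linarith
    next
      case False
      then show ?thesis using F0 G(2)[of "(x, y)"] nn[of "(x, y)"] by simp
    qed
  qed
  then show "AE z in lborel. norm (F z) \<le> norm (G z + ?far z)"
    using G(2) nn by (intro AE_I2) (auto simp del: norm_mult simp: abs_of_nonneg add_nonneg_nonneg)
qed measurable

text \<open>Product rule: the difference of \<open>\<eta> * v\<close> is \<open>\<eta> x\<close>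
  times the difference of \<open>v\<close> plus \<open>v y\<close> times the difference of
  \<open>\<eta>\<close>. The second part is Lipschitz and is absorbed by \<open>near_kernel\<close>;
  distant pairs need only the bound on \<open>v\<close>.\<close>

lemma finite_energy_cutoff:
  fixes v :: "'a \<Rightarrow> real"
  assumes [measurable]: "v \<in> borel_measurable borel"
    and M: "\<And>x. \<bar>v x\<bar> \<le> M" and fin: "finite_energy s p A v"
  shows "finite_energy s p UNIV (\<lambda>x. \<eta> x * v x)"
  unfolding finite_energy_def
proof (rule integrable_pairs)
  let ?G = "\<lambda>z. 2 powr p * energy_density s p A v z
      + 2 powr p * (M / \<rho>) powr p * (indicator A (fst z) * near_kernel (fst z - snd z))"
  show "integrable lborel ?G"
    using fin has_bochner_integral_fst_kernel[OF integrable_indicator_A _ integrable_near]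
    by (auto simp: finite_energy_def has_bochner_integral_iff)
  have M0: "0 \<le> M" using M[of undefined] by simp
  show "0 \<le> ?G z" for z by simp
  have ff: "\<bar>\<eta> x * v x\<bar> \<le> M" for x
    using M[of x] \<eta>_nonneg[of x] \<eta>_le_1[of x] M0 mult_mono[of "\<eta> x" 1 "\<bar>v x\<bar>" M] by (simp add: abs_mult)
  fix x y
  show "\<bar>energy_density s p UNIV (\<lambda>x. \<eta> x * v x) (x, y)\<bar> \<le> (2 * M) powr p * kern (x - y)"
    using ff[of x] ff[of y] p by (auto simp: energy_density_def intro!: mult_right_mono powr_mono2)
  show "energy_density s p UNIV (\<lambda>x. \<eta> x * v x) (x, y) = 0" if "x \<notin> B" "y \<notin> B"
    using off that by (simp add: energy_density_def)
  assume xy: "x \<in> A" "y \<in> A"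
  have e: "\<eta> x * v x - \<eta> y * v y = \<eta> x * (v x - v y) + v y * (\<eta> x - \<eta> y)"
    by (simp add: algebra_simps)
  have "\<bar>\<eta> x * v x - \<eta> y * v y\<bar> \<le> \<bar>\<eta> x * (v x - v y)\<bar> + \<bar>v y * (\<eta> x - \<eta> y)\<bar>"
    unfolding e by (rule abs_triangle_ineq)
  also have "\<dots> \<le> 1 * \<bar>v x - v y\<bar> + M * (norm (x - y) / \<rho>)"
    unfolding abs_mult using \<eta>_nonneg \<eta>_le_1 M lip M0 by (intro add_mono mult_mono) auto
  finally have "\<bar>\<eta> x * v x - \<eta> y * v y\<bar> powr p \<le> (\<bar>v x - v y\<bar> + M * (norm (x - y) / \<rho>)) powr p"
    using p by (intro powr_mono2) auto
  also have "\<dots> \<le> 2 powr p * (\<bar>v x - v y\<bar> powr p + (M * (norm (x - y) / \<rho>)) powr p)"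
    using p M0 \<rho> by (intro powr_add_le_double) auto
  also have "(M * (norm (x - y) / \<rho>)) powr p = (M / \<rho>) powr p * norm (x - y) powr p"
    by (simp add: powr_mult[symmetric])
  finally have "\<bar>\<eta> x * v x - \<eta> y * v y\<bar> powr p * kern (x - y) \<le>
     2 powr p * (\<bar>v x - v y\<bar> powr p + (M / \<rho>) powr p * norm (x - y) powr p) * kern (x - y)"
    by (rule mult_right_mono) simp
  also have "\<dots> = 2 powr p * (\<bar>v x - v y\<bar> powr p * kern (x - y))
      + 2 powr p * (M / \<rho>) powr p * (norm (x - y) powr p * kern (x - y))"
    by (simp add: algebra_simps)
  finally show "\<bar>energy_density s p UNIV (\<lambda>x. \<eta> x * v x) (x, y)\<bar> \<le> ?G (x, y)"
    unfolding norm_powr_kern using xy diam by (simp add: near_kernel_def energy_density_def mult.assoc)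
qed (auto intro!: energy_density_measurable)

text \<open>On \<open>A \<times> A\<close> Young's inequality with weight 1 separates the energies
  of \<open>u\<close> and \<open>\<phi>\<close>; for all other pairs the bounds on both functions
  suffice.\<close>

lemma integrable_pairing_density:
  fixes k u \<phi> :: "'a \<Rightarrow> real"
  assumes [measurable]: "k \<in> borel_measurable borel" "u \<in> borel_measurable borel" "\<phi> \<in> borel_measurable borel"
    and k: "\<And>z. 0 \<le> k z" "\<And>z. k z \<le> \<Lambda> * kern z" and \<Lambda>: "0 \<le> \<Lambda>"
    and M: "\<And>x. \<bar>u x\<bar> \<le> M" and fin: "finite_energy s p A u"
    and M\<phi>: "\<And>x. \<bar>\<phi> x\<bar> \<le> M'" and fin\<phi>: "finite_energy s p UNIV \<phi>"
    and \<phi>: "\<And>x. x \<notin> B \<Longrightarrow> \<phi> x = 0"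
  shows "integrable lborel (pairing_density p k u \<phi>)"
proof (rule integrable_pairs)
  let ?G = "\<lambda>z. \<Lambda> * (energy_density s p A u z + energy_density s p UNIV \<phi> z)"
  show "integrable lborel ?G"
    using fin fin\<phi> by (simp add: finite_energy_def)
  show "0 \<le> ?G z" for z using \<Lambda> by simp
  fix x y
  have abs: "\<bar>pairing_density p k u \<phi> (x, y)\<bar> = \<bar>u x - u y\<bar> powr (p - 1) * \<bar>\<phi> x - \<phi> y\<bar> * k (x - y)"
    using k by (simp add: pairing_density_def abs_mult abs_signed_powr)
  have "\<bar>u x - u y\<bar> powr (p - 1) * \<bar>\<phi> x - \<phi> y\<bar> * k (x - y)
      \<le> (2 * M) powr (p - 1) * (2 * M') * (\<Lambda> * kern (x - y))"
    using M[of x] M[of y] M\<phi>[of x] M\<phi>[of y] k p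
    by (intro mult_mono powr_mono2 mult_nonneg_nonneg) auto
  then show "\<bar>pairing_density p k u \<phi> (x, y)\<bar> \<le> ((2 * M) powr (p - 1) * (2 * M') * \<Lambda>) * kern (x - y)"
    unfolding abs by (simp add: mult.assoc)
  show "pairing_density p k u \<phi> (x, y) = 0" if "x \<notin> B" "y \<notin> B"
    using that \<phi> by (simp add: pairing_density_def)
  assume xy: "x \<in> A" "y \<in> A"
  have "\<bar>u x - u y\<bar> powr (p - 1) * \<bar>\<phi> x - \<phi> y\<bar> * k (x - y)
      \<le> (\<bar>u x - u y\<bar> powr p + \<bar>\<phi> x - \<phi> y\<bar> powr p) * (\<Lambda> * kern (x - y))"
    using k young_weighted[of "\<bar>u x - u y\<bar>" "\<bar>\<phi> x - \<phi> y\<bar>" 1 p] p by (intro mult_mono) auto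
  then show "\<bar>pairing_density p k u \<phi> (x, y)\<bar> \<le> ?G (x, y)"
    unfolding abs using xy by (simp add: energy_density_def algebra_simps)
qed measurable

text \<open>On \<open>A \<times> A\<close> the test difference is split as
  \<open>\<eta> x * w x - \<eta> y * w y = (w x - w y) * (\<eta> x + \<eta> y) / 2 + (w x + w y) * (\<eta> x - \<eta> y) / 2\<close>: the first
  half is coercive, and in the second the factor \<open>\<eta> x - \<eta> y\<close> tames the kernel. For distant pairs this
  would bring in \<open>w\<close> outside \<open>A\<close>, where nothing is known, so there the product is kept as it is.\<close>

lemma energy_difference_le:
  fixes k u v :: "'a \<Rightarrow> real"
  defines "w \<equiv> \<lambda>x. v x - u x"
  defines "\<phi> \<equiv> \<lambda>x. \<eta> x * w x"
  assumes [measurable]: "k \<in> borel_measurable borel" "u \<in> borel_measurable borel" "v \<in> borel_measurable borel"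
    and k: "\<And>z. kern z / \<Lambda> \<le> k z" "\<And>z. k z \<le> \<Lambda> * kern z" and \<Lambda>: "0 < \<Lambda>"
    and Mu: "\<And>x. \<bar>u x\<bar> \<le> M" and finu: "finite_energy s p A u"
    and Mv: "\<And>x. \<bar>v x\<bar> \<le> M" and finv: "finite_energy s p A v"
    and t: "0 < t" and C: "(LINT x|lborel. indicator A x * \<bar>w x\<bar> powr p) \<le> C * t powr p"
  shows "(1/2) powr p / \<Lambda> * energy s p L w
    \<le> (LINT z|lborel. pairing_density p k v \<phi> z) - (LINT z|lborel. pairing_density p k u \<phi> z)
      + t * \<Lambda> * ((energy s p A u + energy s p A v + 2 * C * integral\<^sup>L lborel near_kernel) / \<rho>
          + 4 * (2 * M) powr (p - 1) * integral\<^sup>L lborel far_kernel * (measure lborel A + C))"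
proof -
  have M0: "0 \<le> M" using Mu[of undefined] by auto
  have [measurable]: "w \<in> borel_measurable borel" "\<phi> \<in> borel_measurable borel"
    unfolding w_def \<phi>_def by auto
  have Mw: "\<bar>w x\<bar> \<le> 2 * M" for x
    using Mu[of x] Mv[of x] by (auto simp: w_def)
  have finw: "finite_energy s p A w"
    unfolding w_def using finu finv p by (intro finite_energy_diff) auto
  have M\<phi>: "\<bar>\<phi> x\<bar> \<le> 2 * M" for x
    using Mw[of x] \<eta>_nonneg[of x] \<eta>_le_1[of x] M0 mult_mono[of "\<eta> x" 1 "\<bar>w x\<bar>" "2 * M"]
    by (simp add: abs_mult \<phi>_def)
  have fin\<phi>: "finite_energy s p UNIV \<phi>"
    unfolding \<phi>_def using Mw finw by (intro finite_energy_cutoff) auto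
  have \<phi>0: "\<phi> x = 0" if "x \<notin> B" for x using off[OF that] by (simp add: \<phi>_def)
  have k0: "0 \<le> k z" for z using k(1)[of z] \<Lambda> by (meson divide_nonneg_pos order_trans powr_ge_zero)
  have iu: "integrable lborel (pairing_density p k u \<phi>)"
    by (rule integrable_pairing_density[where M = M and M' = "2 * M"])
       (use k0 k \<Lambda> Mu finu M\<phi> fin\<phi> \<phi>0 in auto)
  have iv: "integrable lborel (pairing_density p k v \<phi>)"
    by (rule integrable_pairing_density[where M = M and M' = "2 * M"])
       (use k0 k \<Lambda> Mv finv M\<phi> fin\<phi> \<phi>0 in auto)
  let ?W = "\<lambda>x. indicator A x * \<bar>w x\<bar> powr p"
  let ?W1 = "\<lambda>x. indicator A x * \<bar>w x\<bar>"
  have iW: "integrable lborel ?W"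
  proof (rule Bochner_Integration.integrable_bound)
    show "integrable lborel (\<lambda>x. (2 * M) powr p * indicator A x)"
      using integrable_indicator_A by simp
    show "AE x in lborel. norm (?W x) \<le> norm ((2 * M) powr p * indicator A x :: real)"
      using Mw p by (intro AE_I2) (auto simp: indicator_def intro!: powr_mono2)
  qed auto
  have iW1: "integrable lborel ?W1"
  proof (rule Bochner_Integration.integrable_bound)
    show "integrable lborel (\<lambda>x. (2 * M) * indicator A x)"
      using integrable_indicator_A by simp
    show "AE x in lborel. norm (?W1 x) \<le> norm ((2 * M) * indicator A x :: real)"
      using Mw M0 by (intro AE_I2) (auto simp: indicator_def)
  qed auto
  \<comment> \<open>The tail sees the first power of \<open>w\<close>. The pointwise bound of
    \<open>\<bar>w x\<bar>\<close> by \<open>t * (1 + \<bar>w x / t\<bar> powr p)\<close> makes its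
    mass on \<open>A\<close> a multiple of \<open>t\<close>.\<close>
  have W1: "integral\<^sup>L lborel ?W1 \<le> t * (measure lborel A + C)"
  proof -
    have "integral\<^sup>L lborel ?W1 \<le> (LINT x|lborel. t * (indicator A x + ?W x / t powr p))"
    proof (rule integral_mono[OF iW1])
      show "integrable lborel (\<lambda>x. t * (indicator A x + ?W x / t powr p))"
        using iW integrable_indicator_A by simp
      fix x
      show "?W1 x \<le> t * (indicator A x + ?W x / t powr p)"
        using young_weighted[of 1 "\<bar>w x\<bar>" t p] t p by (auto simp: indicator_def powr_divide)
    qed
    also have "\<dots> = t * (measure lborel A + integral\<^sup>L lborel ?W / t powr p)"
      using iW integrable_indicator_A by simp
    also have "\<dots> \<le> t * (measure lborel A + C)"
      using C t by (intro mult_left_mono add_left_mono) (auto simp: divide_le_eq)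
    finally show ?thesis .
  qed
  \<comment> \<open>Bounds the difference of the two nonlinearities, whose arguments are at most
    \<open>2 * M\<close> in absolute value.\<close>
  let ?b = "2 * (2 * M) powr (p - 1)"
  \<comment> \<open>Majorant of all terms that are not coercive: the part with
    \<open>t / \<rho>\<close> comes from the Lipschitz cutoff on \<open>A \<times> A\<close>, the
    part with \<open>?b\<close> from pairs at distance at least \<open>\<rho>\<close>.\<close>
  let ?E = "\<lambda>z. t / \<rho> * (energy_density s p A v z + energy_density s p A u z
        + (?W (fst z) * near_kernel (fst z - snd z) + ?W (snd z) * near_kernel (fst z - snd z)) / t powr p)
      + ?b * (?W1 (fst z) * far_kernel (fst z - snd z) + ?W1 (snd z) * far_kernel (fst z - snd z))"
  note n1 = has_bochner_integral_fst_kernel[OF iW _ integrable_near]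
  note n2 = has_bochner_integral_snd_kernel[OF iW _ integrable_near]
  note n3 = has_bochner_integral_fst_kernel[OF iW1 _ integrable_far]
  note n4 = has_bochner_integral_snd_kernel[OF iW1 _ integrable_far]
  have hE: "has_bochner_integral lborel ?E (t / \<rho> * (energy s p A v + energy s p A u
        + (integral\<^sup>L lborel ?W * integral\<^sup>L lborel near_kernel + integral\<^sup>L lborel ?W * integral\<^sup>L lborel near_kernel) / t powr p)
      + ?b * (integral\<^sup>L lborel ?W1 * integral\<^sup>L lborel far_kernel + integral\<^sup>L lborel ?W1 * integral\<^sup>L lborel far_kernel))"
    using finu finv unfolding finite_energy_def energy_def
    by (intro has_bochner_integral_add has_bochner_integral_mult_right has_bochner_integral_divide_zero n1 n2 n3 n4
        has_bochner_integral_integrable) auto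
  have nn: "0 \<le> ?E z" for z
    using t \<rho> by (intro add_nonneg_nonneg mult_nonneg_nonneg divide_nonneg_nonneg) auto
  have pw: "(1/2) powr p / \<Lambda> * energy_density s p L w (x, y)
     \<le> pairing_density p k v \<phi> (x, y) - pairing_density p k u \<phi> (x, y) + \<Lambda> * ?E (x, y)" for x y
  proof -
    define D where "D = signed_powr p (v x - v y) - signed_powr p (u x - u y)"
    have pd: "pairing_density p k v \<phi> (x, y) - pairing_density p k u \<phi> (x, y) = D * k (x - y) * (\<phi> x - \<phi> y)"
      by (simp add: pairing_density_def D_def algebra_simps)
    have D1: "\<bar>D\<bar> \<le> \<bar>v x - v y\<bar> powr (p - 1) + \<bar>u x - u y\<bar> powr (p - 1)"
      unfolding D_def by (rule order_trans[OF abs_triangle_ineq4]) (simp add: abs_signed_powr)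
    have D2: "\<bar>D\<bar> \<le> ?b"
    proof -
      have "\<bar>v x - v y\<bar> powr (p - 1) \<le> (2 * M) powr (p - 1)" "\<bar>u x - u y\<bar> powr (p - 1) \<le> (2 * M) powr (p - 1)"
        using Mu[of x] Mu[of y] Mv[of x] Mv[of y] p by (auto intro!: powr_mono2)
      then show ?thesis using D1 by simp
    qed
    have far: "0 \<le> pairing_density p k v \<phi> (x, y) - pairing_density p k u \<phi> (x, y) + \<Lambda> * ?E (x, y)"
      if "\<rho> \<le> norm (x - y)" "\<bar>\<phi> x - \<phi> y\<bar> \<le> ?W1 x + ?W1 y"
    proof -
      have "\<bar>D * k (x - y) * (\<phi> x - \<phi> y)\<bar> = \<bar>D\<bar> * k (x - y) * \<bar>\<phi> x - \<phi> y\<bar>"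
        using k0 by (simp add: abs_mult)
      also have "\<dots> \<le> ?b * (\<Lambda> * kern (x - y)) * (?W1 x + ?W1 y)"
        using D2 k k0 \<Lambda> that by (intro mult_mono) auto
      also have "\<dots> = \<Lambda> * (?b * (?W1 x * far_kernel (x - y) + ?W1 y * far_kernel (x - y)))"
        using that by (simp add: far_kernel_def algebra_simps)
      also have "\<dots> \<le> \<Lambda> * ?E (x, y)"
        using t \<rho> \<Lambda> by (intro mult_left_mono) (auto intro!: add_nonneg_nonneg mult_nonneg_nonneg divide_nonneg_nonneg)
      finally show ?thesis unfolding pd by linarith
    qed
    show ?thesis
    proof (cases "x \<in> A \<and> y \<in> A")
      case True
      have Dw: "(1/2) powr p * \<bar>w x - w y\<bar> powr p \<le> D * (w x - w y)"
        using signed_powr_strongly_monotone[OF p, of "v x - v y" "u x - u y"]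
        by (simp add: D_def w_def algebra_simps)
      then have Dw0: "0 \<le> D * (w x - w y)" by (rule order_trans[rotated]) simp
      have split: "\<phi> x - \<phi> y = (w x - w y) * ((\<eta> x + \<eta> y) / 2) + (w x + w y) * (\<eta> x - \<eta> y) / 2"
        by (simp add: \<phi>_def field_simps)
      have "(1/2) powr p / \<Lambda> * energy_density s p L w (x, y)
          = (indicator L x * indicator L y) * ((1/2) powr p * \<bar>w x - w y\<bar> powr p) * (kern (x - y) / \<Lambda>)"
        by (simp add: energy_density_def)
      also have "\<dots> \<le> ((\<eta> x + \<eta> y) / 2) * (D * (w x - w y)) * k (x - y)"
      proof -
        have le: "i * P * (kern (x - y) / \<Lambda>) \<le> e * Q * k (x - y)"
          if "0 \<le> P" "P \<le> Q" "0 \<le> i" "i \<le> e" for i e P Q :: real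
          using that k \<Lambda> by (intro mult_mono mult_nonneg_nonneg) auto
        have "indicator L x * indicator L y \<le> (\<eta> x + \<eta> y) / 2"
          using \<eta>_nonneg on by (auto simp: indicator_def)
        then show ?thesis by (intro le Dw) auto
      qed
      finally have main: "(1/2) powr p / \<Lambda> * energy_density s p L w (x, y)
          \<le> D * k (x - y) * ((w x - w y) * ((\<eta> x + \<eta> y) / 2))" by (simp add: algebra_simps)
      \<comment> \<open>The factor \<open>norm (x - y)\<close>, gained from the Lipschitz bound on
        \<open>\<eta>\<close>, is grouped with \<open>w\<close> and not with the power of
        \<open>a\<close>: it then appears as \<open>norm (x - y) powr p\<close> and turns
        \<open>kern\<close> into \<open>near_kernel\<close>, while \<open>a powr p\<close> keeps
        \<open>kern\<close> and is an energy.\<close>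
      have Y: "a powr (p - 1) * (\<bar>w q\<bar> * norm (x - y)) \<le> t * (a powr p + \<bar>w q\<bar> powr p * norm (x - y) powr p / t powr p)"
        if "0 \<le> a" for a q
        using young_weighted[of a "\<bar>w q\<bar> * norm (x - y)" t p] that t p by (simp add: powr_divide powr_mult)
      have "\<bar>D * ((w x + w y) * (\<eta> x - \<eta> y) / 2)\<bar> = \<bar>D\<bar> * \<bar>w x + w y\<bar> * \<bar>\<eta> x - \<eta> y\<bar> / 2"
        by (simp add: abs_mult)
      also have "\<dots> \<le> (\<bar>v x - v y\<bar> powr (p - 1) + \<bar>u x - u y\<bar> powr (p - 1)) * (\<bar>w x\<bar> + \<bar>w y\<bar>) * (norm (x - y) / \<rho>) / 2"
        using D1 lip \<rho> by (intro divide_right_mono mult_mono) auto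
      also have "\<dots> = 1 / (2 * \<rho>) *
            (\<bar>v x - v y\<bar> powr (p - 1) * (\<bar>w x\<bar> * norm (x - y)) + \<bar>v x - v y\<bar> powr (p - 1) * (\<bar>w y\<bar> * norm (x - y))
           + \<bar>u x - u y\<bar> powr (p - 1) * (\<bar>w x\<bar> * norm (x - y)) + \<bar>u x - u y\<bar> powr (p - 1) * (\<bar>w y\<bar> * norm (x - y)))"
        using \<rho> by (simp add: field_simps)
      also have "\<dots> \<le> 1 / (2 * \<rho>) *
            (t * (\<bar>v x - v y\<bar> powr p + \<bar>w x\<bar> powr p * norm (x - y) powr p / t powr p) + t * (\<bar>v x - v y\<bar> powr p + \<bar>w y\<bar> powr p * norm (x - y) powr p / t powr p)
           + t * (\<bar>u x - u y\<bar> powr p + \<bar>w x\<bar> powr p * norm (x - y) powr p / t powr p) + t * (\<bar>u x - u y\<bar> powr p + \<bar>w y\<bar> powr p * norm (x - y) powr p / t powr p))"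
        using \<rho> by (intro mult_left_mono add_mono Y) auto
      also have "\<dots> = t / \<rho> * (\<bar>v x - v y\<bar> powr p + \<bar>u x - u y\<bar> powr p
          + (\<bar>w x\<bar> powr p * norm (x - y) powr p + \<bar>w y\<bar> powr p * norm (x - y) powr p) / t powr p)" (is "_ = ?rhs")
        using \<rho> t by (simp add: field_simps)
      finally have le: "\<bar>D * ((w x + w y) * (\<eta> x - \<eta> y) / 2)\<bar> \<le> ?rhs" .
      have "\<bar>D * k (x - y) * ((w x + w y) * (\<eta> x - \<eta> y) / 2)\<bar> = k (x - y) * \<bar>D * ((w x + w y) * (\<eta> x - \<eta> y) / 2)\<bar>"
        using k0 by (simp add: abs_mult)
      also have "\<dots> \<le> (\<Lambda> * kern (x - y)) * ?rhs"
        using k k0 le \<Lambda> by (intro mult_mono) auto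
      also have "\<dots> = \<Lambda> * (t / \<rho> * (\<bar>v x - v y\<bar> powr p * kern (x - y) + \<bar>u x - u y\<bar> powr p * kern (x - y)
          + (\<bar>w x\<bar> powr p * (norm (x - y) powr p * kern (x - y)) + \<bar>w y\<bar> powr p * (norm (x - y) powr p * kern (x - y))) / t powr p))"
        using \<rho> t by (simp add: field_simps)
      also have "\<dots> \<le> \<Lambda> * ?E (x, y)"
        unfolding norm_powr_kern using True diam \<Lambda> M0
        by (intro mult_left_mono) (auto simp: energy_density_def near_kernel_def)
      finally have "\<bar>D * k (x - y) * ((w x + w y) * (\<eta> x - \<eta> y) / 2)\<bar> \<le> \<Lambda> * ?E (x, y)" .
      then show ?thesis using main unfolding pd split distrib_left by linarith
    next
      case False
      \<comment> \<open>\<open>L\<close> lies inside \<open>A\<close>, so the left side vanishes and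
        only nonnegativity of the right side is at stake.\<close>
      then have "x \<notin> L \<or> y \<notin> L" using L_subset_B B_subset_A by blast
      then have L0: "energy_density s p L w (x, y) = 0" by (auto simp: energy_density_def)
      show ?thesis
      proof (cases "x \<in> B \<or> y \<in> B")
        case True
        have \<phi>W: "\<bar>\<phi> x\<bar> \<le> ?W1 x" for x
        proof (cases "x \<in> A")
          case True
          then show ?thesis
            using \<eta>_nonneg[of x] \<eta>_le_1[of x] by (simp add: \<phi>_def abs_mult mult_left_le_one_le)
        next
          case False
          then have "\<phi> x = 0" using \<phi>0 B_subset_A by blast
          then show ?thesis by simp
        qed
        have "\<rho> \<le> norm (x - y)"
          using True False B_subset_A sep[of x y] sep[of y x] by (auto simp: norm_minus_commute)
        moreover have "\<bar>\<phi> x - \<phi> y\<bar> \<le> ?W1 x + ?W1 y"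
          using \<phi>W[of x] \<phi>W[of y] by linarith
        ultimately show ?thesis using far L0 by simp
      next
        case False
        then have "pairing_density p k v \<phi> (x, y) = 0" "pairing_density p k u \<phi> (x, y) = 0"
          using \<phi>0 by (auto simp: pairing_density_def)
        then show ?thesis using nn[of "(x, y)"] \<Lambda> L0 by simp
      qed
    qed
  qed
  have iE: "integrable lborel ?E" and vE: "integral\<^sup>L lborel ?E = t / \<rho> * (energy s p A v + energy s p A u
        + (integral\<^sup>L lborel ?W * integral\<^sup>L lborel near_kernel + integral\<^sup>L lborel ?W * integral\<^sup>L lborel near_kernel) / t powr p)
      + ?b * (integral\<^sup>L lborel ?W1 * integral\<^sup>L lborel far_kernel + integral\<^sup>L lborel ?W1 * integral\<^sup>L lborel far_kernel)"
    using hE by (auto simp: has_bochner_integral_iff)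
  have N0: "0 \<le> integral\<^sup>L lborel near_kernel" "0 \<le> integral\<^sup>L lborel far_kernel" by simp_all
  have "(1/2) powr p / \<Lambda> * energy s p L w = (LINT z|lborel. (1/2) powr p / \<Lambda> * energy_density s p L w z)"
    by (simp add: energy_def)
  also have "\<dots> \<le> (LINT z|lborel. pairing_density p k v \<phi> z - pairing_density p k u \<phi> z + \<Lambda> * ?E z)"
  proof (rule integral_mono)
    show "integrable lborel (\<lambda>z. (1/2) powr p / \<Lambda> * energy_density s p L w z)"
      using finite_energy_subset(1)[OF finw] B_subset_A L_subset_B by (auto simp: finite_energy_def)
    show "integrable lborel (\<lambda>z. pairing_density p k v \<phi> z - pairing_density p k u \<phi> z + \<Lambda> * ?E z)"
      by (intro Bochner_Integration.integrable_add Bochner_Integration.integrable_diff iu iv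
          integrable_mult_right iE)
  qed (use pw in auto)
  also have "\<dots> = (LINT z|lborel. pairing_density p k v \<phi> z) - (LINT z|lborel. pairing_density p k u \<phi> z)
      + \<Lambda> * integral\<^sup>L lborel ?E"
    by (subst Bochner_Integration.integral_add[OF Bochner_Integration.integrable_diff[OF iv iu] integrable_mult_right[OF iE]])
       (simp only: Bochner_Integration.integral_diff[OF iv iu] integral_mult_right_zero)
  finally have main: "(1/2) powr p / \<Lambda> * energy s p L w
      \<le> (LINT z|lborel. pairing_density p k v \<phi> z) - (LINT z|lborel. pairing_density p k u \<phi> z)
      + \<Lambda> * integral\<^sup>L lborel ?E" .
  have E_le: "integral\<^sup>L lborel ?E \<le> t / \<rho> * (energy s p A v + energy s p A u
        + (C * integral\<^sup>L lborel near_kernel + C * integral\<^sup>L lborel near_kernel))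
      + ?b * (t * (measure lborel A + C) * integral\<^sup>L lborel far_kernel + t * (measure lborel A + C) * integral\<^sup>L lborel far_kernel)"
  proof -
    have "integral\<^sup>L lborel ?W * integral\<^sup>L lborel near_kernel \<le> C * t powr p * integral\<^sup>L lborel near_kernel"
      using C N0 by (intro mult_right_mono) auto
    then have "(integral\<^sup>L lborel ?W * integral\<^sup>L lborel near_kernel + integral\<^sup>L lborel ?W * integral\<^sup>L lborel near_kernel) / t powr p
       \<le> C * integral\<^sup>L lborel near_kernel + C * integral\<^sup>L lborel near_kernel"
      using t by (simp add: field_simps)
    moreover have "integral\<^sup>L lborel ?W1 * integral\<^sup>L lborel far_kernel \<le> t * (measure lborel A + C) * integral\<^sup>L lborel far_kernel"
      using W1 N0 by (intro mult_right_mono) auto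
    ultimately show ?thesis unfolding vE
      using t \<rho> by (intro add_mono mult_left_mono order_refl) auto
  qed
  have alg: "\<Lambda> * (t / \<rho> * (a + b + (C * c + C * c)) + 2 * d * (t * (e + C) * f + t * (e + C) * f))
      = t * \<Lambda> * ((b + a + 2 * C * c) / \<rho> + 4 * d * f * (e + C))" for a b c d e f
    using \<rho> by (simp add: field_simps)
  have "\<Lambda> * integral\<^sup>L lborel ?E
      \<le> t * \<Lambda> * ((energy s p A u + energy s p A v + 2 * C * integral\<^sup>L lborel near_kernel) / \<rho>
          + 4 * (2 * M) powr (p - 1) * integral\<^sup>L lborel far_kernel * (measure lborel A + C))"
    unfolding alg[symmetric] using \<Lambda> by (intro mult_left_mono E_le) auto
  with main show ?thesis by linarith
qed

end

section \<open>Nikolskii estimates\<close>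

abbreviation norm_mass ::
  "real \<Rightarrow> 'a::euclidean_space set \<Rightarrow> ('a \<Rightarrow> 'b::euclidean_space) \<Rightarrow> ennreal" where
  "norm_mass p L v \<equiv> \<integral>\<^sup>+x. ennreal (indicator L x * norm (v x) powr p) \<partial>lborel"

abbreviation abs_mass :: "real \<Rightarrow> 'a::euclidean_space set \<Rightarrow> ('a \<Rightarrow> real) \<Rightarrow> ennreal" where
  "abs_mass p L v \<equiv> \<integral>\<^sup>+x. ennreal (indicator L x * \<bar>v x\<bar> powr p) \<partial>lborel"

text \<open>The weight \<open>l\<close> of \<open>powr_add_le_split\<close> is carried along, since
  \<open>Lp_geometric_limit\<close> needs a particular value of it; elsewhere \<open>1/2\<close> is
  enough.\<close>

lemma norm_mass_add_le:
  fixes f g :: "'a::euclidean_space \<Rightarrow> 'b::euclidean_space"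
  assumes [measurable]: "L \<in> sets borel" "f \<in> borel_measurable borel" "g \<in> borel_measurable borel"
    and p: "0 \<le> p" and l: "0 < l" "l < 1"
  shows "norm_mass p L (\<lambda>x. f x + g x)
    \<le> ennreal ((1 / l) powr p) * norm_mass p L f + ennreal ((1 / (1 - l)) powr p) * norm_mass p L g"
proof -
  have "norm_mass p L (\<lambda>x. f x + g x)
    \<le> (\<integral>\<^sup>+x. ennreal ((1 / l) powr p) * ennreal (indicator L x * norm (f x) powr p)
       + ennreal ((1 / (1 - l)) powr p) * ennreal (indicator L x * norm (g x) powr p) \<partial>lborel)"
  proof (rule nn_integral_mono)
    fix x
    have "norm (f x + g x) powr p \<le> (norm (f x) + norm (g x)) powr p"
      using p by (intro powr_mono2 norm_triangle_ineq) auto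
    also have "\<dots> \<le> (norm (f x) / l) powr p + (norm (g x) / (1 - l)) powr p"
      using p l by (intro powr_add_le_split) auto
    also have "\<dots> = (1 / l) powr p * norm (f x) powr p + (1 / (1 - l)) powr p * norm (g x) powr p"
      using l by (simp add: powr_divide)
    finally show "ennreal (indicator L x * norm (f x + g x) powr p) \<le>
      ennreal ((1 / l) powr p) * ennreal (indicator L x * norm (f x) powr p)
       + ennreal ((1 / (1 - l)) powr p) * ennreal (indicator L x * norm (g x) powr p)"
      by (cases "x \<in> L") (auto simp: ennreal_mult[symmetric] ennreal_plus[symmetric] simp del: ennreal_plus intro!: ennreal_leI)
  qed
  also have "\<dots> = ennreal ((1 / l) powr p) * norm_mass p L f + ennreal ((1 / (1 - l)) powr p) * norm_mass p L g"
    by (simp add: nn_integral_cmult nn_integral_add)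
  finally show ?thesis .
qed

lemmas abs_mass_add_le = norm_mass_add_le[where 'b = real, unfolded real_norm_def]

text \<open>Replaces Hoelder's inequality:
  \<open>\<bar>f x\<bar> \<le> t + t * \<bar>f x / t\<bar> powr p\<close> pointwise, integrated over
  a set of finite measure.\<close>

lemma nn_integral_abs_le_of_mass:
  fixes f :: "'a::euclidean_space \<Rightarrow> real"
  assumes [measurable]: "L \<in> sets borel" "f \<in> borel_measurable borel"
    and L: "emeasure lborel L < \<infinity>" and p: "1 \<le> p" and t: "0 < t" and C: "0 \<le> C"
    and mass: "abs_mass p L f \<le> ennreal (C * t powr p)"
  shows "(\<integral>\<^sup>+x. ennreal (indicator L x * \<bar>f x\<bar>) \<partial>lborel) \<le> ennreal ((measure lborel L + C) * t)"
proof -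
  have "(\<integral>\<^sup>+x. ennreal (indicator L x * \<bar>f x\<bar>) \<partial>lborel)
    \<le> (\<integral>\<^sup>+x. ennreal t * indicator L x + ennreal (t / t powr p) * ennreal (indicator L x * \<bar>f x\<bar> powr p) \<partial>lborel)"
  proof (rule nn_integral_mono)
    fix x
    have "\<bar>f x\<bar> \<le> t + t / t powr p * \<bar>f x\<bar> powr p"
      using young_weighted[of 1 "\<bar>f x\<bar>" t p] t p by (simp add: powr_divide distrib_left)
    then show "ennreal (indicator L x * \<bar>f x\<bar>)
      \<le> ennreal t * indicator L x + ennreal (t / t powr p) * ennreal (indicator L x * \<bar>f x\<bar> powr p)"
      using t by (cases "x \<in> L") (auto simp: ennreal_mult[symmetric] ennreal_plus[symmetric] simp del: ennreal_plus intro!: ennreal_leI)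
  qed
  also have "\<dots> = ennreal t * emeasure lborel L + ennreal (t / t powr p) * abs_mass p L f"
    by (simp add: nn_integral_cmult nn_integral_add)
  also have "\<dots> \<le> ennreal t * ennreal (measure lborel L) + ennreal (t / t powr p) * ennreal (C * t powr p)"
    using L by (intro add_mono mult_left_mono mass) (auto simp: emeasure_eq_ennreal_measure)
  also have "\<dots> = ennreal ((measure lborel L + C) * t)"
    using C t by (simp add: ennreal_mult[symmetric] ennreal_plus[symmetric] algebra_simps del: ennreal_plus)
  finally show ?thesis .
qed

text \<open>Local Nikolskii regularity of order \<open>\<sigma>\<close> in L^p (a Besov condition
  with third index infinity), stated for p-th powers. \<open>v\<close> is total, so
  \<open>x + h\<close> may leave \<open>L\<close>. The nonnegative integral makes sense before any
  integrability is known, which the gradient needs.\<close>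

definition nikolskii ::
  "'a::euclidean_space set \<Rightarrow> real \<Rightarrow> real \<Rightarrow> ('a \<Rightarrow> 'b::euclidean_space) \<Rightarrow> bool" where
  "nikolskii \<Omega> p \<sigma> v \<longleftrightarrow> (\<forall>L. compact L \<longrightarrow> L \<subseteq> \<Omega> \<longrightarrow>
     (\<exists>C \<delta>. 0 \<le> C \<and> 0 < \<delta> \<and> (\<forall>h. norm h \<le> \<delta> \<longrightarrow>
        norm_mass p L (\<lambda>x. v (x + h) - v x) \<le> ennreal (C * norm h powr (\<sigma> * p)))))"

lemma integrable_compact_bounded:
  fixes f :: "'a::euclidean_space \<Rightarrow> real"
  assumes "compact L" and [measurable]: "f \<in> borel_measurable borel" and f: "\<And>x. \<bar>f x\<bar> \<le> M"
  shows "integrable lborel (\<lambda>x. indicator L x * f x)"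
proof (rule Bochner_Integration.integrable_bound)
  show "integrable lborel (\<lambda>x. M * indicator L x)"
    using emeasure_compact_finite[OF assms(1)] borel_compact[OF assms(1)] by simp
  have [measurable]: "L \<in> sets borel" using assms(1) by (rule borel_compact)
  show "(\<lambda>x. indicator L x * f x) \<in> borel_measurable lborel" by measurable
  show "AE x in lborel. norm (indicator L x * f x) \<le> norm (M * indicator L x)"
    using f order_trans[OF abs_ge_zero f] by (intro AE_I2) (auto simp: indicator_def)
qed

lemma integrable_difference_powr:
  fixes u :: "'a::euclidean_space \<Rightarrow> real"
  assumes L: "compact L" and [measurable]: "u \<in> borel_measurable borel" and M: "\<And>x. \<bar>u x\<bar> \<le> M" and p: "0 \<le> p"
  shows "integrable lborel (\<lambda>x. indicator L x * \<bar>u (x + h) - u x\<bar> powr p)"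
proof (rule integrable_compact_bounded[OF L, where M = "(2 * M) powr p"])
  fix x
  show "\<bar>\<bar>u (x + h) - u x\<bar> powr p\<bar> \<le> (2 * M) powr p"
    using M[of x] M[of "x + h"] p by (auto intro!: powr_mono2)
qed auto

text \<open>A bounded function has finite difference integrals over compact sets, so the Bochner
  integral of the energy estimates may be used.\<close>

lemma nikolskii_bounded_iff:
  fixes u :: "'a::euclidean_space \<Rightarrow> real"
  assumes [measurable]: "u \<in> borel_measurable borel" and M: "\<And>x. \<bar>u x\<bar> \<le> M" and p: "0 \<le> p"
  shows "nikolskii \<Omega> p \<sigma> u \<longleftrightarrow> (\<forall>L. compact L \<longrightarrow> L \<subseteq> \<Omega> \<longrightarrow>
     (\<exists>C \<delta>. 0 \<le> C \<and> 0 < \<delta> \<and> (\<forall>h. norm h \<le> \<delta> \<longrightarrow>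
        (LINT x|lborel. indicator L x * \<bar>u (x + h) - u x\<bar> powr p) \<le> C * norm h powr (\<sigma> * p))))"
proof -
  have "norm_mass p L (\<lambda>x. u (x + h) - u x) \<le> ennreal (C * norm h powr (\<sigma> * p))
    \<longleftrightarrow> (LINT x|lborel. indicator L x * \<bar>u (x + h) - u x\<bar> powr p) \<le> C * norm h powr (\<sigma> * p)"
    if "compact L" "0 \<le> C" for L h C
    using integrable_difference_powr[OF that(1) assms, of h] that
    by (simp add: nn_integral_eq_integral ennreal_le_iff)
  then show ?thesis unfolding nikolskii_def by meson
qed

text \<open>The increment over \<open>h\<close> is averaged over the points \<open>y\<close> of the ball with diameter \<open>[x, x + h]\<close>.\<close>

lemma energy_controls_differences:
  fixes v :: "'a::euclidean_space \<Rightarrow> 'b::euclidean_space"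
  assumes p: "0 < p" and s: "0 \<le> s"
  shows "\<exists>C\<ge>0. \<forall>(v :: 'a \<Rightarrow> 'b) A L \<rho> h. v \<in> borel_measurable borel \<longrightarrow> A \<in> sets borel \<longrightarrow> L \<in> sets borel \<longrightarrow>
     finite_energy s p A v \<longrightarrow> (\<forall>x\<in>L. \<forall>y. norm (y - x) \<le> \<rho> \<longrightarrow> y \<in> A) \<longrightarrow> norm h \<le> \<rho> \<longrightarrow>
     norm_mass p L (\<lambda>x. v (x + h) - v x)
       \<le> ennreal (C * norm h powr (s * p) * energy s p A v)"
proof (intro exI conjI allI impI)
  let ?V = "measure lborel (cball (0::'a) (1/2))"
  let ?n = "real DIM('a)"
  let ?C = "2 * 2 powr p / ?V"
  have V: "0 < ?V" by (simp add: content_cball)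
  show "0 \<le> ?C" by simp
  fix v :: "'a \<Rightarrow> 'b" and A L :: "'a set" and \<rho> :: real and h :: 'a
  assume [measurable]: "v \<in> borel_measurable borel" "A \<in> sets borel" "L \<in> sets borel"
  assume fin: "finite_energy s p A v" and A: "\<forall>x\<in>L. \<forall>y. norm (y - x) \<le> \<rho> \<longrightarrow> y \<in> A" and h: "norm h \<le> \<rho>"
  show "norm_mass p L (\<lambda>x. v (x + h) - v x)
       \<le> ennreal (?C * norm h powr (s * p) * energy s p A v)"
  proof (cases "h = 0")
    case False
    define g where "g x = indicator L x * norm (v (x + h) - v x) powr p" for x
    define c where "c = ?V * norm h powr ?n"
    have c: "0 < c" using V False by (simp add: c_def)
    let ?B = "\<lambda>x. cball (x + h /\<^sub>R 2) (norm h / 2)"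
    let ?ed = "energy_density s p A v"
    have vol: "emeasure lborel (?B x) = ennreal c" for x
      using False by (subst emeasure_cball)
        (auto simp: c_def content_cball powr_realpow power_divide)
    have [measurable]: "?B x \<in> sets borel" for x by simp
    \<comment> \<open>\<open>2 powr p\<close> pays for the triangle inequality through
      \<open>y\<close>, \<open>1 / c\<close> is the average over the ball, and the power of
      \<open>norm h\<close> undoes the kernel: both endpoints are within \<open>norm h\<close> of
      \<open>y\<close>, so the kernel is at least \<open>norm h powr (- (n + s * p))\<close> off the
      diagonal.\<close>
    let ?K = "2 powr p * norm h powr (?n + s * p) / c"
    have [measurable]: "g \<in> borel_measurable borel" unfolding g_def[abs_def] by measurable
    have le: "g x / c * indicator (?B x) y \<le> ?K * (?ed (x, y) + ?ed (x + h, y))" for x y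
    proof (cases "x \<in> L \<and> y \<in> ?B x")
      case True
      have n2: "norm (h /\<^sub>R 2) = norm h / 2" by simp
      have yB: "norm (x + h /\<^sub>R 2 - y) \<le> norm h / 2" using True by (simp add: dist_norm)
      have "norm (x - y) \<le> norm (x + h /\<^sub>R 2 - y) + norm (h /\<^sub>R 2)"
        using norm_triangle_ineq4[of "x + h /\<^sub>R 2 - y" "h /\<^sub>R 2"] by (simp add: algebra_simps)
      then have xy: "norm (x - y) \<le> norm h" using yB n2 by simp
      have half: "h = h /\<^sub>R 2 + h /\<^sub>R 2"
        by (simp flip: scaleR_add_left)
      have "x + h - y = (x + h /\<^sub>R 2 - y) + h /\<^sub>R 2"
        using half by (simp add: algebra_simps)
      then have "norm (x + h - y) \<le> norm (x + h /\<^sub>R 2 - y) + norm (h /\<^sub>R 2)"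
        by (metis norm_triangle_ineq)
      then have xhy: "norm (x + h - y) \<le> norm h" using yB n2 by simp
      have inA: "x \<in> A" "y \<in> A" "x + h \<in> A"
      proof -
        have "norm (x - x) \<le> \<rho>" using order_trans[OF norm_ge_zero h] by simp
        then show "x \<in> A" using A True by blast
        have "norm (y - x) \<le> \<rho>" using xy h by (simp add: norm_minus_commute)
        then show "y \<in> A" using A True by blast
        have "norm (x + h - x) \<le> \<rho>" using h by simp
        then show "x + h \<in> A" using A True by blast
      qed
      have Q: "norm (v a - v y) powr p \<le> norm h powr (?n + s * p) * ?ed (a, y)"
        if "a \<in> A" "norm (a - y) \<le> norm h" for a
      proof (cases "a = y")
        case F: False
        have "1 = norm h powr (?n + s * p) * norm h powr (- (?n + s * p))"
          using False by (simp add: powr_add[symmetric] powr_zero_eq_one)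
        also have "\<dots> \<le> norm h powr (?n + s * p) * norm (a - y) powr (- (?n + s * p))"
          using F that p s by (intro mult_left_mono powr_mono2') (auto intro: order_trans[of _ 0])
        finally have "norm (v a - v y) powr p * 1
            \<le> norm (v a - v y) powr p * (norm h powr (?n + s * p) * norm (a - y) powr (- (?n + s * p)))"
          by (rule mult_left_mono) simp
        then show ?thesis using that inA by (simp add: energy_density_def algebra_simps)
      qed simp
      have "norm (v (x + h) - v x) powr p \<le> (norm (v x - v y) + norm (v (x + h) - v y)) powr p"
        using p norm_triangle_ineq4[of "v (x + h) - v y" "v x - v y"] by (intro powr_mono2) (auto simp: algebra_simps)
      also have "\<dots> \<le> 2 powr p * (norm (v x - v y) powr p + norm (v (x + h) - v y) powr p)"
        using p by (intro powr_add_le_double) auto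
      also have "\<dots> \<le> 2 powr p * (norm h powr (?n + s * p) * ?ed (x, y) + norm h powr (?n + s * p) * ?ed (x + h, y))"
        using inA xy xhy by (intro mult_left_mono add_mono Q) auto
      finally have "norm (v (x + h) - v x) powr p / c
         \<le> 2 powr p * (norm h powr (?n + s * p) * ?ed (x, y) + norm h powr (?n + s * p) * ?ed (x + h, y)) / c"
        using c by (intro divide_right_mono) auto
      then show ?thesis using True by (simp add: g_def algebra_simps add_divide_distrib)
    next
      case F: False
      have "0 \<le> ?K * (?ed (x, y) + ?ed (x + h, y))" using c by simp
      then show ?thesis using F by (auto simp: g_def)
    qed
    \<comment> \<open>\<open>g x\<close> is written as its own mean over the ball, which introduces
      the second variable of the energy.\<close>
    have one: "(\<integral>\<^sup>+y. ennreal (g x / c * indicator (?B x) y) \<partial>lborel) = ennreal (g x)" for x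
    proof -
      have "(\<integral>\<^sup>+y. ennreal (g x / c * indicator (?B x) y) \<partial>lborel) = (\<integral>\<^sup>+y. ennreal (g x / c) * indicator (?B x) y \<partial>lborel)"
        using c by (intro nn_integral_cong) (auto simp: indicator_def)
      also have "\<dots> = ennreal (g x / c) * ennreal c"
        by (subst nn_integral_cmult_indicator, simp) (simp only: vol)
      also have "\<dots> = ennreal (g x)"
        using c by (simp add: ennreal_mult''[symmetric])
      finally show ?thesis .
    qed
    have ed: "(\<integral>\<^sup>+x. \<integral>\<^sup>+y. ennreal (?ed (x, y)) \<partial>lborel \<partial>lborel) = ennreal (energy s p A v)"
    proof -
      have "(\<integral>\<^sup>+x. \<integral>\<^sup>+y. ennreal (?ed (x, y)) \<partial>lborel \<partial>lborel) = (\<integral>\<^sup>+z. ennreal (?ed (fst z, snd z)) \<partial>lborel)"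
        by (rule nn_integral_lborel_pair[symmetric]) (simp add: case_prod_beta')
      then show ?thesis using fin
        by (simp add: nn_integral_eq_integral finite_energy_def energy_def)
    qed
    have [measurable]: "(\<lambda>x. \<integral>\<^sup>+y. ennreal (?ed (x, y)) \<partial>lborel) \<in> borel_measurable borel"
      using lborel.borel_measurable_nn_integral_fst[of "\<lambda>z. ennreal (?ed z)" lborel] by (simp add: lborel_prod)
    have "(\<integral>\<^sup>+x. ennreal (g x) \<partial>lborel) = (\<integral>\<^sup>+x. \<integral>\<^sup>+y. ennreal (g x / c * indicator (?B x) y) \<partial>lborel \<partial>lborel)"
      by (simp only: one)
    also have "\<dots> \<le> (\<integral>\<^sup>+x. \<integral>\<^sup>+y. ennreal ?K * (ennreal (?ed (x, y)) + ennreal (?ed (x + h, y))) \<partial>lborel \<partial>lborel)"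
      using c le by (intro nn_integral_mono) (auto simp: ennreal_mult[symmetric] ennreal_plus[symmetric] simp del: ennreal_plus intro!: ennreal_leI)
    also have "\<dots> = (\<integral>\<^sup>+x. ennreal ?K * ((\<integral>\<^sup>+y. ennreal (?ed (x, y)) \<partial>lborel) + (\<integral>\<^sup>+y. ennreal (?ed (x + h, y)) \<partial>lborel)) \<partial>lborel)"
      by (intro nn_integral_cong) (simp add: nn_integral_cmult nn_integral_add)
    also have "\<dots> = ennreal ?K * ((\<integral>\<^sup>+x. \<integral>\<^sup>+y. ennreal (?ed (x, y)) \<partial>lborel \<partial>lborel)
        + (\<integral>\<^sup>+x. \<integral>\<^sup>+y. ennreal (?ed (x + h, y)) \<partial>lborel \<partial>lborel))"
      by (simp add: nn_integral_cmult nn_integral_add)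
    also have "(\<integral>\<^sup>+x. \<integral>\<^sup>+y. ennreal (?ed (x + h, y)) \<partial>lborel \<partial>lborel) = (\<integral>\<^sup>+x. \<integral>\<^sup>+y. ennreal (?ed (x, y)) \<partial>lborel \<partial>lborel)"
      by (rule nn_integral_lborel_shift) measurable
    also have "ennreal ?K * ((\<integral>\<^sup>+x. \<integral>\<^sup>+y. ennreal (?ed (x, y)) \<partial>lborel \<partial>lborel) + (\<integral>\<^sup>+x. \<integral>\<^sup>+y. ennreal (?ed (x, y)) \<partial>lborel \<partial>lborel))
       = ennreal (?K * (energy s p A v + energy s p A v))"
      unfolding ed using c by (simp add: ennreal_mult[symmetric] ennreal_plus[symmetric] del: ennreal_plus)
    also have "?K * (energy s p A v + energy s p A v) = ?C * norm h powr (s * p) * energy s p A v"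
      using False V by (simp add: c_def powr_add field_simps)
    finally show ?thesis by (simp add: g_def)
  qed simp
qed

text \<open>Iterating \<open>u (x + h) - u x = (u (x + 2h) - u x) / 2 - (u (x + 2h) - 2 u (x + h) + u x) / 2\<close> up to
  scale \<open>\<delta>\<close>; for \<open>\<theta> < 1\<close> the resulting geometric series converges.\<close>

lemma first_difference_le_of_second_difference:
  fixes u :: "'a::euclidean_space \<Rightarrow> real"
  assumes L: "compact L" and [measurable]: "u \<in> borel_measurable borel" and M: "\<And>x. \<bar>u x\<bar> \<le> M"
    and p: "0 < p" and \<theta>: "0 \<le> \<theta>" "\<theta> < 1" and \<delta>: "0 < \<delta>" and C: "0 \<le> C"
    and second: "\<And>h. norm h \<le> \<delta> \<Longrightarrow>
      (LINT x|lborel. indicator L x * \<bar>(u (x + h + h) - u (x + h)) - (u (x + h) - u x)\<bar> powr p) \<le> C * norm h powr (\<theta> * p)"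
  shows "\<exists>C'\<ge>0. \<forall>h. norm h \<le> \<delta> \<longrightarrow>
      (LINT x|lborel. indicator L x * \<bar>u (x + h) - u x\<bar> powr p) \<le> C' * norm h powr (\<theta> * p)"
proof -
  have [measurable]: "L \<in> sets borel" using L by (rule borel_compact)
  have M0: "0 \<le> M" using M[of undefined] by simp
  define N where "N h = (LINT x|lborel. indicator L x * \<bar>u (x + h) - u x\<bar> powr p)" for h
  note iN = integrable_difference_powr[OF L assms(2) M, of p]
  \<comment> \<open>Chosen to make doubling a contraction: the split costs
    \<open>(1 / (2 * l)) powr p\<close>, doubling \<open>h\<close> costs
    \<open>2 powr (\<theta> * p)\<close>, and by \<open>al\<close> the product is
    \<open>l powr p\<close>, which is below 1 because \<open>\<theta> < 1\<close>.\<close>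
  define l where "l = (2::real) powr ((\<theta> - 1) / 2)"
  have l: "0 < l" "l < 1" using \<theta> powr_less_mono[of "(\<theta> - 1) / 2" 0 2] by (auto simp: l_def)
  define a where "a = l powr p"
  have a: "0 < a" "a < 1" using l p powr_less_mono2[of p l 1] by (auto simp: a_def)
  define b where "b = (1 / (2 * (1 - l))) powr p * C"
  have b: "0 \<le> b" using C by (simp add: b_def)
  have al: "(1 / (2 * l)) powr p * 2 powr (\<theta> * p) = a"
  proof -
    have "(1 / (2 * l)) powr p * 2 powr (\<theta> * p) = (2 powr \<theta> / (2 * l)) powr p"
      by (simp add: powr_divide powr_powr)
    also have "2 powr \<theta> / (2 * l) = l"
    proof -
      have "l * l * 2 = 2 powr ((\<theta> - 1) / 2 + (\<theta> - 1) / 2 + 1)"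
        unfolding l_def powr_add by simp
      also have "(\<theta> - 1) / 2 + (\<theta> - 1) / 2 + 1 = \<theta>" by (simp add: field_simps)
      finally have "l * l * 2 = 2 powr \<theta>" .
      then show ?thesis using l by (simp add: field_simps)
    qed
    finally show ?thesis by (simp add: a_def)
  qed
  have step: "N h \<le> (1 / (2 * l)) powr p * N (h + h) + b * norm h powr (\<theta> * p)" if h: "norm h \<le> \<delta>" for h
  proof -
    let ?S = "\<lambda>x. indicator L x * \<bar>(u (x + h + h) - u (x + h)) - (u (x + h) - u x)\<bar> powr p"
    have iS: "integrable lborel ?S"
    proof (rule integrable_compact_bounded[OF L, where M = "(4 * M) powr p"])
      fix x
      show "\<bar>\<bar>(u (x + h + h) - u (x + h)) - (u (x + h) - u x)\<bar> powr p\<bar> \<le> (4 * M) powr p"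
        using M[of x] M[of "x + h"] M[of "x + h + h"] p by (auto intro!: powr_mono2)
    qed auto
    have "N h \<le> (LINT x|lborel. (1 / (2 * l)) powr p * (indicator L x * \<bar>u (x + (h + h)) - u x\<bar> powr p)
        + (1 / (2 * (1 - l))) powr p * ?S x)"
      unfolding N_def
    proof (rule integral_mono)
      fix x
      let ?d2 = "\<bar>u (x + (h + h)) - u x\<bar>" and ?dd = "\<bar>(u (x + h + h) - u (x + h)) - (u (x + h) - u x)\<bar>"
      have "\<bar>u (x + h) - u x\<bar> powr p \<le> (?d2 / 2 + ?dd / 2) powr p"
        using p by (intro powr_mono2) (auto simp: add.assoc abs_if field_simps)
      also have "\<dots> \<le> (?d2 / 2 / l) powr p + (?dd / 2 / (1 - l)) powr p"
        using p l by (intro powr_add_le_split) auto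
      also have "\<dots> = (1 / (2 * l)) powr p * ?d2 powr p + (1 / (2 * (1 - l))) powr p * ?dd powr p"
        using l by (simp add: powr_mult[symmetric] field_simps)
      finally show "indicator L x * \<bar>u (x + h) - u x\<bar> powr p \<le>
        (1 / (2 * l)) powr p * (indicator L x * \<bar>u (x + (h + h)) - u x\<bar> powr p)
        + (1 / (2 * (1 - l))) powr p * ?S x"
        by (auto simp: indicator_def)
    qed (use iN iS p in auto)
    also have "\<dots> = (1 / (2 * l)) powr p * N (h + h) + (1 / (2 * (1 - l))) powr p * integral\<^sup>L lborel ?S"
      using iN[of "h + h"] iS p unfolding N_def by simp
    also have "\<dots> \<le> (1 / (2 * l)) powr p * N (h + h) + b * norm h powr (\<theta> * p)"
      using second[OF h] unfolding b_def mult.assoc by (intro add_left_mono mult_left_mono) auto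
    finally show ?thesis .
  qed
  \<comment> \<open>The first entry is the fixed point of the recursion
    \<open>C' \<mapsto> a * C' + b\<close>; the second is the trivial bound for steps of length at
    least \<open>\<delta> / 2\<close>.\<close>
  define C' where "C' = max (b / (1 - a)) ((2 * M) powr p * measure lborel L / (\<delta> / 2) powr (\<theta> * p))"
  have C'0: "0 \<le> C'" using a b by (simp add: C'_def le_max_iff_disj)
  have C'ab: "a * C' + b \<le> C'"
  proof -
    have "b / (1 - a) \<le> C'" by (simp add: C'_def)
    then show ?thesis using a by (simp add: field_simps)
  qed
  have base: "N h \<le> C' * norm h powr (\<theta> * p)" if "\<delta> / 2 \<le> norm h" for h
  proof -
    have "N h \<le> (LINT x|lborel. (2 * M) powr p * indicator L x)"
      unfolding N_def
    proof (rule integral_mono)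
      show "integrable lborel (\<lambda>x. (2 * M) powr p * indicator L x)"
        using emeasure_compact_finite[OF L] by simp
      fix x
      show "indicator L x * \<bar>u (x + h) - u x\<bar> powr p \<le> (2 * M) powr p * indicator L x"
        using M[of x] M[of "x + h"] p by (auto simp: indicator_def intro!: powr_mono2)
    qed (use iN p in auto)
    also have "\<dots> = (2 * M) powr p * measure lborel L" by simp
    also have "\<dots> = (2 * M) powr p * measure lborel L / (\<delta> / 2) powr (\<theta> * p) * (\<delta> / 2) powr (\<theta> * p)"
      using \<delta> by simp
    also have "\<dots> \<le> C' * norm h powr (\<theta> * p)"
      using that \<delta> \<theta> p C'0 by (intro mult_mono powr_mono2) (auto simp: C'_def)
    finally show ?thesis .
  qed
  \<comment> \<open>Induction on a number \<open>n\<close> of doublings that suffices to bring the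
    step up to length \<open>\<delta> / 2\<close>.\<close>
  have ind: "N h \<le> C' * norm h powr (\<theta> * p)" if "\<delta> / 2 ^ (n + 1) \<le> norm h" "norm h \<le> \<delta>" for n h
    using that
  proof (induction n arbitrary: h)
    case 0 then show ?case using base by simp
  next
    case (Suc n)
    show ?case
    proof (cases "\<delta> / 2 \<le> norm h")
      case False
      have n2: "norm (h + h) = 2 * norm h" by (metis norm_scaleR scaleR_2 abs_numeral)
      have "N h \<le> (1 / (2 * l)) powr p * N (h + h) + b * norm h powr (\<theta> * p)"
        using Suc step by blast
      also have "\<dots> \<le> (1 / (2 * l)) powr p * (C' * norm (h + h) powr (\<theta> * p)) + b * norm h powr (\<theta> * p)"
        using Suc False n2 by (intro add_right_mono mult_left_mono Suc.IH) (auto simp: field_simps)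
      also have "\<dots> = ((1 / (2 * l)) powr p * 2 powr (\<theta> * p)) * C' * norm h powr (\<theta> * p) + b * norm h powr (\<theta> * p)"
        unfolding n2 by (simp add: powr_mult)
      also have "\<dots> = (a * C' + b) * norm h powr (\<theta> * p)"
        unfolding al by (simp add: algebra_simps)
      also have "\<dots> \<le> C' * norm h powr (\<theta> * p)" using C'ab by (intro mult_right_mono) auto
      finally show ?thesis .
    qed (use base in auto)
  qed
  have "N h \<le> C' * norm h powr (\<theta> * p)" if h: "norm h \<le> \<delta>" for h
  proof (cases "h = 0")
    case False
    then have "1 \<le> \<delta> / norm h" using h by simp
    then obtain k :: nat where "\<delta> / norm h \<le> 2 ^ (k + 1)" using ex_dyadic_scale by blast
    then show ?thesis using ind[of k h] False h by (simp add: field_simps)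
  qed (simp add: N_def)
  then show ?thesis using C'0 unfolding N_def by blast
qed

section \<open>Bounded solutions\<close>

text \<open>Tonelli in the increment \<open>h = y - x\<close> reduces the near part to the integral
  of \<open>norm h powr ((\<sigma> - \<tau>) * p - DIM('a))\<close> over a ball, finite because
  \<open>\<tau> < \<sigma>\<close>. Increments longer than \<open>\<delta>\<close> are paid for by
  the L^p mass of \<open>v\<close> times the kernel tail.\<close>

lemma finite_energy_of_differences:
  fixes v :: "'a::euclidean_space \<Rightarrow> 'b::euclidean_space"
  assumes L: "compact L" and [measurable]: "v \<in> borel_measurable borel"
    and v: "integrable lborel (\<lambda>x. indicator L x * norm (v x) powr p)"
    and p: "0 < p" and \<tau>: "0 < \<tau>" "\<tau> < \<sigma>" and C: "0 \<le> C" and \<delta>: "0 < \<delta>"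
    and diff: "\<And>h. norm h \<le> \<delta> \<Longrightarrow>
      norm_mass p L (\<lambda>x. v (x + h) - v x) \<le> ennreal (C * norm h powr (\<sigma> * p))"
  shows "finite_energy \<tau> p L v"
proof -
  have [measurable]: "L \<in> sets borel" using L by (rule borel_compact)
  let ?n = "real DIM('a)"
  let ?kern = "\<lambda>z::'a. norm z powr (- (?n + \<tau> * p))"
  define far where "far z = indicator {z. \<delta> \<le> norm z} z * ?kern z" for z :: 'a
  have ifar: "integrable lborel far"
    unfolding far_def[abs_def] using \<tau> p \<delta> by (intro integrable_kernel_far) auto
  have far0: "0 \<le> far z" for z by (simp add: far_def)
  define near where "near x y = indicator L x * indicator (cball 0 \<delta>) (y - x) * (norm (v y - v x) powr p * ?kern (y - x))" for x y
  have [measurable]: "(\<lambda>z. near (fst z) (snd z)) \<in> borel_measurable borel"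
  proof -
    have [measurable]: "cball (0::'a) \<delta> \<in> sets borel" by simp
    show ?thesis unfolding near_def by measurable
  qed
  have near0: "0 \<le> near x y" for x y by (simp add: near_def)
  let ?g = "\<lambda>x. indicator L x * norm (v x) powr p"
  let ?far = "\<lambda>z. 2 powr p * (?g (fst z) * far (fst z - snd z) + ?g (snd z) * far (fst z - snd z))"
  have iF: "integrable lborel ?far"
    using has_bochner_integral_fst_kernel[OF v _ ifar] has_bochner_integral_snd_kernel[OF v _ ifar] far0
    by (auto simp: has_bochner_integral_iff)
  have "(\<integral>\<^sup>+z. ennreal (near (fst z) (snd z)) \<partial>lborel) = (\<integral>\<^sup>+x. \<integral>\<^sup>+y. ennreal (near x y) \<partial>lborel \<partial>lborel)"
    by (rule nn_integral_lborel_pair) (simp add: case_prod_beta')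
  also have "\<dots> = (\<integral>\<^sup>+x. \<integral>\<^sup>+h. ennreal (near x (h + x)) \<partial>lborel \<partial>lborel)"
  proof (rule nn_integral_cong)
    fix x
    have "(\<lambda>y. near x y) \<in> borel_measurable borel"
      using measurable_compose[OF _ \<open>(\<lambda>z. near (fst z) (snd z)) \<in> borel_measurable borel\<close>, of "\<lambda>y. (x, y)" borel]
      by simp
    then show "(\<integral>\<^sup>+y. ennreal (near x y) \<partial>lborel) = (\<integral>\<^sup>+h. ennreal (near x (h + x)) \<partial>lborel)"
      by (intro nn_integral_lborel_shift[symmetric]) measurable
  qed
  also have "\<dots> = (\<integral>\<^sup>+h. \<integral>\<^sup>+x. ennreal (near x (h + x)) \<partial>lborel \<partial>lborel)"
  proof -
    have "(\<lambda>z. near (fst z) (snd z + fst z)) \<in> borel_measurable borel"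
      using measurable_compose[OF _ \<open>(\<lambda>z. near (fst z) (snd z)) \<in> borel_measurable borel\<close>, of "\<lambda>z. (fst z, snd z + fst z)" borel]
      by simp
    then have *: "(\<lambda>(x, h). ennreal (near x (h + x))) \<in> borel_measurable borel"
      by (simp add: case_prod_beta')
    show ?thesis
      using nn_integral_lborel_pair[OF *] nn_integral_lborel_pair_swap[OF *] by simp
  qed
  also have "\<dots> \<le> (\<integral>\<^sup>+h. ennreal (indicator (cball (0::'a) \<delta>) h * norm h powr ((\<sigma> - \<tau>) * p - ?n)) * ennreal C \<partial>lborel)"
  proof (rule nn_integral_mono)
    fix h :: 'a
    show "(\<integral>\<^sup>+x. ennreal (near x (h + x)) \<partial>lborel)
      \<le> ennreal (indicator (cball 0 \<delta>) h * norm h powr ((\<sigma> - \<tau>) * p - ?n)) * ennreal C"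
    proof (cases "norm h \<le> \<delta>")
      case True
      have "(\<integral>\<^sup>+x. ennreal (near x (h + x)) \<partial>lborel)
          = (\<integral>\<^sup>+x. ennreal (?kern h) * ennreal (indicator L x * norm (v (x + h) - v x) powr p) \<partial>lborel)"
        using True by (intro nn_integral_cong) (simp add: near_def ennreal_mult[symmetric] mult_ac add_ac)
      also have "\<dots> = ennreal (?kern h) * (norm_mass p L (\<lambda>x. v (x + h) - v x))"
        by (rule nn_integral_cmult) measurable
      also have "\<dots> \<le> ennreal (?kern h) * ennreal (C * norm h powr (\<sigma> * p))"
        using diff[OF True] by (rule mult_left_mono) simp
      also have "\<dots> = ennreal ((?kern h * norm h powr (\<sigma> * p)) * C)"
        using C by (simp add: ennreal_mult[symmetric] mult_ac)
      also have "?kern h * norm h powr (\<sigma> * p) = norm h powr ((\<sigma> - \<tau>) * p - ?n)"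
        by (simp add: powr_add[symmetric] algebra_simps)
      finally show ?thesis using True C by (simp add: ennreal_mult)
    qed (simp add: near_def)
  qed
  also have "\<dots> = (\<integral>\<^sup>+h. ennreal (indicator (cball 0 \<delta>) h * norm h powr ((\<sigma> - \<tau>) * p - ?n)) \<partial>(lborel :: 'a measure)) * ennreal C"
  proof (rule nn_integral_multc)
    have [measurable]: "cball (0::'a) \<delta> \<in> sets borel" by simp
    show "(\<lambda>h::'a. ennreal (indicator (cball 0 \<delta>) h * norm h powr ((\<sigma> - \<tau>) * p - ?n))) \<in> borel_measurable lborel"
      by measurable
  qed
  also have "\<dots> < \<infinity>"
    using nn_integral_kernel_near_finite[of "(\<sigma> - \<tau>) * p" \<delta>, where 'a='a] \<tau> p
    by (auto simp: ennreal_mult_less_top)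
  finally have iN: "integrable lborel (\<lambda>z. near (fst z) (snd z))"
    using near0 by (intro integrableI_bounded) (auto simp: abs_of_nonneg)
  show ?thesis
    unfolding finite_energy_def
  proof (rule Bochner_Integration.integrable_bound[OF Bochner_Integration.integrable_add[OF iN iF]])
    have "energy_density \<tau> p L v (x, y) \<le> near x y + ?far (x, y)" for x y
    proof (cases "x \<in> L \<and> y \<in> L")
      case True
      show ?thesis
      proof (cases "norm (x - y) \<le> \<delta>")
        case n: True
        have "energy_density \<tau> p L v (x, y) = near x y"
          using True n by (simp add: near_def energy_density_def norm_minus_commute)
        then show ?thesis using far0 by simp
      next
        case False
        have "norm (v x - v y) powr p \<le> (norm (v x) + norm (v y)) powr p"
          using p norm_triangle_ineq4 by (intro powr_mono2) auto
        also have "\<dots> \<le> 2 powr p * (norm (v x) powr p + norm (v y) powr p)"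
          using p by (intro powr_add_le_double) auto
        finally have "norm (v x - v y) powr p * far (x - y) \<le> 2 powr p * (norm (v x) powr p + norm (v y) powr p) * far (x - y)"
          using far0 by (rule mult_right_mono)
        moreover have "energy_density \<tau> p L v (x, y) = norm (v x - v y) powr p * far (x - y)"
          using True False by (simp add: far_def energy_density_def)
        ultimately show ?thesis using True near0[of x y] by (simp add: algebra_simps)
      qed
    next
      case False
      then have "energy_density \<tau> p L v (x, y) = 0" by (auto simp: energy_density_def)
      then show ?thesis using near0[of x y] far0 by simp
    qed
    then show "AE z in lborel. norm (energy_density \<tau> p L v z) \<le> norm (near (fst z) (snd z) + ?far z)"
      using near0 far0 by (intro AE_I2) (auto simp del: norm_mult simp: abs_of_nonneg)
  qed (auto intro!: energy_density_measurable)
qed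

section \<open>Compact neighbourhoods and distance cutoffs\<close>

lemma compact_neighbourhood:
  fixes L :: "'a::euclidean_space set"
  assumes "compact L" "L \<subseteq> \<Omega>" "open \<Omega>"
  obtains A \<rho> where "compact A" "A \<subseteq> \<Omega>" "0 < \<rho>" "\<And>x y. x \<in> L \<Longrightarrow> norm (y - x) \<le> \<rho> \<Longrightarrow> y \<in> A"
proof (cases "L = {}")
  case True
  then show ?thesis using that[of "{}" 1] by simp
next
  case False
  then obtain e where e: "0 < e" "{x. infdist x L \<le> e} \<subseteq> \<Omega>"
    using compact_in_open_separated[of L \<Omega>] assms by metis
  show ?thesis
  proof (rule that[of "{x. infdist x L \<le> e}" e])
    show "compact {x. infdist x L \<le> e}" using False assms e by (intro compact_infdist_le)
    fix x y assume "x \<in> L" "norm (y - x) \<le> e"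
    then show "y \<in> {x. infdist x L \<le> e}"
      using infdist_le[of x L y] by (simp add: dist_norm)
  qed (use e in auto)
qed

text \<open>The cutoff has only to be Lipschitz, so a truncated distance function does. The closed
  neighbourhoods of radii \<open>\<rho>\<close> and \<open>2 * \<rho>\<close> leave the gap demanded
  by \<open>sep\<close>.\<close>

lemma cutoff_infdist:
  fixes L :: "'a::euclidean_space set"
  assumes s: "0 < s" "s < 1" and p: "2 \<le> p" and \<rho>: "0 < \<rho>" and L: "compact L" "L \<noteq> {}"
  shows "\<exists>R. cutoff s p \<rho> R L {x. infdist x L \<le> \<rho>} {x. infdist x L \<le> 2 * \<rho>} (\<lambda>x. max 0 (1 - infdist x L / \<rho>))"
proof -
  define nb where "nb t = {x. infdist x L \<le> t}" for t
  define \<eta> where "\<eta> x = max 0 (1 - infdist x L / \<rho>)" for x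
  have cA: "compact (nb (2 * \<rho>))"
    unfolding nb_def using L \<rho> by (intro compact_infdist_le) auto
  have [measurable]: "(\<lambda>x. infdist x L) \<in> borel_measurable borel"
    by (intro borel_measurable_continuous_onI continuous_intros)
  have inf_lip: "\<bar>infdist x L - infdist y L\<bar> \<le> norm (x - y)" for x y
    using infdist_triangle_abs[of x L y] by (simp add: dist_norm)
  obtain R where R: "\<And>x y. x \<in> nb (2 * \<rho>) \<Longrightarrow> y \<in> nb (2 * \<rho>) \<Longrightarrow> norm (x - y) \<le> R"
    using compact_imp_bounded[OF cA] unfolding bounded_two_points by (auto simp: dist_norm)
  have id0: "0 \<le> infdist x L / \<rho>" for x
    using \<rho> infdist_nonneg[of x L] by simp
  have "cutoff s p \<rho> R L (nb \<rho>) (nb (2 * \<rho>)) \<eta>"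
  proof
    show "\<eta> \<in> borel_measurable borel" unfolding \<eta>_def[abs_def] by measurable
    show "L \<in> sets borel" "nb (2 * \<rho>) \<in> sets borel" using L cA by (simp_all add: borel_compact)
    show "emeasure lborel (nb (2 * \<rho>)) < \<infinity>" by (rule emeasure_compact_finite[OF cA])
    fix x y :: 'a
    show "\<rho> \<le> norm (x - y)" if "x \<in> nb \<rho>" "y \<notin> nb (2 * \<rho>)"
      using that inf_lip[of x y] by (auto simp: nb_def)
    have "\<bar>\<eta> x - \<eta> y\<bar> \<le> \<bar>infdist x L / \<rho> - infdist y L / \<rho>\<bar>"
      unfolding \<eta>_def by linarith
    also have "\<dots> \<le> norm (x - y) / \<rho>"
      using inf_lip[of x y] \<rho> by (simp add: diff_divide_distrib[symmetric] divide_right_mono)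
    finally show "\<bar>\<eta> x - \<eta> y\<bar> \<le> norm (x - y) / \<rho>" .
  qed (use s p \<rho> R id0 in \<open>auto simp: \<eta>_def nb_def\<close>)
  then show ?thesis unfolding nb_def \<eta>_def by blast
qed

section \<open>The iteration for an abstract bounded solution\<close>

text \<open>The equation in the form the iteration consumes: \<open>k\<close> in place of
  \<open>1 / K\<close>, Borel data, bounds at every point. The source survives only as the constant
  \<open>C\<close> in \<open>weak\<close>, fixed before the test function and the scale
  \<open>t\<close>, so that one constant serves all increments.\<close>

locale bounded_solution =
  fixes s p \<Lambda> M :: real and \<Omega> :: "'a::euclidean_space set" and k u :: "'a \<Rightarrow> real"
  assumes s: "0 < s" "s < 1" and p: "2 \<le> p" and \<Lambda>: "0 < \<Lambda>" and \<Omega>: "open \<Omega>"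
    and k_measurable [measurable]: "k \<in> borel_measurable borel"
    and u_measurable [measurable]: "u \<in> borel_measurable borel"
    and k_lower: "\<And>z. norm z powr (- (real DIM('a) + s * p)) / \<Lambda> \<le> k z"
    and k_upper: "\<And>z. k z \<le> \<Lambda> * norm z powr (- (real DIM('a) + s * p))"
    and M: "\<And>x. \<bar>u x\<bar> \<le> M"
    and fin: "\<And>A. compact A \<Longrightarrow> A \<subseteq> \<Omega> \<Longrightarrow> finite_energy s p A u"
    and weak: "\<And>A. compact A \<Longrightarrow> A \<subseteq> \<Omega> \<Longrightarrow> \<exists>C\<ge>0. \<forall>\<phi> t M'. \<phi> \<in> borel_measurable borel \<longrightarrow>
       (\<forall>x. \<bar>\<phi> x\<bar> \<le> M') \<longrightarrow> (\<forall>x. x \<notin> A \<longrightarrow> \<phi> x = 0) \<longrightarrow> finite_energy s p UNIV \<phi> \<longrightarrow> 0 < t \<longrightarrow>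
       \<bar>LINT z|lborel. pairing_density p k u \<phi> z\<bar> \<le> t * (C + (LINT x|lborel. \<bar>\<phi> x / t\<bar> powr p))"
begin

lemma nikolskii_zero: "nikolskii \<Omega> p 0 u"
proof -
  have "(LINT x|lborel. indicator L x * \<bar>u (x + h) - u x\<bar> powr p)
      \<le> (2 * M) powr p * measure lborel L * norm h powr (0 * p)" if L: "compact L" for L h
  \<comment> \<open>By the convention \<open>0 powr 0 = 0\<close> the right side vanishes at
    \<open>h = 0\<close>, but so does the left.\<close>
  proof (cases "h = 0")
    case False
    have [measurable]: "L \<in> sets borel" using L by (rule borel_compact)
    have "(LINT x|lborel. indicator L x * \<bar>u (x + h) - u x\<bar> powr p) \<le> (LINT x|lborel. (2 * M) powr p * indicator L x)"
    proof (rule integral_mono)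
      show "integrable lborel (\<lambda>x. (2 * M) powr p * indicator L x)"
        using emeasure_compact_finite[OF L] by simp
      fix x
      show "indicator L x * \<bar>u (x + h) - u x\<bar> powr p \<le> (2 * M) powr p * indicator L x"
        using M[of x] M[of "x + h"] p by (auto simp: indicator_def intro!: powr_mono2)
    qed (use integrable_difference_powr[OF L u_measurable M] p in auto)
    then show ?thesis using False by simp
  qed simp
  note bd = this
  have p0: "0 \<le> p" using p by simp
  show ?thesis
    unfolding nikolskii_bounded_iff[OF u_measurable M p0]
  proof (intro allI impI)
    fix L :: "'a set" assume "compact L" "L \<subseteq> \<Omega>"
    then show "\<exists>C \<delta>. 0 \<le> C \<and> 0 < \<delta> \<and> (\<forall>h. norm h \<le> \<delta> \<longrightarrow>
        (LINT x|lborel. indicator L x * \<bar>u (x + h) - u x\<bar> powr p) \<le> C * norm h powr (0 * p))"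
      using bd[of L] by - (rule exI[of _ "(2 * M) powr p * measure lborel L"], rule exI[of _ 1], auto)
  qed
qed

text \<open>With \<open>t = norm h powr \<sigma>\<close> the bounds from
  \<open>energy_difference_le\<close> and \<open>weak\<close> are \<open>t\<close> times constants
  independent of \<open>h\<close>. The neighbourhood of radius \<open>3 * \<rho>\<close> has to fit
  into \<open>\<Omega>\<close>: \<open>2 * \<rho>\<close> for the outer set of the cutoff and
  \<open>\<rho>\<close> for the shift of \<open>u\<close>.\<close>

lemma energy_increment:
  assumes N: "nikolskii \<Omega> p \<sigma> u" and L: "compact L" "L \<subseteq> \<Omega>"
  shows "\<exists>C \<delta>. 0 \<le> C \<and> 0 < \<delta> \<and> (\<forall>h. norm h \<le> \<delta> \<longrightarrow>
     finite_energy s p L (\<lambda>x. u (x + h) - u x) \<and>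
     energy s p L (\<lambda>x. u (x + h) - u x) \<le> C * norm h powr \<sigma>)"
proof (cases "L = {}")
  case True
  have "energy_density s p {} v = (\<lambda>_. 0)" for v :: "'a \<Rightarrow> real"
    by (simp add: energy_density_def fun_eq_iff)
  then show ?thesis unfolding True
    by (intro exI[of _ 1]) (simp add: finite_energy_def energy_def)
next
  case False
  obtain e where e: "0 < e" "{x. infdist x L \<le> e} \<subseteq> \<Omega>"
    using compact_in_open_separated[of L \<Omega>] False L \<Omega> by metis
  define \<rho> where "\<rho> = e / 3"
  have \<rho>: "0 < \<rho>" using e by (simp add: \<rho>_def)
  define nb where "nb t = {x. infdist x L \<le> t}" for t
  have nbc: "compact (nb t)" if "0 < t" for t
    unfolding nb_def using False L that by (intro compact_infdist_le)
  have nb3: "nb (3 * \<rho>) \<subseteq> \<Omega>" using e by (simp add: nb_def \<rho>_def)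
  have nbm: "nb t \<subseteq> nb t'" if "t \<le> t'" for t t' using that by (auto simp: nb_def)
  have nb2: "nb (2 * \<rho>) \<subseteq> \<Omega>" using nb3 nbm[of "2 * \<rho>" "3 * \<rho>"] \<rho> by auto
  have nb_shift: "y \<in> nb (t + r)" if "x \<in> nb t" "norm (x - y) \<le> r" for x y t r
    using that infdist_triangle[of y L x] by (simp add: nb_def dist_norm norm_minus_commute)
  have [measurable]: "(\<lambda>x. infdist x L) \<in> borel_measurable borel"
    by (intro borel_measurable_continuous_onI continuous_intros)
  have [measurable]: "nb t \<in> sets borel" for t
    unfolding nb_def by measurable
  have [measurable]: "L \<in> sets borel" using L by (simp add: borel_compact)
  define \<eta> where "\<eta> x = max 0 (1 - infdist x L / \<rho>)" for x
  obtain R where "cutoff s p \<rho> R L (nb \<rho>) (nb (2 * \<rho>)) \<eta>"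
    using cutoff_infdist[OF s p \<rho> L(1) False] unfolding nb_def \<eta>_def by blast
  then interpret cutoff s p \<rho> R L "nb \<rho>" "nb (2 * \<rho>)" \<eta> .
  have cA: "compact (nb (2 * \<rho>))" using \<rho> by (intro nbc) simp
  obtain C1 \<delta>1 where C1: "0 \<le> C1" "0 < \<delta>1" "\<And>h. norm h \<le> \<delta>1 \<Longrightarrow>
      (LINT x|lborel. indicator (nb (2 * \<rho>)) x * \<bar>u (x + h) - u x\<bar> powr p) \<le> C1 * norm h powr (\<sigma> * p)"
  proof -
    have "0 \<le> p" using p by simp
    from N[unfolded nikolskii_bounded_iff[OF u_measurable M this]] cA nb2 that show ?thesis by meson
  qed
  obtain Cf where Cf: "0 \<le> Cf" "\<And>\<phi> t M'. \<phi> \<in> borel_measurable borel \<Longrightarrow>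
       (\<And>x. \<bar>\<phi> x\<bar> \<le> M') \<Longrightarrow> (\<And>x. x \<notin> nb (2 * \<rho>) \<Longrightarrow> \<phi> x = 0) \<Longrightarrow> finite_energy s p UNIV \<phi> \<Longrightarrow> 0 < t \<Longrightarrow>
       \<bar>LINT z|lborel. pairing_density p k u \<phi> z\<bar> \<le> t * (Cf + (LINT x|lborel. \<bar>\<phi> x / t\<bar> powr p))"
    using weak[OF cA nb2] by meson
  define E where "E = energy s p (nb (3 * \<rho>)) u"
  have E0: "0 \<le> E" by (simp add: E_def)
  have c3: "compact (nb (3 * \<rho>))" using \<rho> by (intro nbc) simp
  note fin3 = fin[OF c3 nb3]
  define \<delta> where "\<delta> = min \<rho> \<delta>1"
  define c where "c = (1/2) powr p / \<Lambda>"
  have c: "0 < c" using \<Lambda> by (simp add: c_def)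
  have N0: "0 \<le> integral\<^sup>L lborel near_kernel" "0 \<le> integral\<^sup>L lborel far_kernel" by simp_all
  \<comment> \<open>The source bound, once for the equation and once for its translate, plus the
    error of \<open>energy_difference_le\<close>, all divided by \<open>t\<close>.\<close>
  define K where "K = 2 * (Cf + C1) + \<Lambda> * ((E + E + 2 * C1 * integral\<^sup>L lborel near_kernel) / \<rho>
          + 4 * (2 * M) powr (p - 1) * integral\<^sup>L lborel far_kernel * (measure lborel (nb (2 * \<rho>)) + C1))"
  have K: "0 \<le> K"
    unfolding K_def using Cf C1 E0 N0 \<Lambda> \<rho>
    by (intro add_nonneg_nonneg mult_nonneg_nonneg divide_nonneg_nonneg) auto
  have M0: "0 \<le> M" using M[of undefined] by simp
  show ?thesis
  proof (rule exI[of _ "K / c"], rule exI[of _ \<delta>], intro conjI allI impI)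
    show "0 \<le> K / c" using K c by simp
    show "0 < \<delta>" using \<rho> C1 by (simp add: \<delta>_def)
    fix h :: 'a assume h: "norm h \<le> \<delta>"
    define v where "v x = u (x + h)" for x
    define w where "w x = v x - u x" for x
    have [measurable]: "v \<in> borel_measurable borel" "w \<in> borel_measurable borel"
      unfolding v_def[abs_def] w_def[abs_def] by auto
    have finu: "finite_energy s p (nb (2 * \<rho>)) u" and Eu: "energy s p (nb (2 * \<rho>)) u \<le> E"
      unfolding E_def using finite_energy_subset[OF fin3, of "nb (2 * \<rho>)"] nbm[of "2 * \<rho>" "3 * \<rho>"] \<rho> by auto
    have sh: "x + h \<in> nb (3 * \<rho>)" if "x \<in> nb (2 * \<rho>)" for x
      using nb_shift[OF that, of "x + h" \<rho>] h by (simp add: \<delta>_def)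
    have finv: "finite_energy s p (nb (2 * \<rho>)) v" and Ev: "energy s p (nb (2 * \<rho>)) v \<le> E"
      unfolding E_def v_def using finite_energy_shift[OF fin3 sh] by auto
    have finw: "finite_energy s p (nb (2 * \<rho>)) w"
      unfolding w_def using finu finv p by (intro finite_energy_diff) auto
    have weq: "(\<lambda>x. u (x + h) - u x) = w" by (simp add: w_def v_def fun_eq_iff)
    show "finite_energy s p L (\<lambda>x. u (x + h) - u x)"
      unfolding weq using B_subset_A L_subset_B by (intro finite_energy_subset[OF finw]) auto
    show "energy s p L (\<lambda>x. u (x + h) - u x) \<le> K / c * norm h powr \<sigma>"
    proof (cases "h = 0")
      case True
      then have "w = (\<lambda>_. 0)" by (simp add: w_def v_def fun_eq_iff)
      then have "energy_density s p L w = (\<lambda>_. 0)" by (simp add: energy_density_def fun_eq_iff)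
      then show ?thesis unfolding weq using True by (simp add: energy_def)
    next
      case h0: False
      define t where "t = norm h powr \<sigma>"
      have t: "0 < t" using h0 by (simp add: t_def)
      have tp: "norm h powr (\<sigma> * p) = t powr p" by (simp add: t_def powr_powr)
      have Cw: "(LINT x|lborel. indicator (nb (2 * \<rho>)) x * \<bar>w x\<bar> powr p) \<le> C1 * t powr p"
        using C1(3)[of h] h by (simp add: weq[symmetric] tp \<delta>_def)
      define \<phi> where "\<phi> x = \<eta> x * w x" for x
      \<comment> \<open>Testing the original equation with this translate gives the pairing of
        \<open>v\<close> with \<open>\<phi>\<close> (see \<open>shift\<close>), which is the
        translated equation. As \<open>norm h \<le> \<rho>\<close>, the support stays in
        \<open>nb (2 * \<rho>)\<close>.\<close>
      define \<phi>' where "\<phi>' x = \<phi> (x + (- h))" for x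
      have [measurable]: "\<phi> \<in> borel_measurable borel" unfolding \<phi>_def[abs_def] by measurable
      then have [measurable]: "\<phi>' \<in> borel_measurable borel" unfolding \<phi>'_def[abs_def] by measurable
      have Mw: "\<bar>w x\<bar> \<le> 2 * M" for x
        using M[of x] M[of "x + h"] by (auto simp: w_def v_def)
      have \<phi>w: "\<bar>\<phi> x\<bar> \<le> \<bar>w x\<bar>" for x
        using \<eta>_nonneg[of x] \<eta>_le_1[of x] by (simp add: \<phi>_def abs_mult mult_left_le_one_le)
      have M\<phi>: "\<bar>\<phi> x\<bar> \<le> 2 * M" for x using \<phi>w[of x] Mw[of x] by linarith
      have fin\<phi>: "finite_energy s p UNIV \<phi>"
        unfolding \<phi>_def[abs_def] using Mw finw by (intro finite_energy_cutoff) auto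
      have \<phi>0: "\<phi> x = 0" if "x \<notin> nb \<rho>" for x using off[OF that] by (simp add: \<phi>_def)
      have fin\<phi>': "finite_energy s p UNIV \<phi>'"
        unfolding \<phi>'_def[abs_def] by (rule finite_energy_shift[OF fin\<phi>]) auto
      have \<phi>'0: "\<phi>' x = 0" if "x \<notin> nb (2 * \<rho>)" for x
      proof -
        have "x + (- h) \<notin> nb \<rho>"
          using nb_shift[of "x + - h" \<rho> x \<rho>] that h by (auto simp: \<delta>_def)
        then show ?thesis using \<phi>0 by (simp add: \<phi>'_def)
      qed
      have Mv: "\<bar>v x\<bar> \<le> M" for x using M by (simp add: v_def)
      have I\<phi>: "(LINT x|lborel. \<bar>\<phi> x / t\<bar> powr p) \<le> C1"
      proof -
        have iw: "integrable lborel (\<lambda>x. indicator (nb (2 * \<rho>)) x * \<bar>w x\<bar> powr p)"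
          using integrable_difference_powr[OF cA u_measurable M, of p h] p by (simp add: w_def v_def)
        have le: "\<bar>\<phi> x / t\<bar> powr p \<le> indicator (nb (2 * \<rho>)) x * \<bar>w x\<bar> powr p / t powr p" for x
        proof (cases "x \<in> nb (2 * \<rho>)")
          case True
          then show ?thesis using \<phi>w[of x] t p by (auto simp: powr_divide intro!: divide_right_mono powr_mono2)
        next
          case False
          then have "\<phi> x = 0" using \<phi>0 B_subset_A by blast
          then show ?thesis using False by simp
        qed
        have "(LINT x|lborel. \<bar>\<phi> x / t\<bar> powr p) \<le> (LINT x|lborel. indicator (nb (2 * \<rho>)) x * \<bar>w x\<bar> powr p / t powr p)"
        proof (rule integral_mono)
          show "integrable lborel (\<lambda>x. \<bar>\<phi> x / t\<bar> powr p)"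
            by (rule Bochner_Integration.integrable_bound[OF integrable_divide[OF iw, of "t powr p"]])
               (use le in auto)
        qed (use iw le in auto)
        also have "\<dots> \<le> C1" using Cw t by (simp add: divide_le_eq)
        finally show ?thesis .
      qed
      have I\<phi>': "(LINT x|lborel. \<bar>\<phi>' x / t\<bar> powr p) = (LINT x|lborel. \<bar>\<phi> x / t\<bar> powr p)"
        unfolding \<phi>'_def by (rule integral_lborel_shift[of "\<lambda>x. \<bar>\<phi> x / t\<bar> powr p"]) measurable
      have w1: "\<bar>LINT z|lborel. pairing_density p k u \<phi> z\<bar> \<le> t * (Cf + C1)"
      proof -
        have "\<phi> x = 0" if "x \<notin> nb (2 * \<rho>)" for x using that \<phi>0 B_subset_A by blast
        then have "\<bar>LINT z|lborel. pairing_density p k u \<phi> z\<bar> \<le> t * (Cf + (LINT x|lborel. \<bar>\<phi> x / t\<bar> powr p))"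
          using M\<phi> fin\<phi> t by (intro Cf) auto
        also have "\<dots> \<le> t * (Cf + C1)" using I\<phi> t by (intro mult_left_mono) auto
        finally show ?thesis .
      qed
      have w2: "\<bar>LINT z|lborel. pairing_density p k u \<phi>' z\<bar> \<le> t * (Cf + C1)"
      proof -
        have "\<bar>LINT z|lborel. pairing_density p k u \<phi>' z\<bar> \<le> t * (Cf + (LINT x|lborel. \<bar>\<phi>' x / t\<bar> powr p))"
          using M\<phi> fin\<phi>' \<phi>'0 t by (intro Cf(2)[where M' = "2 * M"]) (auto simp: \<phi>'_def)
        also have "\<dots> \<le> t * (Cf + C1)" using I\<phi> t unfolding I\<phi>' by (intro mult_left_mono) auto
        finally show ?thesis .
      qed
      have shift: "(LINT z|lborel. pairing_density p k u \<phi>' z) = (LINT z|lborel. pairing_density p k v \<phi> z)"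
      proof -
        have "(LINT z|lborel. pairing_density p k u \<phi>' z) = (LINT z|lborel. pairing_density p k u \<phi>' (z + (h, h)))"
          by (rule integral_lborel_shift[symmetric]) measurable
        also have "(\<lambda>z. pairing_density p k u \<phi>' (z + (h, h))) = pairing_density p k v \<phi>"
          by (simp add: pairing_density_def fun_eq_iff v_def \<phi>'_def)
        finally show ?thesis .
      qed
      have "c * energy s p L w \<le> (LINT z|lborel. pairing_density p k v \<phi> z) - (LINT z|lborel. pairing_density p k u \<phi> z)
        + t * \<Lambda> * ((energy s p (nb (2 * \<rho>)) u + energy s p (nb (2 * \<rho>)) v + 2 * C1 * integral\<^sup>L lborel near_kernel) / \<rho>
          + 4 * (2 * M) powr (p - 1) * integral\<^sup>L lborel far_kernel * (measure lborel (nb (2 * \<rho>)) + C1))"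
        unfolding c_def w_def[abs_def] \<phi>_def[abs_def]
        by (rule energy_difference_le)
           (use k_lower k_upper \<Lambda> M Mv finu finv t Cw[unfolded w_def] in auto)
      also have "\<dots> \<le> 2 * (t * (Cf + C1))
        + t * \<Lambda> * ((E + E + 2 * C1 * integral\<^sup>L lborel near_kernel) / \<rho>
          + 4 * (2 * M) powr (p - 1) * integral\<^sup>L lborel far_kernel * (measure lborel (nb (2 * \<rho>)) + C1))"
      proof (rule add_mono)
        show "(LINT z|lborel. pairing_density p k v \<phi> z) - (LINT z|lborel. pairing_density p k u \<phi> z) \<le> 2 * (t * (Cf + C1))"
          using w1 w2 unfolding shift by linarith
      qed (use Eu Ev t \<Lambda> \<rho> in \<open>intro mult_left_mono add_right_mono divide_right_mono add_mono; simp\<close>)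
      also have "\<dots> = K * t" by (simp add: K_def algebra_simps)
      finally show ?thesis unfolding weq t_def[symmetric] using c by (simp add: field_simps)
    qed
  qed
qed

text \<open>The energy of \<open>w\<^sub>h\<close> controls its own differences with a second step
  \<open>j\<close>, unrelated to \<open>h\<close>. The choice \<open>j = h\<close> gives second
  differences; the gradient estimate needs a dyadic step \<open>h\<close> along a unit vector and an
  arbitrary \<open>j\<close>.\<close>

lemma mixed_difference_le:
  assumes N: "nikolskii \<Omega> p \<sigma> u" and L: "compact L" "L \<subseteq> \<Omega>"
  shows "\<exists>C \<delta>. 0 \<le> C \<and> 0 < \<delta> \<and> (\<forall>h j. norm h \<le> \<delta> \<longrightarrow> norm j \<le> \<delta> \<longrightarrow>
     (LINT x|lborel. indicator L x * \<bar>(u (x + j + h) - u (x + j)) - (u (x + h) - u x)\<bar> powr p)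
       \<le> C * norm j powr (s * p) * norm h powr \<sigma>)"
proof -
  obtain A \<rho> where A: "compact A" "A \<subseteq> \<Omega>" "0 < \<rho>" "\<And>x y. x \<in> L \<Longrightarrow> norm (y - x) \<le> \<rho> \<Longrightarrow> y \<in> A"
    using compact_neighbourhood[OF L \<Omega>] by metis
  obtain C1 \<delta>1 where C1: "0 \<le> C1" "0 < \<delta>1" "\<And>h. norm h \<le> \<delta>1 \<Longrightarrow>
     finite_energy s p A (\<lambda>x. u (x + h) - u x)"
     "\<And>h. norm h \<le> \<delta>1 \<Longrightarrow> energy s p A (\<lambda>x. u (x + h) - u x) \<le> C1 * norm h powr \<sigma>"
    using energy_increment[OF N A(1,2)] by (elim exE conjE) (rule that, assumption, assumption, blast+)
  have ps: "0 < p" "0 \<le> s" using p s by auto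
  obtain C2 where C2: "0 \<le> C2" "\<And>(v::'a \<Rightarrow> real) A L \<rho> h. v \<in> borel_measurable borel \<Longrightarrow> A \<in> sets borel \<Longrightarrow> L \<in> sets borel \<Longrightarrow>
     finite_energy s p A v \<Longrightarrow> (\<forall>x\<in>L. \<forall>y. norm (y - x) \<le> \<rho> \<longrightarrow> y \<in> A) \<Longrightarrow> norm h \<le> \<rho> \<Longrightarrow>
     norm_mass p L (\<lambda>x. v (x + h) - v x)
       \<le> ennreal (C2 * norm h powr (s * p) * energy s p A v)"
    using energy_controls_differences[OF ps, where 'a='a and 'b=real] by (elim exE conjE) (rule that, assumption, blast)
  show ?thesis
  proof (rule exI[of _ "C2 * C1"], rule exI[of _ "min \<rho> \<delta>1"], intro conjI allI impI)
    fix h j :: 'a assume h: "norm h \<le> min \<rho> \<delta>1" and j: "norm j \<le> min \<rho> \<delta>1"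
    let ?w = "\<lambda>x. u (x + h) - u x"
    have Mw: "\<bar>?w x\<bar> \<le> 2 * M" for x using M[of x] M[of "x + h"] by auto
    have "norm_mass p L (\<lambda>x. ?w (x + j) - ?w x)
       \<le> ennreal (C2 * norm j powr (s * p) * energy s p A ?w)"
      by (rule C2(2)[where \<rho> = \<rho>]) (use A L C1 h j in \<open>auto intro: borel_compact\<close>)
    also have "\<dots> \<le> ennreal (C2 * norm j powr (s * p) * (C1 * norm h powr \<sigma>))"
      using C1 C2 h by (intro ennreal_leI mult_left_mono) auto
    finally have *: "abs_mass p L (\<lambda>x. ?w (x + j) - ?w x)
       \<le> ennreal (C2 * norm j powr (s * p) * (C1 * norm h powr \<sigma>))" by simp
    have "integrable lborel (\<lambda>x. indicator L x * \<bar>?w (x + j) - ?w x\<bar> powr p)"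
      by (rule integrable_difference_powr[OF L(1), where M = "2 * M"]) (use Mw p in auto)
    with * C1 C2 have "(LINT x|lborel. indicator L x * \<bar>?w (x + j) - ?w x\<bar> powr p) \<le> C2 * norm j powr (s * p) * (C1 * norm h powr \<sigma>)"
      by (simp add: nn_integral_eq_integral ennreal_le_iff)
    then show "(LINT x|lborel. indicator L x * \<bar>(u (x + j + h) - u (x + j)) - (u (x + h) - u x)\<bar> powr p)
       \<le> C2 * C1 * norm j powr (s * p) * norm h powr \<sigma>" by (simp add: mult_ac)
  qed (use A C1 C2 in auto)
qed

text \<open>For \<open>j = h\<close> the mixed bound has exponent \<open>s * p + \<sigma>\<close>,
  at least \<open>\<theta> * p\<close>, and \<open>\<theta> < 1\<close> allows the descent from
  second to first differences. Steps are kept at most 1 so that lowering the exponent enlarges the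
  bound.\<close>

lemma nikolskii_improve:
  assumes N: "nikolskii \<Omega> p \<sigma> u" and \<theta>: "0 \<le> \<theta>" "\<theta> < 1" "\<theta> \<le> s + \<sigma> / p"
  shows "nikolskii \<Omega> p \<theta> u"
proof -
  have p0: "0 \<le> p" using p by simp
  show ?thesis
    unfolding nikolskii_bounded_iff[OF u_measurable M p0]
  proof (intro allI impI)
    fix L assume L: "compact L" "L \<subseteq> \<Omega>"
    obtain C \<delta> where C: "0 \<le> C" "0 < \<delta>" "\<And>h j. norm h \<le> \<delta> \<Longrightarrow> norm j \<le> \<delta> \<Longrightarrow>
     (LINT x|lborel. indicator L x * \<bar>(u (x + j + h) - u (x + j)) - (u (x + h) - u x)\<bar> powr p)
       \<le> C * norm j powr (s * p) * norm h powr \<sigma>"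
      using mixed_difference_le[OF N L] by (elim exE conjE) (rule that, assumption, assumption, blast)
    have \<sigma>: "\<theta> * p \<le> s * p + \<sigma>" using mult_right_mono[OF \<theta>(3), of p] p by (simp add: distrib_right)
    have "\<exists>C'\<ge>0. \<forall>h. norm h \<le> min \<delta> 1 \<longrightarrow>
      (LINT x|lborel. indicator L x * \<bar>u (x + h) - u x\<bar> powr p) \<le> C' * norm h powr (\<theta> * p)"
    proof (rule first_difference_le_of_second_difference[OF L(1) u_measurable M _ \<theta>(1,2), where C = C])
      fix h :: 'a assume h: "norm h \<le> min \<delta> 1"
      have "(LINT x|lborel. indicator L x * \<bar>(u (x + h + h) - u (x + h)) - (u (x + h) - u x)\<bar> powr p)
         \<le> C * norm h powr (s * p) * norm h powr \<sigma>" using C(3)[of h h] h by simp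
      also have "\<dots> = C * norm h powr (s * p + \<sigma>)" by (simp add: powr_add)
      also have "\<dots> \<le> C * norm h powr (\<theta> * p)"
        using C h \<sigma> by (intro mult_left_mono powr_mono') auto
      finally show "(LINT x|lborel. indicator L x * \<bar>(u (x + h + h) - u (x + h)) - (u (x + h) - u x)\<bar> powr p)
         \<le> C * norm h powr (\<theta> * p)" .
    qed (use p C in auto)
    then show "\<exists>C \<delta>. 0 \<le> C \<and> 0 < \<delta> \<and> (\<forall>h. norm h \<le> \<delta> \<longrightarrow>
        (LINT x|lborel. indicator L x * \<bar>u (x + h) - u x\<bar> powr p) \<le> C * norm h powr (\<theta> * p))"
    proof (elim exE conjE)
      fix C' assume "0 \<le> C'" "\<forall>h. norm h \<le> min \<delta> 1 \<longrightarrow>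
        (LINT x|lborel. indicator L x * \<bar>u (x + h) - u x\<bar> powr p) \<le> C' * norm h powr (\<theta> * p)"
      then show ?thesis using C(2) by (intro exI[of _ C'] exI[of _ "min \<delta> 1"] conjI) auto
    qed
  qed
qed

text \<open>The exponents \<open>F * (1 - p\<^sup>-\<^sup>n)\<close> are the orbit of \<open>0\<close> under \<open>\<sigma> \<mapsto> s + \<sigma> / p\<close>, whose fixed point is \<open>F\<close>.\<close>

lemma nikolskii_below_threshold:
  assumes \<sigma>: "0 \<le> \<sigma>" "\<sigma> < 1" "\<sigma> < s * p / (p - 1)"
  shows "nikolskii \<Omega> p \<sigma> u"
proof -
  define F where "F = s * p / (p - 1)"
  have F0: "0 < F" using s p by (simp add: F_def)
  have fixpoint: "s + F / p = F"
    using p by (simp add: F_def field_simps)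
  have it: "nikolskii \<Omega> p \<theta> u" if "0 \<le> \<theta>" "\<theta> < 1" "\<theta> \<le> F * (1 - (1 / p) ^ n)" for n \<theta>
    using that
  proof (induction n arbitrary: \<theta>)
    case 0
    then show ?case using nikolskii_zero by simp
  next
    case (Suc n)
    \<comment> \<open>The preimage of \<open>\<theta>\<close> under the iteration map, cut off at 0
      when \<open>\<theta> < s\<close>.\<close>
    define \<sigma>' where "\<sigma>' = max 0 ((\<theta> - s) * p)"
    have "(\<theta> - s) * p \<le> F * (1 - (1 / p) ^ n)"
    proof -
      have "\<theta> \<le> F - F * (1 / p) ^ n / p" using Suc.prems by (simp add: algebra_simps)
      then have "\<theta> - s \<le> F / p - F * (1 / p) ^ n / p" using fixpoint by linarith
      then have "(\<theta> - s) * p \<le> (F / p - F * (1 / p) ^ n / p) * p" using p by (intro mult_right_mono) auto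
      also have "\<dots> = F * (1 - (1 / p) ^ n)" using p by (simp add: algebra_simps)
      finally show ?thesis .
    qed
    moreover have pn: "0 \<le> (1 / p) ^ n" "(1 / p) ^ n \<le> 1" using p by (auto intro!: power_le_one)
    ultimately have le: "\<sigma>' \<le> F * (1 - (1 / p) ^ n)" using F0 by (simp add: \<sigma>'_def)
    \<comment> \<open>If the fixed point is at least one, then \<open>1 - s \<le> 1 / p\<close>, so
      an exponent \<open>\<theta> < 1\<close> pulls back to one below 1 and the induction never
      meets the barrier.\<close>
    have lt: "\<sigma>' < 1"
    proof (cases "F < 1")
      case True
      have "F * (1 - (1 / p) ^ n) \<le> F * 1" using F0 pn by (intro mult_left_mono) auto
      then show ?thesis using le True by simp
    next
      case False
      then have "1 \<le> s + 1 / p" using p by (simp add: F_def field_simps)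
      then have "(\<theta> - s) < 1 / p" using Suc.prems by linarith
      then have "(\<theta> - s) * p < 1" using p by (simp add: field_simps)
      then show ?thesis by (simp add: \<sigma>'_def)
    qed
    have le': "\<theta> \<le> s + \<sigma>' / p"
    proof -
      have "(\<theta> - s) * p / p \<le> \<sigma>' / p" using p by (intro divide_right_mono) (auto simp: \<sigma>'_def)
      then show ?thesis using p by simp
    qed
    have "nikolskii \<Omega> p \<sigma>' u"
      by (rule Suc.IH[OF _ lt le]) (simp add: \<sigma>'_def)
    then show ?case
      using Suc.prems(1,2) le' by (rule nikolskii_improve)
  qed
  have "0 < 1 - \<sigma> / F" using \<sigma> F0 by (simp add: F_def[symmetric])
  then obtain n where "(1 / p) ^ n < 1 - \<sigma> / F"
    using real_arch_pow_inv[of "1 - \<sigma> / F" "1 / p"] p by auto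
  then have "\<sigma> / F \<le> 1 - (1 / p) ^ n" by simp
  then have "\<sigma> \<le> F * (1 - (1 / p) ^ n)" using F0 by (simp add: field_simps)
  then show ?thesis using it \<sigma> by blast
qed

end

section \<open>Limits of geometrically converging sequences\<close>

text \<open>Summable L^1 increments give absolute convergence almost everywhere on \<open>L\<close>;
  the rate in L^p follows from a bound on the increments over n steps, uniform in n, and Fatou's
  lemma. Taking the pointwise \<open>lim\<close> gives a function that depends neither on
  \<open>L\<close> nor on \<open>r\<close>.\<close>

lemma Lp_geometric_limit:
  fixes D :: "nat \<Rightarrow> 'a::euclidean_space \<Rightarrow> real"
  assumes [measurable]: "\<And>m. D m \<in> borel_measurable borel" "L \<in> sets borel"
    and L: "emeasure lborel L < \<infinity>" and p: "1 \<le> p" and r: "0 < r" "r < 1" and C: "0 \<le> C"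
    and step: "\<And>m. m0 \<le> m \<Longrightarrow>
      abs_mass p L (\<lambda>x. D (Suc m) x - D m x) \<le> ennreal (C * r ^ m)"
  shows "AE x in lborel. x \<in> L \<longrightarrow> (\<lambda>m. D m x) \<longlonglongrightarrow> lim (\<lambda>m. D m x)"
    and "\<exists>B\<ge>0. \<forall>m\<ge>m0. abs_mass p L (\<lambda>x. lim (\<lambda>m. D m x) - D m x) \<le> ennreal (B * r ^ m)"
proof -
  \<comment> \<open>The L^1 norm of an increment decays like the p-th root of its p-th power
    mass.\<close>
  define q where "q = r powr (1 / p)"
  have q: "0 < q" "q < 1" using r p powr_less_mono2[of "1 / p" r 1] by (auto simp: q_def)
  have qr: "(q ^ m) powr p = r ^ m" for m
    using r p by (simp add: q_def powr_realpow[symmetric] powr_powr)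
  have L1: "(\<integral>\<^sup>+x. ennreal (indicator L x * \<bar>D (Suc m) x - D m x\<bar>) \<partial>lborel) \<le> ennreal ((measure lborel L + C) * q ^ m)"
    if m: "m0 \<le> m" for m
    using nn_integral_abs_le_of_mass[OF _ _ L p _ C, where f = "\<lambda>x. D (Suc m) x - D m x" and t = "q ^ m"]
      q step[OF m] by (simp add: qr)
  let ?S = "\<lambda>x. \<Sum>j. ennreal (indicator L x * \<bar>D (Suc (m0 + j)) x - D (m0 + j) x\<bar>)"
  have "(\<integral>\<^sup>+x. ?S x \<partial>lborel) = (\<Sum>j. \<integral>\<^sup>+x. ennreal (indicator L x * \<bar>D (Suc (m0 + j)) x - D (m0 + j) x\<bar>) \<partial>lborel)"
    by (rule nn_integral_suminf) measurable
  also have "\<dots> \<le> (\<Sum>j. ennreal ((measure lborel L + C) * q ^ m0 * q ^ j))"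
    using L1[of "m0 + _"] by (intro suminf_le) (auto simp: power_add mult_ac)
  also have "\<dots> < \<infinity>"
  proof -
    have "(\<Sum>j. ennreal ((measure lborel L + C) * q ^ m0 * q ^ j)) \<noteq> top"
      using q C by (intro ennreal_suminf_neq_top summable_mult summable_geometric) auto
    then show ?thesis by (simp add: less_top)
  qed
  finally have fin: "(\<integral>\<^sup>+x. ?S x \<partial>lborel) \<noteq> \<infinity>" by simp
  have aefin: "AE x in lborel. ?S x \<noteq> \<infinity>"
    by (rule nn_integral_PInf_AE[OF _ fin]) measurable
  show conv: "AE x in lborel. x \<in> L \<longrightarrow> (\<lambda>m. D m x) \<longlonglongrightarrow> lim (\<lambda>m. D m x)"
    using aefin
  proof (eventually_elim, intro impI)
    fix x assume fin: "?S x \<noteq> \<infinity>" and x: "x \<in> L"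
    have "summable (\<lambda>j. \<bar>D (Suc (m0 + j)) x - D (m0 + j) x\<bar>)"
    proof (rule ccontr)
      assume "\<not> ?thesis"
      then have "(\<Sum>j. ennreal \<bar>D (Suc (m0 + j)) x - D (m0 + j) x\<bar>) = top"
        by (intro summable_iff_suminf_neq_top) auto
      then show False using fin x by simp
    qed
    then have "summable (\<lambda>j. D (Suc (m0 + j)) x - D (m0 + j) x)" by (rule summable_rabs_cancel)
    then obtain l where "(\<lambda>n. \<Sum>j<n. D (m0 + Suc j) x - D (m0 + j) x) \<longlonglongrightarrow> l"
      by (auto simp: summable_def sums_def)
    then have "(\<lambda>n. D (m0 + n) x - D m0 x) \<longlonglongrightarrow> l"
      by (simp only: sum_lessThan_telescope[of "\<lambda>j. D (m0 + j) x"] add_0_right)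
    then have "(\<lambda>n. D (m0 + n) x - D m0 x + D m0 x) \<longlonglongrightarrow> l + D m0 x"
      by (intro tendsto_intros)
    then have "(\<lambda>n. D (n + m0) x) \<longlonglongrightarrow> l + D m0 x" by (simp add: add.commute)
    then have "(\<lambda>n. D n x) \<longlonglongrightarrow> l + D m0 x" by (rule LIMSEQ_offset)
    then show "(\<lambda>m. D m x) \<longlonglongrightarrow> lim (\<lambda>m. D m x)"
      by (simp add: limI)
  qed
  \<comment> \<open>Each step of the induction costs \<open>(1 / l) powr p\<close> and gains
    \<open>r\<close>, in total \<open>sqrt r < 1\<close>.\<close>
  define l where "l = r powr (1 / (2 * p))"
  have l: "0 < l" "l < 1" using r p powr_less_mono2[of "1 / (2 * p)" r 1] by (auto simp: l_def)
  have lp: "(1 / l) powr p * r = sqrt r"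
  proof -
    have "l powr p = sqrt r" using r p by (simp add: l_def powr_powr powr_half_sqrt)
    then show ?thesis using r l by (simp add: powr_divide real_div_sqrt)
  qed
  have sr: "0 < sqrt r" "sqrt r < 1" using r by auto
  \<comment> \<open>Fixed point of the recursion for the constant, so that the induction on the
    number of steps reproduces it.\<close>
  define B where "B = (1 / (1 - l)) powr p * C / (1 - sqrt r)"
  have B0: "0 \<le> B" using C sr by (simp add: B_def)
  have Beq: "sqrt r * B + (1 / (1 - l)) powr p * C = B"
    using sr by (simp add: B_def field_simps)
  let ?I = "\<lambda>m n. (abs_mass p L (\<lambda>x. D (m + n) x - D m x))"
  \<comment> \<open>The first increment is split off, not the last: the induction hypothesis is then
    used at \<open>Suc m\<close>, where it carries an additional factor \<open>r\<close>.\<close>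
  have I: "?I m n \<le> ennreal (B * r ^ m)" if "m0 \<le> m" for m n
    using that
  proof (induction n arbitrary: m)
    case 0
    then show ?case by simp
  next
    case (Suc n)
    have "?I m (Suc n) = abs_mass p L (\<lambda>x. (D (Suc m + n) x - D (Suc m) x) + (D (Suc m) x - D m x))" by simp
    also have "\<dots> \<le> ennreal ((1 / l) powr p) * ?I (Suc m) n
        + ennreal ((1 / (1 - l)) powr p) * abs_mass p L (\<lambda>x. D (Suc m) x - D m x)"
      using p l by (intro abs_mass_add_le) auto
    also have "\<dots> \<le> ennreal ((1 / l) powr p) * ennreal (B * r ^ Suc m) + ennreal ((1 / (1 - l)) powr p) * ennreal (C * r ^ m)"
      using Suc by (intro add_mono mult_left_mono step Suc.IH) auto
    also have "\<dots> = ennreal ((1 / l) powr p * (B * r ^ Suc m) + (1 / (1 - l)) powr p * (C * r ^ m))"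
      using B0 C r by (simp add: ennreal_mult[symmetric] ennreal_plus[symmetric] del: ennreal_plus)
    also have "(1 / l) powr p * (B * r ^ Suc m) + (1 / (1 - l)) powr p * (C * r ^ m)
        = (((1 / l) powr p * r) * B + (1 / (1 - l)) powr p * C) * r ^ m" by (simp add: algebra_simps)
    also have "\<dots> = B * r ^ m" unfolding lp Beq ..
    finally show ?case .
  qed
  show "\<exists>B\<ge>0. \<forall>m\<ge>m0. abs_mass p L (\<lambda>x. lim (\<lambda>m. D m x) - D m x) \<le> ennreal (B * r ^ m)"
  proof (intro exI conjI allI impI)
    show "0 \<le> B" by (rule B0)
    fix m assume m: "m0 \<le> m"
    let ?f = "\<lambda>n x. ennreal (indicator L x * \<bar>D (m + n) x - D m x\<bar> powr p)"
    have "(abs_mass p L (\<lambda>x. lim (\<lambda>m. D m x) - D m x))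
      = (\<integral>\<^sup>+x. liminf (\<lambda>n. ?f n x) \<partial>lborel)"
    proof (rule nn_integral_cong_AE, use conv in eventually_elim)
      fix x assume x: "x \<in> L \<longrightarrow> (\<lambda>m. D m x) \<longlonglongrightarrow> lim (\<lambda>m. D m x)"
      have "(\<lambda>n. ?f n x) \<longlonglongrightarrow> ennreal (indicator L x * \<bar>lim (\<lambda>m. D m x) - D m x\<bar> powr p)"
      proof (cases "x \<in> L")
        case True
        then have "(\<lambda>n. D (n + m) x) \<longlonglongrightarrow> lim (\<lambda>m. D m x)" using x by (intro LIMSEQ_ignore_initial_segment) simp
        then have "(\<lambda>n. D (m + n) x) \<longlonglongrightarrow> lim (\<lambda>m. D m x)" by (simp add: add.commute)
        then have "(\<lambda>n. \<bar>D (m + n) x - D m x\<bar> powr p) \<longlonglongrightarrow> \<bar>lim (\<lambda>m. D m x) - D m x\<bar> powr p"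
          using p by (intro tendsto_powr' tendsto_intros) auto
        then show ?thesis using True by (simp add: tendsto_ennrealI)
      qed simp
      then show "ennreal (indicator L x * \<bar>lim (\<lambda>m. D m x) - D m x\<bar> powr p) = liminf (\<lambda>n. ?f n x)"
        by (intro lim_imp_Liminf[symmetric]) auto
    qed
    also have "\<dots> \<le> liminf (\<lambda>n. integral\<^sup>N lborel (?f n))"
      by (rule nn_integral_liminf) measurable
    also have "\<dots> \<le> limsup (\<lambda>n. integral\<^sup>N lborel (?f n))"
      by (rule Liminf_le_Limsup) simp
    also have "\<dots> \<le> ennreal (B * r ^ m)"
      using I[OF m] by (intro Limsup_bounded) auto
    finally show "abs_mass p L (\<lambda>x. lim (\<lambda>m. D m x) - D m x) \<le> ennreal (B * r ^ m)" .
  qed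
qed

lemma nikolskii_add:
  fixes v w :: "'a::euclidean_space \<Rightarrow> 'b::euclidean_space"
  assumes v: "nikolskii \<Omega> p \<sigma> v" and w: "nikolskii \<Omega> p \<sigma> w" and p: "0 \<le> p"
    and [measurable]: "v \<in> borel_measurable borel" "w \<in> borel_measurable borel"
  shows "nikolskii \<Omega> p \<sigma> (\<lambda>x. v x + w x)"
  unfolding nikolskii_def
proof (intro allI impI)
  fix L assume L: "compact L" "L \<subseteq> \<Omega>"
  have [measurable]: "L \<in> sets borel" using L by (simp add: borel_compact)
  let ?J = "\<lambda>v h. norm_mass p L (\<lambda>x. v (x + h) - v x)"
  obtain C1 \<delta>1 where 1: "0 \<le> C1" "0 < \<delta>1" "\<And>h. norm h \<le> \<delta>1 \<Longrightarrow> ?J v h \<le> ennreal (C1 * norm h powr (\<sigma> * p))"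
    using v L unfolding nikolskii_def by meson
  obtain C2 \<delta>2 where 2: "0 \<le> C2" "0 < \<delta>2" "\<And>h. norm h \<le> \<delta>2 \<Longrightarrow> ?J w h \<le> ennreal (C2 * norm h powr (\<sigma> * p))"
    using w L unfolding nikolskii_def by meson
  show "\<exists>C \<delta>. 0 \<le> C \<and> 0 < \<delta> \<and> (\<forall>h. norm h \<le> \<delta> \<longrightarrow> ?J (\<lambda>x. v x + w x) h \<le> ennreal (C * norm h powr (\<sigma> * p)))"
  proof (rule exI[of _ "2 powr p * (C1 + C2)"], rule exI[of _ "min \<delta>1 \<delta>2"], intro conjI allI impI)
    fix h :: 'a assume h: "norm h \<le> min \<delta>1 \<delta>2"
    have "?J (\<lambda>x. v x + w x) h = norm_mass p L (\<lambda>x. (v (x + h) - v x) + (w (x + h) - w x))"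
      by (simp add: algebra_simps)
    also have "\<dots> \<le> ennreal (2 powr p) * ?J v h + ennreal (2 powr p) * ?J w h"
      using norm_mass_add_le[of L "\<lambda>x. v (x + h) - v x" "\<lambda>x. w (x + h) - w x" p "1/2"] p by simp
    also have "\<dots> \<le> ennreal (2 powr p) * ennreal (C1 * norm h powr (\<sigma> * p)) + ennreal (2 powr p) * ennreal (C2 * norm h powr (\<sigma> * p))"
      using h by (intro mult_left_mono add_mono 1 2) auto
    also have "\<dots> = ennreal (2 powr p * (C1 + C2) * norm h powr (\<sigma> * p))"
      using 1 2 by (simp add: ennreal_mult[symmetric] ennreal_plus[symmetric] algebra_simps del: ennreal_plus)
    finally show "?J (\<lambda>x. v x + w x) h \<le> ennreal (2 powr p * (C1 + C2) * norm h powr (\<sigma> * p))" .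
  qed (use 1 2 in auto)
qed

lemma nikolskii_const: "nikolskii \<Omega> p \<sigma> (\<lambda>x. c)"
  unfolding nikolskii_def by (intro allI impI exI[of _ 1]) simp

lemma nikolskii_scaleR_unit:
  fixes v :: "'a::euclidean_space \<Rightarrow> real" and e :: "'b::euclidean_space"
  assumes "nikolskii \<Omega> p \<sigma> v" "norm e = 1"
  shows "nikolskii \<Omega> p \<sigma> (\<lambda>x. v x *\<^sub>R e)"
proof -
  have "norm (a *\<^sub>R e - b *\<^sub>R e) = norm (a - b)" for a b
    using assms(2) by (simp flip: scaleR_diff_left)
  then show ?thesis using assms(1) unfolding nikolskii_def by simp
qed

lemma nikolskii_sum_Basis:
  fixes g :: "'b::euclidean_space \<Rightarrow> 'a::euclidean_space \<Rightarrow> real"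
  assumes "\<And>e. e \<in> Basis \<Longrightarrow> nikolskii \<Omega> p \<sigma> (g e)" "\<And>e. g e \<in> borel_measurable borel" "0 \<le> p"
  shows "nikolskii \<Omega> p \<sigma> (\<lambda>x. \<Sum>e\<in>Basis. g e x *\<^sub>R e)"
proof -
  have "nikolskii \<Omega> p \<sigma> (\<lambda>x. \<Sum>e\<in>S. g e x *\<^sub>R e)" if "finite S" "S \<subseteq> Basis" for S
    using that
  proof induction
    case empty
    then show ?case by (simp add: nikolskii_const)
  next
    case (insert e S)
    have [measurable]: "g e \<in> borel_measurable borel" for e by (rule assms)
    show ?case
      unfolding sum.insert[OF insert.hyps]
      by (rule nikolskii_add) (use insert assms in \<open>auto intro!: nikolskii_scaleR_unit\<close>)
  qed
  then show ?thesis by simp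
qed

section \<open>The gradient\<close>

context bounded_solution
begin

definition diff_quot :: "nat \<Rightarrow> 'a \<Rightarrow> 'a \<Rightarrow> real" where
  "diff_quot m e x = 2 ^ m * (u (x + (1/2) ^ m *\<^sub>R e) - u x)"

text \<open>\<open>lim\<close> is unspecified where the quotients diverge, but the function is Borel
  everywhere and the same for all compact sets. Above the threshold and for unit vectors
  \<open>e\<close>, divergence is confined to a null subset of each compact subset of
  \<open>\<Omega>\<close>.\<close>

definition grad_comp :: "'a \<Rightarrow> 'a \<Rightarrow> real" where
  "grad_comp e x = lim (\<lambda>m. diff_quot m e x)"

definition grad :: "'a \<Rightarrow> 'a" where
  "grad x = (\<Sum>e\<in>Basis. grad_comp e x *\<^sub>R e)"

lemma diff_quot_measurable [measurable]: "diff_quot m e \<in> borel_measurable borel"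
  unfolding diff_quot_def[abs_def] by measurable

lemma grad_comp_measurable [measurable]: "grad_comp e \<in> borel_measurable borel"
  unfolding grad_comp_def[abs_def] by measurable

lemma grad_measurable [measurable]: "grad \<in> borel_measurable borel"
  unfolding grad_def[abs_def] by measurable

lemma grad_inner: "e \<in> Basis \<Longrightarrow> grad x \<bullet> e = grad_comp e x"
  unfolding grad_def by (simp add: inner_sum_left inner_Basis if_distrib sum.If_cases cong: if_cong)

lemma diff_quot_bounded: "\<bar>diff_quot m e x\<bar> \<le> 2 ^ m * (2 * M)"
  using M[of x] M[of "x + (1/2) ^ m *\<^sub>R e"] unfolding diff_quot_def abs_mult
  by (intro mult_mono) auto

text \<open>The step from \<open>2\<^sup>-\<^sup>m\<close> to \<open>2\<^sup>-\<^sup>m\<^sup>-\<^sup>1\<close> changes the difference quotient by a second difference, which is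
  of order larger than one. So the quotients converge strongly and no weak compactness is needed.\<close>

lemma diff_quot_converges:
  assumes sp: "(p - 1) / p < s" and e: "norm e = 1" and \<gamma>: "0 < \<gamma>" "\<gamma> < s - (p - 1) / p"
    and L: "compact L" "L \<subseteq> \<Omega>"
  shows "AE x in lborel. x \<in> L \<longrightarrow> (\<lambda>m. diff_quot m e x) \<longlonglongrightarrow> grad_comp e x"
    and "\<exists>B m0. 0 \<le> B \<and> (\<forall>m\<ge>m0. abs_mass p L (\<lambda>x. grad_comp e x - diff_quot m e x)
      \<le> ennreal (B * (2 powr (- (\<gamma> * p))) ^ m))"
    and "\<exists>C \<delta>. 0 \<le> C \<and> 0 < \<delta> \<and> (\<forall>m j. (1/2) ^ m \<le> \<delta> \<longrightarrow> norm j \<le> \<delta> \<longrightarrow> norm j \<le> (1/2) ^ m \<longrightarrow>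
      abs_mass p L (\<lambda>x. diff_quot m e (x + j) - diff_quot m e x)
      \<le> ennreal (C * (2 powr (- (\<gamma> * p))) ^ m))"
proof -
  have pp: "0 < p" using p by simp
  have Lm [measurable]: "L \<in> sets borel" using L by (simp add: borel_compact)
  \<comment> \<open>Solves \<open>s * p + \<sigma> = (\<gamma> + 1) * p\<close>, so that mixed
    differences have order \<open>\<gamma> + 1\<close>. The upper bound on \<open>\<gamma>\<close>
    says exactly that \<open>\<sigma> < 1\<close>.\<close>
  define \<sigma> where "\<sigma> = (\<gamma> + 1 - s) * p"
  define r where "r = 2 powr (- (\<gamma> * p))"
  have r: "0 < r" "r < 1" using \<gamma> pp powr_less_mono[of "- (\<gamma> * p)" 0 2] by (auto simp: r_def)
  have s1: "s - (p - 1) / p = s + 1 / p - 1" using pp by (simp add: field_simps)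
  have \<sigma>0: "0 \<le> \<sigma>" using \<gamma> s pp by (auto simp: \<sigma>_def)
  have \<sigma>1: "\<sigma> < 1"
  proof -
    have "\<gamma> + 1 - s < 1 / p" using \<gamma>(2) unfolding s1 by linarith
    then show ?thesis using pp by (simp add: \<sigma>_def field_simps)
  qed
  have "1 < s * p / (p - 1)" using sp p by (simp add: field_simps)
  then have N: "nikolskii \<Omega> p \<sigma> u" using \<sigma>0 \<sigma>1 by (intro nikolskii_below_threshold) auto
  obtain C \<delta> where C: "0 \<le> C" "0 < \<delta>" "\<And>h j. norm h \<le> \<delta> \<Longrightarrow> norm j \<le> \<delta> \<Longrightarrow>
     (LINT x|lborel. indicator L x * \<bar>(u (x + j + h) - u (x + j)) - (u (x + h) - u x)\<bar> powr p)
       \<le> C * norm j powr (s * p) * norm h powr \<sigma>"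
    using mixed_difference_le[OF N L] by (elim exE conjE) (rule that, assumption, assumption, blast)
  have sum: "s * p + \<sigma> = (\<gamma> + 1) * p" by (simp add: \<sigma>_def algebra_simps)
  \<comment> \<open>The factor \<open>2 ^ m\<close> of the quotient uses up one order at scale
    \<open>(1/2) ^ m\<close>; the excess \<open>\<gamma>\<close> remains as the rate
    \<open>r\<close>.\<close>
  have rm: "r ^ m = (2 ^ m) powr p * ((1/2) ^ m) powr ((\<gamma> + 1) * p)" for m
  proof -
    have "(2 ^ m) powr p * ((1/2) ^ m) powr ((\<gamma> + 1) * p) = 2 powr (real m * p) * (2 powr (- real m)) powr ((\<gamma> + 1) * p)"
      by (simp add: powr_realpow[symmetric] powr_powr powr_minus power_one_over inverse_eq_divide)
    also have "\<dots> = 2 powr (real m * p - real m * ((\<gamma> + 1) * p))"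
      by (simp add: powr_powr powr_add[symmetric])
    also have "\<dots> = r ^ m" by (simp add: r_def powr_realpow[symmetric] powr_powr algebra_simps)
    finally show ?thesis by simp
  qed
  \<comment> \<open>Serves twice: with \<open>j = h\<close> the halved dyadic step for convergence,
    and with \<open>j\<close> free for the increments of a fixed quotient.\<close>
  have mixed: "abs_mass p L (\<lambda>x. 2 ^ m * ((u (x + j + h) - u (x + j)) - (u (x + h) - u x)))
      \<le> ennreal (C * r ^ m)" if "norm h \<le> \<delta>" "norm j \<le> \<delta>" "norm h \<le> (1/2) ^ m" "norm j \<le> (1/2) ^ m" for h j m
  proof -
    let ?d = "\<lambda>x. \<bar>(u (x + j + h) - u (x + j)) - (u (x + h) - u x)\<bar>"
    have i: "integrable lborel (\<lambda>x. indicator L x * ?d x powr p)"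
    proof (rule integrable_compact_bounded[OF L(1), where M = "(4 * M) powr p"])
      fix x
      show "\<bar>?d x powr p\<bar> \<le> (4 * M) powr p"
        using M[of x] M[of "x + h"] M[of "x + j"] M[of "x + j + h"] p by (auto intro!: powr_mono2)
    qed auto
    have eq: "indicator L x * \<bar>2 ^ m * ((u (x + j + h) - u (x + j)) - (u (x + h) - u x))\<bar> powr p
       = (2 ^ m) powr p * (indicator L x * ?d x powr p)" for x
      by (simp add: abs_mult powr_mult)
    have "(abs_mass p L (\<lambda>x. 2 ^ m * ((u (x + j + h) - u (x + j)) - (u (x + h) - u x))))
      = ennreal ((2 ^ m) powr p * (LINT x|lborel. indicator L x * ?d x powr p))"
      unfolding eq using i by (subst nn_integral_eq_integral) auto
    also have "\<dots> \<le> ennreal ((2 ^ m) powr p * (C * norm j powr (s * p) * norm h powr \<sigma>))"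
      using that by (intro ennreal_leI mult_left_mono C) auto
    also have "\<dots> \<le> ennreal ((2 ^ m) powr p * (C * ((1/2) ^ m) powr (s * p) * ((1/2) ^ m) powr \<sigma>))"
      using that C s pp \<sigma>0 by (intro ennreal_leI mult_mono mult_nonneg_nonneg powr_mono2) auto
    also have "(2 ^ m) powr p * (C * ((1/2) ^ m) powr (s * p) * ((1/2) ^ m) powr \<sigma>) = C * r ^ m"
      unfolding rm sum[symmetric] by (simp add: powr_add)
    finally show ?thesis .
  qed
  have lim0: "((\<lambda>m. (1/2::real) ^ m) \<longlonglongrightarrow> 0)" by (rule LIMSEQ_realpow_zero) auto
  obtain m0 where m0: "\<And>m. m0 \<le> m \<Longrightarrow> (1/2::real) ^ m < \<delta>"
    using order_tendstoD(2)[OF lim0 C(2)] unfolding eventually_sequentially by blast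
  have step: "abs_mass p L (\<lambda>x. diff_quot (Suc m) e x - diff_quot m e x) \<le> ennreal (C * r ^ m)"
    if m: "m0 \<le> m" for m
  proof -
    define h where "h = (1/2) ^ Suc m *\<^sub>R e"
    have hh: "(1/2) ^ m *\<^sub>R e = h + h"
      unfolding h_def by (simp flip: scaleR_add_left)
    have nh: "norm h = (1/2) ^ Suc m" using e by (simp add: h_def)
    \<comment> \<open>Without absolute values the two sides differ by a sign.\<close>
    have eq: "\<bar>diff_quot (Suc m) e x - diff_quot m e x\<bar> = \<bar>2 ^ m * ((u (x + h + h) - u (x + h)) - (u (x + h) - u x))\<bar>" for x
      unfolding diff_quot_def hh h_def[symmetric] by (simp add: algebra_simps)
    have "norm h \<le> (1/2) ^ m" unfolding nh by simp
    then show ?thesis unfolding eq using m0[of m] m by (intro mixed) auto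
  qed
  have p1: "1 \<le> p" using p by simp
  note lim = Lp_geometric_limit[where D = "\<lambda>m. diff_quot m e", OF diff_quot_measurable Lm emeasure_compact_finite[OF L(1)] p1 r C(1) step]
  show "AE x in lborel. x \<in> L \<longrightarrow> (\<lambda>m. diff_quot m e x) \<longlonglongrightarrow> grad_comp e x"
    unfolding grad_comp_def by (rule lim(1))
  show "\<exists>B m0. 0 \<le> B \<and> (\<forall>m\<ge>m0. abs_mass p L (\<lambda>x. grad_comp e x - diff_quot m e x)
      \<le> ennreal (B * (2 powr (- (\<gamma> * p))) ^ m))"
    unfolding grad_comp_def r_def[symmetric] using lim(2) by blast
  show "\<exists>C \<delta>. 0 \<le> C \<and> 0 < \<delta> \<and> (\<forall>m j. (1/2) ^ m \<le> \<delta> \<longrightarrow> norm j \<le> \<delta> \<longrightarrow> norm j \<le> (1/2) ^ m \<longrightarrow>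
      abs_mass p L (\<lambda>x. diff_quot m e (x + j) - diff_quot m e x)
      \<le> ennreal (C * (2 powr (- (\<gamma> * p))) ^ m))"
  proof (rule exI[of _ C], rule exI[of _ \<delta>], intro conjI allI impI)
    fix m and j :: 'a assume a: "(1/2) ^ m \<le> \<delta>" "norm j \<le> \<delta>" "norm j \<le> (1/2) ^ m"
    have eq: "diff_quot m e (x + j) - diff_quot m e x
       = 2 ^ m * ((u (x + j + (1/2) ^ m *\<^sub>R e) - u (x + j)) - (u (x + (1/2) ^ m *\<^sub>R e) - u x))" for x
      by (simp add: diff_quot_def algebra_simps)
    show "abs_mass p L (\<lambda>x. diff_quot m e (x + j) - diff_quot m e x)
      \<le> ennreal (C * (2 powr (- (\<gamma> * p))) ^ m)"
      unfolding eq r_def[symmetric] using a e by (intro mixed) auto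
  qed (use C in auto)
qed

text \<open>The limit is within finite L^p distance of a single difference quotient, which is
  bounded because \<open>u\<close> is.\<close>

lemma nn_integral_grad_comp_finite:
  assumes sp: "(p - 1) / p < s" and e: "norm e = 1" and L: "compact L" "L \<subseteq> \<Omega>"
  shows "abs_mass p L (grad_comp e) < \<infinity>"
proof -
  have [measurable]: "L \<in> sets borel" using L by (simp add: borel_compact)
  have M0: "0 \<le> M" using M[of undefined] by simp
  obtain \<gamma> where "0 < \<gamma>" "\<gamma> < s - (p - 1) / p" using sp dense[of 0 "s - (p - 1) / p"] by auto
  from diff_quot_converges(2)[OF sp e this L] obtain B m where
    B: "abs_mass p L (\<lambda>x. grad_comp e x - diff_quot m e x)
      \<le> ennreal (B * (2 powr (- (\<gamma> * p))) ^ m)" by blast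
  let ?b = "(2 ^ m * (2 * M)) powr p"
  have "abs_mass p L (grad_comp e) = abs_mass p L (\<lambda>x. (grad_comp e x - diff_quot m e x) + diff_quot m e x)" by simp
  also have "\<dots> \<le> ennreal (2 powr p) * abs_mass p L (\<lambda>x. grad_comp e x - diff_quot m e x) + ennreal (2 powr p) * abs_mass p L (diff_quot m e)"
    using abs_mass_add_le[of L "\<lambda>x. grad_comp e x - diff_quot m e x" "diff_quot m e" p "1/2"] p by simp
  also have "\<dots> < \<infinity>"
  proof -
    have "abs_mass p L (diff_quot m e) \<le> (\<integral>\<^sup>+x. ennreal ?b * indicator L x \<partial>lborel)"
      using diff_quot_bounded p by (intro nn_integral_mono) (auto simp: indicator_def intro!: ennreal_leI powr_mono2)
    also have "\<dots> < \<infinity>"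
      using emeasure_compact_finite[OF L(1)] by (simp add: nn_integral_cmult_indicator ennreal_mult_less_top)
    finally show ?thesis
      using order_le_less_trans[OF B ennreal_less_top] by (simp add: ennreal_mult_less_top)
  qed
  finally show ?thesis .
qed

text \<open>For an increment \<open>j\<close> choose \<open>m\<close> with \<open>(1/2) ^ m\<close>
  between \<open>norm j\<close> and \<open>2 * norm j\<close>. Replacing the limit by the m-th
  quotient at \<open>x\<close> and at \<open>x + j\<close> costs a multiple of \<open>r ^ m\<close>
  each, the increment of the quotient is a mixed difference of the same size, and
  \<open>r ^ m\<close> is comparable to \<open>norm j powr (\<gamma> * p)\<close>.\<close>

lemma nikolskii_grad_comp:
  assumes sp: "(p - 1) / p < s" and e: "norm e = 1" and \<gamma>: "0 < \<gamma>" "\<gamma> < s - (p - 1) / p"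
  shows "nikolskii \<Omega> p \<gamma> (grad_comp e)"
  unfolding nikolskii_def
proof (intro allI impI)
  fix L assume L: "compact L" "L \<subseteq> \<Omega>"
  have pp: "0 < p" using p by simp
  obtain A \<rho> where A: "compact A" "A \<subseteq> \<Omega>" "0 < \<rho>" "\<And>x y. x \<in> L \<Longrightarrow> norm (y - x) \<le> \<rho> \<Longrightarrow> y \<in> A"
    using compact_neighbourhood[OF L \<Omega>] by metis
  have [measurable]: "L \<in> sets borel" "A \<in> sets borel" using L A by (simp_all add: borel_compact)
  define r where "r = 2 powr (- (\<gamma> * p))"
  obtain B m0 where B: "0 \<le> B" "\<And>m. m0 \<le> m \<Longrightarrow> abs_mass p A (\<lambda>x. grad_comp e x - diff_quot m e x)
      \<le> ennreal (B * r ^ m)"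
    using diff_quot_converges(2)[OF sp e \<gamma> A(1,2)] unfolding r_def[symmetric] by blast
  obtain C \<delta> where C: "0 \<le> C" "0 < \<delta>" "\<And>m j. (1/2) ^ m \<le> \<delta> \<Longrightarrow> norm j \<le> \<delta> \<Longrightarrow> norm j \<le> (1/2) ^ m \<Longrightarrow>
      abs_mass p L (\<lambda>x. diff_quot m e (x + j) - diff_quot m e x)
      \<le> ennreal (C * r ^ m)"
    using diff_quot_converges(3)[OF sp e \<gamma> L] unfolding r_def[symmetric] by (elim exE conjE) (rule that, assumption, assumption, blast)
  \<comment> \<open>\<open>\<rho>\<close> keeps \<open>x + j\<close> in \<open>A\<close>;
    \<open>\<delta> / 2\<close> keeps the dyadic scale, up to twice \<open>norm j\<close>, below
    \<open>\<delta>\<close>; the last entry forces \<open>m0 \<le> m\<close>.\<close>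
  define \<epsilon> where "\<epsilon> = min (min \<rho> (\<delta> / 2)) ((1/2) ^ (m0 + 1))"
  let ?K = "(2 powr p * (2 powr p * (B + B)) + 2 powr p * C) * 2 powr (\<gamma> * p)"
  show "\<exists>C \<delta>. 0 \<le> C \<and> 0 < \<delta> \<and> (\<forall>h. norm h \<le> \<delta> \<longrightarrow>
        norm_mass p L (\<lambda>x. grad_comp e (x + h) - grad_comp e x) \<le> ennreal (C * norm h powr (\<gamma> * p)))"
  proof (rule exI[of _ ?K], rule exI[of _ \<epsilon>], intro conjI allI impI)
    show "0 < \<epsilon>" using A C by (simp add: \<epsilon>_def)
    fix j :: 'a assume j: "norm j \<le> \<epsilon>"
    show "norm_mass p L (\<lambda>x. grad_comp e (x + j) - grad_comp e x) \<le> ennreal (?K * norm j powr (\<gamma> * p))"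
    proof (cases "j = 0")
      case False
      have jm: "norm j \<le> (1/2) ^ (m0 + 1)" "norm j \<le> \<rho>" "norm j \<le> \<delta> / 2" using j by (auto simp: \<epsilon>_def)
      have "(1/2::real) ^ (m0 + 1) \<le> 1" by (rule power_le_one) auto
      with jm(1) have "norm j \<le> 1" by linarith
      then have "1 \<le> 1 / norm j" using False by simp
      then obtain m where m: "2 ^ m \<le> 1 / norm j" "1 / norm j \<le> 2 ^ (m + 1)" using ex_dyadic_scale by blast
      have m1: "norm j \<le> (1/2) ^ m" using m(1) False by (simp add: field_simps power_one_over)
      have m2: "(1/2) ^ m \<le> 2 * norm j" using m(2) False by (simp add: field_simps power_one_over)
      have "m0 \<le> m"
      proof (rule ccontr)
        assume "\<not> m0 \<le> m"
        then have "(1/2::real) ^ m0 < (1/2) ^ m" by (intro power_strict_decreasing) auto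
        moreover have "2 * norm j \<le> (1/2) ^ m0" using jm(1) by simp
        ultimately show False using m2 by linarith
      qed
      have add: "abs_mass p L (\<lambda>x. f x + g x) \<le> ennreal (2 powr p) * X + ennreal (2 powr p) * Y"
        if "abs_mass p L f \<le> X" "abs_mass p L g \<le> Y" "f \<in> borel_measurable borel" "g \<in> borel_measurable borel" for f g X Y
      proof -
        have "abs_mass p L (\<lambda>x. f x + g x) \<le> ennreal (2 powr p) * abs_mass p L f + ennreal (2 powr p) * abs_mass p L g"
          using abs_mass_add_le[of L f g p "1/2"] that pp by simp
        also have "\<dots> \<le> ennreal (2 powr p) * X + ennreal (2 powr p) * Y"
          using that by (intro add_mono mult_left_mono) auto
        finally show ?thesis .
      qed
      have B0: "abs_mass p L (\<lambda>x. - (grad_comp e x - diff_quot m e x)) \<le> ennreal (B * r ^ m)"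
      proof (rule order_trans[OF nn_integral_mono B(2)[OF \<open>m0 \<le> m\<close>]])
        show "ennreal (indicator L x * \<bar>- (grad_comp e x - diff_quot m e x)\<bar> powr p)
          \<le> ennreal (indicator A x * \<bar>grad_comp e x - diff_quot m e x\<bar> powr p)" for x
          using A(4)[of x x] A(3) by (cases "x \<in> L") (auto simp: abs_minus_commute)
      qed
      have B1: "abs_mass p L (\<lambda>x. grad_comp e (x + j) - diff_quot m e (x + j)) \<le> ennreal (B * r ^ m)"
      proof -
        have "abs_mass p L (\<lambda>x. grad_comp e (x + j) - diff_quot m e (x + j))
          \<le> (\<integral>\<^sup>+x. ennreal (indicator A (x + j) * \<bar>grad_comp e (x + j) - diff_quot m e (x + j)\<bar> powr p) \<partial>lborel)"
          using A(4)[of _ "_ + j"] jm(2) by (intro nn_integral_mono) (auto simp: indicator_def)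
        also have "\<dots> \<le> ennreal (B * r ^ m)"
          using B(2)[OF \<open>m0 \<le> m\<close>] nn_integral_lborel_shift[of "\<lambda>x. ennreal (indicator A x * \<bar>grad_comp e x - diff_quot m e x\<bar> powr p)" j] by simp
        finally show ?thesis .
      qed
      have C1: "abs_mass p L (\<lambda>x. diff_quot m e (x + j) - diff_quot m e x) \<le> ennreal (C * r ^ m)"
        using m1 m2 jm C by (intro C(3)) auto
      have "norm_mass p L (\<lambda>x. grad_comp e (x + j) - grad_comp e x)
         = abs_mass p L (\<lambda>x. ((grad_comp e (x + j) - diff_quot m e (x + j)) + - (grad_comp e x - diff_quot m e x))
             + (diff_quot m e (x + j) - diff_quot m e x))" by simp
      also have "\<dots> \<le> ennreal (2 powr p) * (ennreal (2 powr p) * ennreal (B * r ^ m) + ennreal (2 powr p) * ennreal (B * r ^ m))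
          + ennreal (2 powr p) * ennreal (C * r ^ m)"
        by (intro add B0 B1 C1; measurable)
      also have "\<dots> = ennreal ((2 powr p * (2 powr p * (B + B)) + 2 powr p * C) * r ^ m)"
        using B C by (simp add: ennreal_mult[symmetric] ennreal_plus[symmetric] algebra_simps r_def del: ennreal_plus)
      also have "\<dots> \<le> ennreal ((2 powr p * (2 powr p * (B + B)) + 2 powr p * C) * (2 powr (\<gamma> * p) * norm j powr (\<gamma> * p)))"
      proof (intro ennreal_leI mult_left_mono)
        have "r ^ m = ((1/2) ^ m) powr (\<gamma> * p)"
          by (simp add: r_def powr_realpow[symmetric] powr_powr power_one_over powr_divide powr_minus_divide mult_ac)
        also have "\<dots> \<le> (2 * norm j) powr (\<gamma> * p)" using m2 \<gamma> pp by (intro powr_mono2) auto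
        finally show "r ^ m \<le> 2 powr (\<gamma> * p) * norm j powr (\<gamma> * p)" by (simp add: powr_mult)
      qed (use B C in auto)
      finally show ?thesis by (simp add: mult.assoc)
    qed simp
  qed (use B C in auto)
qed

text \<open>Discrete integration by parts moves the quotient onto \<open>\<phi>\<close>. The
  integrals with \<open>diff_quot\<close> converge by L^1 convergence on the support; the others by
  dominated convergence, since \<open>u\<close> is bounded and the quotients of
  \<open>\<phi>\<close> have a common bound.\<close>

lemma grad_comp_weak_derivative:
  fixes \<phi> :: "'a \<Rightarrow> real"
  assumes sp: "(p - 1) / p < s" and e: "norm e = 1" and S: "compact S" "S \<subseteq> \<Omega>"
    and d: "\<And>x. (\<phi> has_derivative \<phi>' x) (at x)" and c: "continuous_on UNIV (\<lambda>x. \<phi>' x e)"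
    and z: "\<And>x. x \<notin> S \<Longrightarrow> \<phi> x = 0" "\<And>x. x \<notin> S \<Longrightarrow> \<phi>' x e = 0"
  shows "(LINT x|lborel. u x * \<phi>' x e) = - (LINT x|lborel. grad_comp e x * \<phi> x)"
proof -
  have pp: "1 \<le> p" "0 < p" using p by auto
  have M0: "0 \<le> M" using M[of undefined] by simp
  have cont: "continuous_on UNIV \<phi>"
    using d by (intro continuous_at_imp_continuous_on ballI) (rule has_derivative_continuous)
  have [measurable]: "\<phi> \<in> borel_measurable borel" "(\<lambda>x. \<phi>' x e) \<in> borel_measurable borel"
    using cont c by (auto intro: borel_measurable_continuous_onI)
  have [measurable]: "S \<in> sets borel" using S by (simp add: borel_compact)
  have bdd: "\<exists>K\<ge>0. \<forall>x. \<bar>f x\<bar> \<le> K" if "continuous_on UNIV f" "\<And>x. x \<notin> S \<Longrightarrow> f x = 0" for f :: "'a \<Rightarrow> real"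
  proof -
    have "bounded (f ` S)"
      using that S by (intro compact_imp_bounded compact_continuous_image) (auto intro: continuous_on_subset)
    then obtain K where K: "\<And>x. x \<in> S \<Longrightarrow> \<bar>f x\<bar> \<le> K" by (auto simp: bounded_iff)
    have "\<bar>f x\<bar> \<le> max K 0" for x
      using K[of x] that(2)[of x] by (cases "x \<in> S") auto
    then show ?thesis by (intro exI[of _ "max K 0"]) auto
  qed
  obtain \<Phi> where \<Phi>: "0 \<le> \<Phi>" "\<And>x. \<bar>\<phi> x\<bar> \<le> \<Phi>" using bdd[OF cont z(1)] by blast
  obtain Q where Q: "0 \<le> Q" "\<And>x. \<bar>\<phi>' x e\<bar> \<le> Q" using bdd[OF c z(2)] by blast
  obtain R where R: "\<And>x. x \<in> S \<Longrightarrow> norm x \<le> R" using compact_imp_bounded[OF S(1)] by (auto simp: bounded_iff)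
  define h where "h m = (1/2) ^ m *\<^sub>R e" for m :: nat
  have nh: "norm (h m) = (1/2) ^ m" for m using e by (simp add: h_def)
  have nh1: "norm (h m) \<le> 1" for m unfolding nh by (rule power_le_one) auto
  obtain \<gamma> where \<gamma>: "0 < \<gamma>" "\<gamma> < s - (p - 1) / p" using sp dense[of 0 "s - (p - 1) / p"] by auto
  define r where "r = 2 powr (- (\<gamma> * p))"
  define q where "q = 2 powr (- \<gamma>)"
  have q: "0 < q" "q < 1" using \<gamma> powr_less_mono[of "- \<gamma>" 0 2] by (auto simp: q_def)
  have qr: "(q ^ m) powr p = r ^ m" for m
    by (simp add: q_def r_def powr_realpow[symmetric] powr_powr mult_ac)
  have r0: "0 < r" by (simp add: r_def)
  obtain B m0 where B: "0 \<le> B" "\<And>m. m0 \<le> m \<Longrightarrow> abs_mass p S (\<lambda>x. grad_comp e x - diff_quot m e x)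
      \<le> ennreal (B * r ^ m)"
    using diff_quot_converges(2)[OF sp e \<gamma> S] unfolding r_def[symmetric] by blast
  have SL: "emeasure lborel S < \<infinity>" by (rule emeasure_compact_finite[OF S(1)])
  \<comment> \<open>Multiplication by \<open>\<phi>\<close> localizes to \<open>S\<close>, of finite
    measure, where a p-th power bound yields an L^1 bound linear in \<open>t\<close>.\<close>
  have weighted: "(\<integral>\<^sup>+x. ennreal \<bar>f x * \<phi> x\<bar> \<partial>lborel) \<le> ennreal (\<Phi> * ((measure lborel S + C) * t))"
    if [measurable]: "f \<in> borel_measurable borel" and t: "0 < t" and C: "0 \<le> C" "abs_mass p S f \<le> ennreal (C * t powr p)" for f t C
  proof -
    have "(\<integral>\<^sup>+x. ennreal \<bar>f x * \<phi> x\<bar> \<partial>lborel) \<le> (\<integral>\<^sup>+x. ennreal \<Phi> * ennreal (indicator S x * \<bar>f x\<bar>) \<partial>lborel)"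
    proof (rule nn_integral_mono)
      fix x
      show "ennreal \<bar>f x * \<phi> x\<bar> \<le> ennreal \<Phi> * ennreal (indicator S x * \<bar>f x\<bar>)"
        using \<Phi> mult_right_mono[of "\<bar>\<phi> x\<bar>" \<Phi> "\<bar>f x\<bar>"]
        by (cases "x \<in> S") (auto simp: z abs_mult mult.commute ennreal_mult[symmetric] intro!: ennreal_leI)
    qed
    also have "\<dots> = ennreal \<Phi> * (\<integral>\<^sup>+x. ennreal (indicator S x * \<bar>f x\<bar>) \<partial>lborel)"
      by (rule nn_integral_cmult) measurable
    also have "\<dots> \<le> ennreal \<Phi> * ennreal ((measure lborel S + C) * t)"
      using SL pp t C by (intro mult_left_mono nn_integral_abs_le_of_mass[where p = p]) auto
    also have "\<dots> = ennreal (\<Phi> * ((measure lborel S + C) * t))"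
      using \<Phi> t C by (simp add: ennreal_mult)
    finally show ?thesis .
  qed
  have intc: "integrable lborel f" if [measurable]: "f \<in> borel_measurable borel" and "\<And>x. \<bar>f x\<bar> \<le> K" "\<And>x. f x \<noteq> 0 \<Longrightarrow> norm x \<le> R + 1"
    for f :: "'a \<Rightarrow> real" and K
  proof -
    have "integrable lborel (\<lambda>x. indicator (cball 0 (R + 1)) x * f x)"
      using that by (intro integrable_compact_bounded[where M = K]) auto
    moreover have "(\<lambda>x. indicator (cball 0 (R + 1)) x * f x) = f"
      using that(3) by (auto simp: fun_eq_iff indicator_def)
    ultimately show ?thesis by simp
  qed
  have far: "\<phi> x = 0" if "R < norm x" for x using z(1)[of x] R[of x] that by force
  have shift_norm: "norm x \<le> norm (x - h m) + 1" for x m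
    using norm_triangle_sub[of x "h m"] norm_triangle_ineq[of "x - h m" "h m"] nh1[of m] by simp
  have i1: "integrable lborel (\<lambda>x. diff_quot m e x * \<phi> x)" for m
  proof (rule intc[where K = "2 ^ m * (2 * M) * \<Phi>"])
    show "\<bar>diff_quot m e x * \<phi> x\<bar> \<le> 2 ^ m * (2 * M) * \<Phi>" for x
      unfolding abs_mult using diff_quot_bounded \<Phi> M0 by (intro mult_mono) auto
    show "norm x \<le> R + 1" if "diff_quot m e x * \<phi> x \<noteq> 0" for x
      using that far[of x] by (cases "R < norm x") auto
  qed auto
  have ig: "integrable lborel (\<lambda>x. grad_comp e x * \<phi> x)"
  proof (rule integrableI_bounded)
    have "abs_mass p S (grad_comp e) \<le> ennreal (enn2real (abs_mass p S (grad_comp e)) * 1 powr p)"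
      using nn_integral_grad_comp_finite[OF sp e S] by simp
    from weighted[OF _ _ _ this]
    have "(\<integral>\<^sup>+x. ennreal \<bar>grad_comp e x * \<phi> x\<bar> \<partial>lborel) \<le> ennreal (\<Phi> * ((measure lborel S + enn2real (abs_mass p S (grad_comp e))) * 1))"
      by simp
    also have "\<dots> < \<infinity>" by simp
    finally show "(\<integral>\<^sup>+x. ennreal (norm (grad_comp e x * \<phi> x)) \<partial>lborel) < \<infinity>" by simp
  qed auto
  have A: "(\<lambda>m. LINT x|lborel. diff_quot m e x * \<phi> x) \<longlonglongrightarrow> (LINT x|lborel. grad_comp e x * \<phi> x)"
  proof (rule tendsto_L1_int[OF i1 ig])
    let ?b = "\<lambda>m. ennreal (\<Phi> * ((measure lborel S + B) * q ^ m))"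
    have le: "(\<integral>\<^sup>+x. ennreal (norm (diff_quot m e x * \<phi> x - grad_comp e x * \<phi> x)) \<partial>lborel) \<le> ?b m" if "m0 \<le> m" for m
    proof -
      have eq: "norm (diff_quot m e x * \<phi> x - grad_comp e x * \<phi> x) = \<bar>(grad_comp e x - diff_quot m e x) * \<phi> x\<bar>" for x
        by (simp add: algebra_simps)
      show ?thesis
        unfolding eq using q B that by (intro weighted) (auto simp: qr)
    qed
    show "(\<lambda>m. \<integral>\<^sup>+x. ennreal (norm (diff_quot m e x * \<phi> x - grad_comp e x * \<phi> x)) \<partial>lborel) \<longlonglongrightarrow> 0"
    proof (rule tendsto_sandwich[of "\<lambda>_. 0" _ _ ?b])
      show "\<forall>\<^sub>F m in sequentially. (\<integral>\<^sup>+x. ennreal (norm (diff_quot m e x * \<phi> x - grad_comp e x * \<phi> x)) \<partial>lborel) \<le> ?b m"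
        using le by (auto simp: eventually_sequentially)
      have "(\<lambda>m. \<Phi> * ((measure lborel S + B) * q ^ m)) \<longlonglongrightarrow> \<Phi> * ((measure lborel S + B) * 0)"
        using q by (intro tendsto_mult_left LIMSEQ_realpow_zero) auto
      then show "?b \<longlonglongrightarrow> 0" using tendsto_ennrealI by fastforce
    qed auto
  qed
  have parts: "(LINT x|lborel. diff_quot m e x * \<phi> x) = (LINT x|lborel. u x * (2 ^ m * (\<phi> (x - h m) - \<phi> x)))" for m
  proof -
    have j0: "integrable lborel (\<lambda>x. u x * \<phi> x)"
    proof (rule intc[where K = "M * \<Phi>"])
      show "\<bar>u x * \<phi> x\<bar> \<le> M * \<Phi>" for x
        unfolding abs_mult using M \<Phi> M0 by (intro mult_mono) auto
      show "norm x \<le> R + 1" if "u x * \<phi> x \<noteq> 0" for x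
        using that far[of x] by (cases "R < norm x") auto
    qed auto
    have j1: "integrable lborel (\<lambda>x. u x * \<phi> (x - h m))"
    proof (rule intc[where K = "M * \<Phi>"])
      show "\<bar>u x * \<phi> (x - h m)\<bar> \<le> M * \<Phi>" for x
        unfolding abs_mult using M \<Phi> M0 by (intro mult_mono) auto
      show "norm x \<le> R + 1" if "u x * \<phi> (x - h m) \<noteq> 0" for x
      proof -
        have "norm (x - h m) \<le> R" using that far[of "x - h m"] by force
        then show ?thesis using shift_norm[of x m] by simp
      qed
    qed auto
    have j2: "integrable lborel (\<lambda>x. u (x + h m) * \<phi> x)"
      and e2: "(LINT x|lborel. u (x + h m) * \<phi> x) = (LINT x|lborel. u x * \<phi> (x - h m))"
      using j1 integrable_lborel_shift_iff[of "\<lambda>x. u x * \<phi> (x - h m)" "h m"]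
        integral_lborel_shift[of "\<lambda>x. u x * \<phi> (x - h m)" "h m"] by auto
    have "(LINT x|lborel. diff_quot m e x * \<phi> x) = (LINT x|lborel. 2 ^ m * (u (x + h m) * \<phi> x - u x * \<phi> x))"
      unfolding diff_quot_def h_def[symmetric] by (intro Bochner_Integration.integral_cong) (auto simp: algebra_simps)
    also have "\<dots> = 2 ^ m * ((LINT x|lborel. u (x + h m) * \<phi> x) - (LINT x|lborel. u x * \<phi> x))"
      using j2 j0 by simp
    also have "\<dots> = (LINT x|lborel. 2 ^ m * (u x * \<phi> (x - h m) - u x * \<phi> x))"
      unfolding e2 using j1 j0 by simp
    also have "\<dots> = (LINT x|lborel. u x * (2 ^ m * (\<phi> (x - h m) - \<phi> x)))"
      by (intro Bochner_Integration.integral_cong) (auto simp: algebra_simps)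
    finally show ?thesis .
  qed
  have line: "((\<lambda>t. \<phi> (x + t *\<^sub>R e)) has_field_derivative \<phi>' (x + t *\<^sub>R e) e) (at t)" for x t
  proof -
    have "((\<lambda>t. \<phi> (x + t *\<^sub>R e)) has_derivative (\<lambda>a. \<phi>' (x + t *\<^sub>R e) (a *\<^sub>R e))) (at t)"
      by (rule has_derivative_compose[OF _ d]) (auto intro!: derivative_eq_intros)
    moreover have "\<phi>' (x + t *\<^sub>R e) (a *\<^sub>R e) = \<phi>' (x + t *\<^sub>R e) e * a" for a
      using linear_scale[OF has_derivative_linear[OF d]] by simp
    ultimately show ?thesis by (simp add: has_field_derivative_def)
  qed
  have C: "(\<lambda>m. LINT x|lborel. u x * (2 ^ m * (\<phi> (x - h m) - \<phi> x))) \<longlonglongrightarrow> (LINT x|lborel. u x * (- \<phi>' x e))"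
  proof (rule integral_dominated_convergence[where w = "\<lambda>x. (M * Q) * indicator (cball 0 (R + 1)) x"])
    show "integrable lborel (\<lambda>x::'a. (M * Q) * indicator (cball 0 (R + 1)) x)"
      using emeasure_lborel_cball_finite[of "0::'a" "R + 1"] by simp
    show "AE x in lborel. (\<lambda>m. u x * (2 ^ m * (\<phi> (x - h m) - \<phi> x))) \<longlonglongrightarrow> u x * (- \<phi>' x e)"
    proof (intro AE_I2 tendsto_mult_left)
      fix x
      have "((\<lambda>t. (\<phi> (x + (0 + t) *\<^sub>R e) - \<phi> (x + 0 *\<^sub>R e)) / t) \<longlongrightarrow> \<phi>' (x + 0 *\<^sub>R e) e) (at 0)"
        using line[of x 0] unfolding DERIV_def by simp
      \<comment> \<open>The change of variables puts the opposite shift on \<open>\<phi>\<close>, so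
        its derivative is approached along negative steps; this is the source of the minus
        sign.\<close>
      moreover have "filterlim (\<lambda>m. - ((1/2::real) ^ m)) (at 0) sequentially"
        unfolding filterlim_at using tendsto_minus[OF LIMSEQ_realpow_zero[of "1/2"]] by simp
      ultimately have "(\<lambda>m. (\<phi> (x + (0 + - ((1/2::real) ^ m)) *\<^sub>R e) - \<phi> (x + 0 *\<^sub>R e)) / - ((1/2::real) ^ m)) \<longlonglongrightarrow> \<phi>' (x + 0 *\<^sub>R e) e"
        by (rule filterlim_compose)
      then have "(\<lambda>m. - ((\<phi> (x + (0 + - ((1/2::real) ^ m)) *\<^sub>R e) - \<phi> (x + 0 *\<^sub>R e)) / - ((1/2::real) ^ m))) \<longlonglongrightarrow> - \<phi>' (x + 0 *\<^sub>R e) e"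
        by (rule tendsto_minus)
      moreover have "- ((\<phi> (x + (0 + - ((1/2::real) ^ m)) *\<^sub>R e) - \<phi> (x + 0 *\<^sub>R e)) / - ((1/2::real) ^ m)) = 2 ^ m * (\<phi> (x - h m) - \<phi> x)" for m
        by (simp add: h_def power_one_over)
      ultimately show "(\<lambda>m. 2 ^ m * (\<phi> (x - h m) - \<phi> x)) \<longlonglongrightarrow> - \<phi>' x e" by simp
    qed
    show "AE x in lborel. norm (u x * (2 ^ m * (\<phi> (x - h m) - \<phi> x))) \<le> (M * Q) * indicator (cball 0 (R + 1)) x" for m
    proof (intro AE_I2)
      fix x
      show "norm (u x * (2 ^ m * (\<phi> (x - h m) - \<phi> x))) \<le> (M * Q) * indicator (cball 0 (R + 1)) x"
      proof (cases "norm x \<le> R + 1")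
        case True
        have lt: "- ((1/2::real) ^ m) < 0" by simp
        \<comment> \<open>The mean value theorem on the segment makes the dominating bound
          \<open>Q\<close> independent of \<open>m\<close>.\<close>
        obtain \<xi> where "\<phi> (x + 0 *\<^sub>R e) - \<phi> (x + (- ((1/2) ^ m)) *\<^sub>R e) = (0 - - ((1/2) ^ m)) * \<phi>' (x + \<xi> *\<^sub>R e) e"
          using MVT2[OF lt, of "\<lambda>t. \<phi> (x + t *\<^sub>R e)" "\<lambda>t. \<phi>' (x + t *\<^sub>R e) e"] line by blast
        then have "2 ^ m * (\<phi> (x - h m) - \<phi> x) = - \<phi>' (x + \<xi> *\<^sub>R e) e"
          by (simp add: h_def power_one_over field_simps)
        then have "\<bar>2 ^ m * (\<phi> (x - h m) - \<phi> x)\<bar> \<le> Q" using Q by simp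
        then have "\<bar>u x\<bar> * \<bar>2 ^ m * (\<phi> (x - h m) - \<phi> x)\<bar> \<le> M * Q"
          using M M0 by (intro mult_mono) auto
        then show ?thesis using True by (simp add: abs_mult)
      next
        case False
        then have "\<phi> x = 0" "\<phi> (x - h m) = 0"
          using shift_norm[of x m] by (auto intro!: far)
        then show ?thesis using M0 Q by simp
      qed
    qed
  qed measurable
  have "(LINT x|lborel. grad_comp e x * \<phi> x) = (LINT x|lborel. u x * (- \<phi>' x e))"
    using LIMSEQ_unique[OF A] C unfolding parts by blast
  then show ?thesis by simp
qed

end

section \<open>Borel representatives\<close>

text \<open>Completeness of Lebesgue measure: each preimage under \<open>f\<close> agrees almost
  everywhere with a Borel set.\<close>

lemma borel_measurable_lebesgue_AE_eq:
  fixes f g :: "'a::euclidean_space \<Rightarrow> 'b::topological_space"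
  assumes g: "g \<in> borel_measurable borel" and ae: "AE x in lborel. f x = g x"
  shows "f \<in> borel_measurable lebesgue"
proof (rule measurableI)
  fix A :: "'b set" assume A: "A \<in> sets borel"
  have "g -` A \<in> sets borel" using measurable_sets[OF g A] by simp
  then have A': "g -` A \<in> sets lebesgue" by (intro sets_completionI_sets) simp
  have ae': "AE x in lebesgue. x \<in> g -` A \<longleftrightarrow> x \<in> f -` A"
    using AE_completion[OF ae] by eventually_elim simp
  have "f -` A \<in> sets lebesgue"
    using ae' A' by (rule completion.in_sets_AE) simp
  then show "f -` A \<inter> space lebesgue \<in> sets lebesgue" by simp
qed simp

lemma integral_lebesgue_eq_lborel:
  fixes f g :: "'a::euclidean_space \<Rightarrow> 'b::{banach, second_countable_topology}"
  assumes g: "g \<in> borel_measurable borel" and ae: "AE x in lborel. f x = g x"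
  shows "integral\<^sup>L lebesgue f = integral\<^sup>L lborel g" "integrable lebesgue f \<longleftrightarrow> integrable lborel g"
proof -
  have f: "f \<in> borel_measurable lebesgue" using assms by (rule borel_measurable_lebesgue_AE_eq)
  have g': "g \<in> borel_measurable lebesgue" using g by (intro measurable_completion) simp
  have "integral\<^sup>L lebesgue f = integral\<^sup>L lebesgue g"
    using f g' AE_completion[OF ae] by (rule integral_cong_AE)
  also have "\<dots> = integral\<^sup>L lborel g" using g by (intro integral_completion) simp
  finally show "integral\<^sup>L lebesgue f = integral\<^sup>L lborel g" .
  have "integrable lebesgue f \<longleftrightarrow> integrable lebesgue g"
    using f g' AE_completion[OF ae] by (rule integrable_cong_AE)
  also have "\<dots> \<longleftrightarrow> integrable lborel g" using g by (intro integrable_completion) simp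
  finally show "integrable lebesgue f \<longleftrightarrow> integrable lborel g" .
qed

lemma Lp_space_iff:
  fixes v v0 :: "'a::euclidean_space \<Rightarrow> 'b::euclidean_space"
  assumes [measurable]: "v0 \<in> borel_measurable borel" and ae: "AE x in lborel. v x = v0 x"
    and [measurable]: "E \<in> sets borel"
  shows "v \<in> Lp_space q E \<longleftrightarrow> integrable lborel (\<lambda>x. indicator E x * norm (v0 x) powr q)"
proof -
  have E: "E \<inter> space lebesgue \<in> sets lebesgue" by simp
  have "v \<in> borel_measurable lebesgue" by (rule borel_measurable_lebesgue_AE_eq[OF _ ae]) measurable
  then have "v \<in> borel_measurable (lebesgue_on E)" by (rule measurable_restrict_space1)
  moreover have "integrable (lebesgue_on E) (\<lambda>x. norm (v x) powr q)
      \<longleftrightarrow> integrable lborel (\<lambda>x. indicator E x * norm (v0 x) powr q)"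
    unfolding integrable_restrict_space[OF E]
    by (rule integral_lebesgue_eq_lborel(2), measurable) (use ae in \<open>eventually_elim, simp\<close>)
  ultimately show ?thesis by (simp add: Lp_space_def)
qed

text \<open>The almost everywhere equality is used once in each variable; Tonelli then turns the
  iterated integral over \<open>E\<close> into an energy on the product space.\<close>

lemma fractional_W_iff:
  fixes v v0 :: "'a::euclidean_space \<Rightarrow> 'b::euclidean_space"
  assumes [measurable]: "v0 \<in> borel_measurable borel" and ae: "AE x in lborel. v x = v0 x"
    and [measurable]: "E \<in> sets borel"
  shows "v \<in> fractional_W \<alpha> q E \<longleftrightarrow>
    integrable lborel (\<lambda>x. indicator E x * norm (v0 x) powr q) \<and> finite_energy \<alpha> q E v0"
proof -
  have E: "E \<inter> space lebesgue \<in> sets lebesgue" by simp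
  let ?g = "\<lambda>w x y. norm (w x - w y) powr q / norm (x - y) powr (real DIM('a) + \<alpha> * q)"
  have eq: "?g v0 x y * indicator E y * indicator E x = energy_density \<alpha> q E v0 (x, y)" for x y
    unfolding energy_density_def powr_minus_divide by simp
  have "(\<integral>\<^sup>+x. (\<integral>\<^sup>+y. ennreal (?g v x y) \<partial>lebesgue_on E) \<partial>lebesgue_on E)
    = (\<integral>\<^sup>+x. (\<integral>\<^sup>+y. ennreal (?g v x y) * indicator E y \<partial>lborel) * indicator E x \<partial>lborel)"
    unfolding nn_integral_restrict_space[OF E] nn_integral_completion ..
  also have "\<dots> = (\<integral>\<^sup>+x. (\<integral>\<^sup>+y. ennreal (?g v0 x y) * indicator E y \<partial>lborel) * indicator E x \<partial>lborel)"
  proof (rule nn_integral_cong_AE, use ae in eventually_elim)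
    fix x assume x: "v x = v0 x"
    have "(\<integral>\<^sup>+y. ennreal (?g v x y) * indicator E y \<partial>lborel) = (\<integral>\<^sup>+y. ennreal (?g v0 x y) * indicator E y \<partial>lborel)"
      by (rule nn_integral_cong_AE, use ae in eventually_elim) (simp add: x)
    then show "(\<integral>\<^sup>+y. ennreal (?g v x y) * indicator E y \<partial>lborel) * indicator E x
      = (\<integral>\<^sup>+y. ennreal (?g v0 x y) * indicator E y \<partial>lborel) * indicator E x" by simp
  qed
  also have "\<dots> = (\<integral>\<^sup>+x. (\<integral>\<^sup>+y. ennreal (energy_density \<alpha> q E v0 (x, y)) \<partial>lborel) \<partial>lborel)"
  proof (rule nn_integral_cong)
    fix x
    have "(\<integral>\<^sup>+y. ennreal (?g v0 x y) * indicator E y \<partial>lborel) * indicator E x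
      = (\<integral>\<^sup>+y. ennreal (?g v0 x y) * indicator E y * indicator E x \<partial>lborel)"
      by (rule nn_integral_multc[symmetric]) measurable
    also have "\<dots> = (\<integral>\<^sup>+y. ennreal (energy_density \<alpha> q E v0 (x, y)) \<partial>lborel)"
      unfolding eq[symmetric] by (intro nn_integral_cong) (auto simp: indicator_def)
    finally show "(\<integral>\<^sup>+y. ennreal (?g v0 x y) * indicator E y \<partial>lborel) * indicator E x
      = (\<integral>\<^sup>+y. ennreal (energy_density \<alpha> q E v0 (x, y)) \<partial>lborel)" .
  qed
  also have "\<dots> = (\<integral>\<^sup>+z. ennreal (energy_density \<alpha> q E v0 (fst z, snd z)) \<partial>lborel)"
    by (rule nn_integral_lborel_pair[symmetric]) (simp add: case_prod_beta')
  finally have "(\<integral>\<^sup>+x. (\<integral>\<^sup>+y. ennreal (?g v x y) \<partial>lebesgue_on E) \<partial>lebesgue_on E) < \<infinity> \<longleftrightarrow> finite_energy \<alpha> q E v0"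
    by (simp add: finite_energy_def integrable_iff_bounded)
  then show ?thesis
    unfolding fractional_W_def using Lp_space_iff[OF assms] by simp
qed

section \<open>From the weak formulation to the abstract bounded solution\<close>

text \<open>The local spaces quantify over open sets, the estimates over compact ones; the interior
  of a compact neighbourhood mediates.\<close>

lemma compactly_contained_superset:
  fixes A :: "'a::euclidean_space set"
  assumes "compact A" "A \<subseteq> \<Omega>" "open \<Omega>"
  obtains E where "compactly_contained E \<Omega>" "A \<subseteq> E"
proof -
  obtain A2 \<rho> where A2: "compact A2" "A2 \<subseteq> \<Omega>" "0 < \<rho>" "\<And>x y. x \<in> A \<Longrightarrow> norm (y - x) \<le> \<rho> \<Longrightarrow> y \<in> A2"
    using compact_neighbourhood[OF assms] by metis
  have cl: "closure (interior A2) \<subseteq> A2"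
    using A2(1) by (intro closure_minimal interior_subset compact_imp_closed)
  show ?thesis
  proof (rule that)
    have "compact (closure (interior A2))"
      using compact_Int_closed[OF A2(1) closed_closure[of "interior A2"]] cl by (simp add: Int_absorb1)
    then show "compactly_contained (interior A2) \<Omega>"
      using cl A2 by (auto simp: compactly_contained_def)
    show "A \<subseteq> interior A2"
    proof
      fix x assume "x \<in> A"
      then have "ball x \<rho> \<subseteq> A2" using A2(4) by (auto simp: dist_norm norm_minus_commute)
      then show "x \<in> interior A2" using A2(3) by (meson centre_in_ball interior_maximal open_ball subsetD)
    qed
  qed
qed

text \<open>Prepares Fubini: the weak formulation is an iterated Bochner integral, the energy
  argument works with an integral over pairs.\<close>

lemma integrable_pairing_of_compact_support:
  fixes k u \<phi> :: "'a::euclidean_space \<Rightarrow> real"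
  assumes s: "0 < s" "s < 1" and p: "2 \<le> p" and \<Lambda>: "0 \<le> \<Lambda>" and \<Omega>: "open \<Omega>" "A \<subseteq> \<Omega>" "compact A"
    and [measurable]: "k \<in> borel_measurable borel" "u \<in> borel_measurable borel" "\<phi> \<in> borel_measurable borel"
    and k: "\<And>z. 0 \<le> k z" "\<And>z. k z \<le> \<Lambda> * norm z powr (- (real DIM('a) + s * p))"
    and M: "\<And>x. \<bar>u x\<bar> \<le> M" and fin: "\<And>A. compact A \<Longrightarrow> A \<subseteq> \<Omega> \<Longrightarrow> finite_energy s p A u"
    and M\<phi>: "\<And>x. \<bar>\<phi> x\<bar> \<le> M'" and fin\<phi>: "finite_energy s p UNIV \<phi>"
    and \<phi>: "\<And>x. x \<notin> A \<Longrightarrow> \<phi> x = 0"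
  shows "integrable lborel (pairing_density p k u \<phi>)"
proof (cases "A = {}")
  case True
  then have "pairing_density p k u \<phi> = (\<lambda>_. 0)"
    using \<phi> by (simp add: pairing_density_def fun_eq_iff)
  then show ?thesis by simp
next
  case False
  obtain e where e: "0 < e" "{x. infdist x A \<le> e} \<subseteq> \<Omega>"
    using compact_in_open_separated[of A \<Omega>] False \<Omega> by metis
  define \<rho> where "\<rho> = e / 2"
  have \<rho>: "0 < \<rho>" using e by (simp add: \<rho>_def)
  obtain R where "cutoff s p \<rho> R A {x. infdist x A \<le> \<rho>} {x. infdist x A \<le> 2 * \<rho>} (\<lambda>x. max 0 (1 - infdist x A / \<rho>))"
    using cutoff_infdist[OF s p \<rho> \<Omega>(3) False] by blast
  then interpret cutoff s p \<rho> R A "{x. infdist x A \<le> \<rho>}" "{x. infdist x A \<le> 2 * \<rho>}" "\<lambda>x. max 0 (1 - infdist x A / \<rho>)" .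
  have "finite_energy s p {x. infdist x A \<le> 2 * \<rho>} u"
    using e False \<Omega> by (intro fin compact_infdist_le) (auto simp: \<rho>_def)
  moreover have "\<phi> x = 0" if "x \<notin> {x. infdist x A \<le> \<rho>}" for x
    using that L_subset_B \<phi> by blast
  ultimately show ?thesis
    using k \<Lambda> M M\<phi> fin\<phi> by (intro integrable_pairing_density[where M = M and M' = M']) auto
qed

text \<open>Three translations: \<open>u\<close> and \<open>1 / K\<close> are exchanged for
  \<open>v\<close> and \<open>k\<close> under both integrals, the iterated integral becomes one over
  pairs, and Young's inequality turns the source into a constant. That constant is an integral of
  \<open>f\<close> over a set \<open>E\<close> depending only on \<open>A\<close>, hence the same
  for all \<open>\<phi>\<close> and \<open>t\<close>.\<close>

lemma bounded_solution_of_local_weak_solution: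
  fixes K f u k v :: "'a::euclidean_space \<Rightarrow> real"
  assumes s: "0 < s" "s < 1" and p: "2 \<le> p" and \<Lambda>: "0 < \<Lambda>" and \<Omega>: "open \<Omega>"
    and [measurable]: "k \<in> borel_measurable borel" and v_measurable [measurable]: "v \<in> borel_measurable borel"
    and k_lower: "\<And>z. norm z powr (- (real DIM('a) + s * p)) / \<Lambda> \<le> k z"
    and k_upper: "\<And>z. k z \<le> \<Lambda> * norm z powr (- (real DIM('a) + s * p))"
    and kK: "AE z in lborel. 1 / K z = k z"
    and M: "\<And>x. \<bar>v x\<bar> \<le> M" and uv: "AE x in lborel. u x = v x"
    and f: "f \<in> local_space (fractional_W s (p / (p - 1))) \<Omega>"
    and u: "u \<in> local_space (fractional_W s p) \<Omega>"
    and sol: "local_weak_solution s p K \<Omega> f u"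
  shows "bounded_solution s p \<Lambda> M \<Omega> k v"
proof -
  have fin: "finite_energy s p A v" if A0: "compact A" "A \<subseteq> \<Omega>" for A
  proof -
    obtain E where E: "compactly_contained E \<Omega>" "A \<subseteq> E" using compactly_contained_superset[OF A0 \<Omega>] .
    have Em: "E \<in> sets borel" using E by (simp add: compactly_contained_def)
    have Am: "A \<in> sets borel" using A0 by (simp add: borel_compact)
    have "u \<in> fractional_W s p E" using u E by (simp add: local_space_def)
    then have "finite_energy s p E v"
      using fractional_W_iff[OF v_measurable uv Em, of s p] by blast
    then show ?thesis by (rule finite_energy_subset(1)[OF _ E(2) Am v_measurable])
  qed
  show ?thesis
  proof
    fix A assume A: "compact A" "A \<subseteq> \<Omega>"
    obtain E where E: "compactly_contained E \<Omega>" "A \<subseteq> E" using compactly_contained_superset[OF A \<Omega>] .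
    have [measurable]: "E \<in> sets borel" "A \<in> sets borel" "\<Omega> \<in> sets borel"
      using A E \<Omega> by (auto simp: compactly_contained_def borel_compact)
    have EL: "E \<inter> space lebesgue \<in> sets lebesgue" by simp
    have k0: "0 \<le> k z" for z using k_lower[of z] \<Lambda> by (meson divide_nonneg_pos order_trans powr_ge_zero)
    define p' where "p' = p / (p - 1)"
    have "f \<in> Lp_space p' E" using f E by (simp add: local_space_def fractional_W_def p'_def)
    then have fint: "integrable (lebesgue_on E) (\<lambda>x. \<bar>f x\<bar> powr p')" by (simp add: Lp_space_def)
    define C where "C = (LINT x|lebesgue_on E. \<bar>f x\<bar> powr p')"
    have C0: "0 \<le> C" by (simp add: C_def)
    show "\<exists>C\<ge>0. \<forall>\<phi> t M'. \<phi> \<in> borel_measurable borel \<longrightarrow>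
         (\<forall>x. \<bar>\<phi> x\<bar> \<le> M') \<longrightarrow> (\<forall>x. x \<notin> A \<longrightarrow> \<phi> x = 0) \<longrightarrow> finite_energy s p UNIV \<phi> \<longrightarrow> 0 < t \<longrightarrow>
         \<bar>LINT z|lborel. pairing_density p k v \<phi> z\<bar> \<le> t * (C + (LINT x|lborel. \<bar>\<phi> x / t\<bar> powr p))"
    proof (intro exI[of _ C] conjI allI impI C0)
      fix \<phi> :: "'a \<Rightarrow> real" and t M' :: real
      assume [measurable]: "\<phi> \<in> borel_measurable borel" and M': "\<forall>x. \<bar>\<phi> x\<bar> \<le> M'"
        and \<phi>0: "\<forall>x. x \<notin> A \<longrightarrow> \<phi> x = 0" and fin\<phi>: "finite_energy s p UNIV \<phi>" and t: "0 < t"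
      have iphi: "integrable lborel (\<lambda>x. \<bar>\<phi> x / t\<bar> powr p)"
      proof -
        have "integrable lborel (\<lambda>x. indicator A x * \<bar>\<phi> x / t\<bar> powr p)"
          using M' t p by (intro integrable_compact_bounded[OF A(1), where M = "(M' / t) powr p"])
            (auto intro!: powr_mono2 divide_right_mono)
        also have "(\<lambda>x. indicator A x * \<bar>\<phi> x / t\<bar> powr p) = (\<lambda>x. \<bar>\<phi> x / t\<bar> powr p)"
          using \<phi>0 by (auto simp: fun_eq_iff indicator_def)
        finally show ?thesis .
      qed
      have "\<phi> \<in> fractional_W s p \<Omega>"
      proof -
        have "integrable lborel (\<lambda>x. indicator A x * (indicator \<Omega> x * norm (\<phi> x) powr p))"
          using M' p by (intro integrable_compact_bounded[OF A(1), where M = "M' powr p"])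
            (auto intro!: powr_mono2 simp: indicator_def)
        also have "(\<lambda>x. indicator A x * (indicator \<Omega> x * norm (\<phi> x) powr p)) = (\<lambda>x. indicator \<Omega> x * norm (\<phi> x) powr p)"
          using \<phi>0 by (auto simp: fun_eq_iff indicator_def)
        finally show ?thesis
          using finite_energy_subset(1)[OF fin\<phi>, of \<Omega>] by (subst fractional_W_iff[where v0 = \<phi>]) auto
      qed
      then have eq: "(LINT x|lebesgue. LINT y|lebesgue.
             (\<bar>u x - u y\<bar> powr (p - 2) * (u x - u y)) / K (x - y)
               * (indicator \<Omega> x * \<phi> x - indicator \<Omega> y * \<phi> y))
          = (LINT x|lebesgue_on E. f x * \<phi> x)"
        using sol E \<phi>0 unfolding local_weak_solution_def by blast
      have ip: "integrable lborel (pairing_density p k v \<phi>)"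
        using s p \<Lambda> \<Omega> A k0 k_upper M fin M' fin\<phi> \<phi>0
        by (intro integrable_pairing_of_compact_support[where s = s and p = p and \<Lambda> = \<Lambda> and \<Omega> = \<Omega> and A = A and M = M and M' = M']) auto
      have ind: "indicator \<Omega> x * \<phi> x = \<phi> x" for x
        using \<phi>0 A by (auto simp: indicator_def)
      have "(LINT x|lebesgue. LINT y|lebesgue.
             (\<bar>u x - u y\<bar> powr (p - 2) * (u x - u y)) / K (x - y)
               * (indicator \<Omega> x * \<phi> x - indicator \<Omega> y * \<phi> y))
        = (LINT x|lborel. LINT y|lborel. pairing_density p k v \<phi> (x, y))"
      proof (rule integral_lebesgue_eq_lborel(1))
        have "(\<lambda>x. LINT y|lborel. pairing_density p k v \<phi> (x, y)) \<in> borel_measurable lborel"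
          by (rule lborel.borel_measurable_lebesgue_integral) (simp add: lborel_prod case_prod_beta')
        then show "(\<lambda>x. LINT y|lborel. pairing_density p k v \<phi> (x, y)) \<in> borel_measurable borel" by simp
        show "AE x in lborel. (LINT y|lebesgue.
             (\<bar>u x - u y\<bar> powr (p - 2) * (u x - u y)) / K (x - y)
               * (indicator \<Omega> x * \<phi> x - indicator \<Omega> y * \<phi> y)) = (LINT y|lborel. pairing_density p k v \<phi> (x, y))"
          using uv
        proof eventually_elim
          fix x assume x: "u x = v x"
          show "(LINT y|lebesgue.
             (\<bar>u x - u y\<bar> powr (p - 2) * (u x - u y)) / K (x - y)
               * (indicator \<Omega> x * \<phi> x - indicator \<Omega> y * \<phi> y)) = (LINT y|lborel. pairing_density p k v \<phi> (x, y))"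
          proof (rule integral_lebesgue_eq_lborel(1))
            show "(\<lambda>y. pairing_density p k v \<phi> (x, y)) \<in> borel_measurable borel"
              unfolding pairing_density_def signed_powr_def by measurable
            show "AE y in lborel. (\<bar>u x - u y\<bar> powr (p - 2) * (u x - u y)) / K (x - y)
               * (indicator \<Omega> x * \<phi> x - indicator \<Omega> y * \<phi> y) = pairing_density p k v \<phi> (x, y)"
              using uv AE_lborel_reflect[OF kK, of x]
            proof eventually_elim
              fix y assume y: "u y = v y" and ky: "1 / K (x - y) = k (x - y)"
              show "(\<bar>u x - u y\<bar> powr (p - 2) * (u x - u y)) / K (x - y)
               * (indicator \<Omega> x * \<phi> x - indicator \<Omega> y * \<phi> y) = pairing_density p k v \<phi> (x, y)"
                by (simp add: ind pairing_density_def signed_powr_def x y flip: ky)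
            qed
          qed
        qed
      qed
      also have "\<dots> = (LINT z|lborel. pairing_density p k v \<phi> z)"
        using lborel_pair.integral_fst'[of "pairing_density p k v \<phi>"] ip by (simp add: lborel_prod)
      finally have "(LINT z|lborel. pairing_density p k v \<phi> z) = (LINT x|lebesgue_on E. f x * \<phi> x)"
        using eq by simp
      also have "\<bar>\<dots>\<bar> \<le> t * (C + (LINT x|lborel. \<bar>\<phi> x / t\<bar> powr p))"
      \<comment> \<open>If the product were not integrable, its Bochner integral would be 0 by
        convention and the bound would hold trivially, so integrability need not be derived
        first.\<close>
      proof (cases "integrable (lebesgue_on E) (\<lambda>x. f x * \<phi> x)")
        case False
        then show ?thesis using C0 t by (simp add: not_integrable_integral_eq)
      next
        case True
        have ind': "indicator E x *\<^sub>R \<bar>\<phi> x / t\<bar> powr p = \<bar>\<phi> x / t\<bar> powr p" for x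
          using \<phi>0 E by (auto simp: indicator_def)
        have i2: "integrable (lebesgue_on E) (\<lambda>x. \<bar>\<phi> x / t\<bar> powr p)"
          unfolding integrable_restrict_space[OF EL] ind'
          using iphi by (subst integrable_completion) auto
        have e2: "(LINT x|lebesgue_on E. \<bar>\<phi> x / t\<bar> powr p) = (LINT x|lborel. \<bar>\<phi> x / t\<bar> powr p)"
          unfolding integral_restrict_space[OF EL] ind' by (subst integral_completion) auto
        have "\<bar>LINT x|lebesgue_on E. f x * \<phi> x\<bar> \<le> (LINT x|lebesgue_on E. \<bar>f x * \<phi> x\<bar>)"
          using integral_norm_bound[of "lebesgue_on E" "\<lambda>x. f x * \<phi> x"] by simp
        also have "\<dots> \<le> (LINT x|lebesgue_on E. t * (\<bar>f x\<bar> powr p' + \<bar>\<phi> x / t\<bar> powr p))"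
        proof (rule integral_mono)
          fix x
          show "\<bar>f x * \<phi> x\<bar> \<le> t * (\<bar>f x\<bar> powr p' + \<bar>\<phi> x / t\<bar> powr p)"
            using young_weighted_conjugate[of "\<bar>f x\<bar>" "\<bar>\<phi> x\<bar>" t p] p t by (simp add: abs_mult p'_def)
        qed (use True fint i2 in auto)
        also have "\<dots> = t * (C + (LINT x|lborel. \<bar>\<phi> x / t\<bar> powr p))"
          unfolding C_def e2[symmetric] using fint i2 by simp
        finally show ?thesis .
      qed
      finally show "\<bar>LINT z|lborel. pairing_density p k v \<phi> z\<bar> \<le> t * (C + (LINT x|lborel. \<bar>\<phi> x / t\<bar> powr p))" .
    qed
  qed (use assms fin in auto)
qed

section \<open>Sobolev regularity\<close>

text \<open>Every term is at most the maximum, which is itself one of the terms.\<close>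

lemma sum_powr_le:
  fixes a :: "'i \<Rightarrow> real"
  assumes "finite S" "\<And>i. i \<in> S \<Longrightarrow> 0 \<le> a i" "0 \<le> p"
  shows "(\<Sum>i\<in>S. a i) powr p \<le> real (card S) powr p * (\<Sum>i\<in>S. a i powr p)"
proof (cases "S = {}")
  case False
  define m where "m = Max (a ` S)"
  have "m \<in> a ` S" unfolding m_def using assms False by (intro Max_in) auto
  then obtain i where i: "i \<in> S" "a i = m" by auto
  have le: "a j \<le> m" if "j \<in> S" for j using assms that by (simp add: m_def)
  have "(\<Sum>i\<in>S. a i) \<le> real (card S) * m" using le by (intro sum_bounded_above) auto
  then have "(\<Sum>i\<in>S. a i) powr p \<le> (real (card S) * m) powr p"
    using assms by (intro powr_mono2 sum_nonneg) auto
  also have "\<dots> = real (card S) powr p * a i powr p" using i by (simp add: powr_mult)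
  also have "\<dots> \<le> real (card S) powr p * (\<Sum>i\<in>S. a i powr p)"
    using i assms by (intro mult_left_mono member_le_sum) auto
  finally show ?thesis .
qed simp

lemma integrable_indicator_subset:
  fixes f :: "'a::euclidean_space \<Rightarrow> real"
  assumes "integrable lborel (\<lambda>x. indicator L x * f x)" "E \<subseteq> L" "E \<in> sets borel"
  shows "integrable lborel (\<lambda>x. indicator E x * f x)"
proof -
  have "integrable lborel (\<lambda>x. indicator E x *\<^sub>R (indicator L x * f x))"
    using assms by (intro integrable_mult_indicator) auto
  also have "(\<lambda>x. indicator E x *\<^sub>R (indicator L x * f x)) = (\<lambda>x. indicator E x * f x)"
    using assms(2) by (auto simp: fun_eq_iff indicator_def)
  finally show ?thesis .
qed

text \<open>On a compact set \<open>norm (v x) \<le> 1 + norm (v x) powr p\<close> suffices. The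
  exponent \<open>powr 1\<close> is written out as in \<open>Lp_space 1\<close>.\<close>

lemma integrable_powr_one:
  fixes v :: "'a::euclidean_space \<Rightarrow> 'b::euclidean_space"
  assumes L: "compact L" and i: "integrable lborel (\<lambda>x. indicator L x * norm (v x) powr p)"
    and p: "1 \<le> p" and [measurable]: "v \<in> borel_measurable borel"
  shows "integrable lborel (\<lambda>x. indicator L x * norm (v x) powr 1)"
proof (rule Bochner_Integration.integrable_bound)
  have [measurable]: "L \<in> sets borel" using L by (rule borel_compact)
  show "integrable lborel (\<lambda>x. indicator L x + indicator L x * norm (v x) powr p)"
    using i emeasure_compact_finite[OF L] by simp
  show "AE x in lborel. norm (indicator L x * norm (v x) powr 1) \<le> norm (indicator L x + indicator L x * norm (v x) powr p)"
    using young_weighted[of 1 "norm (v _)" 1 p] p by (intro AE_I2) (auto simp: indicator_def)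
  show "(\<lambda>x. indicator L x * norm (v x) powr 1) \<in> borel_measurable lborel" by measurable
qed

text \<open>Differentiability and continuity are the first level of \<open>C_k\<close>. Off the
  closed support \<open>\<phi>\<close> vanishes on a whole neighbourhood, so its derivative is zero
  there.\<close>

lemma test_function_derivative:
  assumes "\<phi> \<in> test_functions \<Omega>"
  shows "(\<phi> has_derivative frechet_derivative \<phi> (at x)) (at x)"
    and "i \<in> Basis \<Longrightarrow> continuous_on UNIV (\<lambda>x. frechet_derivative \<phi> (at x) i)"
    and "x \<notin> closure {x. \<phi> x \<noteq> 0} \<Longrightarrow> frechet_derivative \<phi> (at x) i = 0"
proof -
  have "C_k (Suc 0) \<phi>" using assms by (simp add: test_functions_def)
  then have d: "\<And>x. \<phi> differentiable (at x)" and c: "\<And>i. i \<in> Basis \<Longrightarrow> continuous_on UNIV (\<lambda>x. frechet_derivative \<phi> (at x) i)"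
    by simp_all
  show d': "(\<phi> has_derivative frechet_derivative \<phi> (at x)) (at x)" for x
    using d frechet_derivative_works by blast
  show "continuous_on UNIV (\<lambda>x. frechet_derivative \<phi> (at x) i)" if "i \<in> Basis" using c that .
  show "frechet_derivative \<phi> (at x) i = 0" if x: "x \<notin> closure {x. \<phi> x \<noteq> 0}"
  proof -
    have "((\<lambda>x. 0) has_derivative frechet_derivative \<phi> (at x)) (at x)"
    proof (rule has_derivative_transform_within_open[OF d'])
      show "open (- closure {x. \<phi> x \<noteq> 0})" by (intro open_Compl closed_closure)
      show "x \<in> - closure {x. \<phi> x \<noteq> 0}" using x by simp
      show "\<phi> y = 0" if "y \<in> - closure {x. \<phi> x \<noteq> 0}" for y
        using that closure_subset[of "{x. \<phi> x \<noteq> 0}"] by auto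
    qed
    then have "frechet_derivative \<phi> (at x) = (\<lambda>h. 0)"
      by (rule has_derivative_unique) simp
    then show ?thesis by simp
  qed
qed

context bounded_solution
begin

section \<open>From Nikolskii bounds and difference quotients back to function spaces\<close>

lemma integrable_u:
  assumes "compactly_contained E \<Omega>" "0 \<le> q"
  shows "integrable lborel (\<lambda>x. indicator E x * norm (u x) powr q)"
proof (rule integrable_indicator_subset)
  show "integrable lborel (\<lambda>x. indicator (closure E) x * norm (u x) powr q)"
    using assms M by (intro integrable_compact_bounded[where M = "M powr q"])
      (auto simp: compactly_contained_def intro!: powr_mono2)
qed (use assms closure_subset in \<open>auto simp: compactly_contained_def\<close>)

text \<open>Passing from Nikolskii to Gagliardo regularity costs an arbitrarily small order, which
  is harmless because the ranges of \<open>\<tau>\<close> in the theorem are open.\<close>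

lemma fractional_W_of_nikolskii:
  fixes v w :: "'a \<Rightarrow> 'b::euclidean_space"
  assumes N: "nikolskii \<Omega> p \<sigma> v" and \<tau>: "0 < \<tau>" "\<tau> < \<sigma>"
    and vm [measurable]: "v \<in> borel_measurable borel" and ae: "AE x in lborel. w x = v x"
    and i: "\<And>L. compact L \<Longrightarrow> L \<subseteq> \<Omega> \<Longrightarrow> integrable lborel (\<lambda>x. indicator L x * norm (v x) powr p)"
  shows "w \<in> local_space (fractional_W \<tau> p) \<Omega>"
  unfolding local_space_def
proof (intro CollectI allI impI)
  fix E assume E: "compactly_contained E \<Omega>"
  have Em: "E \<in> sets borel" and L: "compact (closure E)" "closure E \<subseteq> \<Omega>"
    using E by (auto simp: compactly_contained_def)
  have pp: "0 < p" using p by simp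
  obtain C \<delta> where C: "0 \<le> C" "0 < \<delta>" "\<And>h. norm h \<le> \<delta> \<Longrightarrow>
    norm_mass p (closure E) (\<lambda>x. v (x + h) - v x) \<le> ennreal (C * norm h powr (\<sigma> * p))"
    using N L unfolding nikolskii_def by meson
  have "finite_energy \<tau> p (closure E) v"
    by (rule finite_energy_of_differences[OF L(1) _ i[OF L] pp \<tau> C]) measurable
  then have "finite_energy \<tau> p E v"
    by (rule finite_energy_subset(1)[OF _ closure_subset Em vm])
  moreover have "integrable lborel (\<lambda>x. indicator E x * norm (v x) powr p)"
    using integrable_indicator_subset[OF i[OF L] closure_subset Em] .
  ultimately show "w \<in> fractional_W \<tau> p E"
    using fractional_W_iff[OF vm ae Em] by blast
qed

lemma integrable_u_compact: "compact L \<Longrightarrow> integrable lborel (\<lambda>x. indicator L x * norm (u x) powr p)"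
  using M p by (intro integrable_compact_bounded[where M = "M powr p"]) (auto intro!: powr_mono2)

lemma integrable_grad_compact:
  assumes sp: "(p - 1) / p < s" and L: "compact L" "L \<subseteq> \<Omega>"
  shows "integrable lborel (\<lambda>x. indicator L x * norm (grad x) powr p)"
proof (rule Bochner_Integration.integrable_bound)
  have [measurable]: "L \<in> sets borel" using L by (simp add: borel_compact)
  have "integrable lborel (\<lambda>x. indicator L x * \<bar>grad_comp e x\<bar> powr p)" if "e \<in> Basis" for e
    using nn_integral_grad_comp_finite[OF sp _ L, of e] that by (intro integrableI_bounded) (auto simp: abs_mult)
  then show "integrable lborel (\<lambda>x. real DIM('a) powr p * (\<Sum>e\<in>(Basis :: 'a set). indicator L x * \<bar>grad_comp e x\<bar> powr p))"
    by (intro integrable_mult_right Bochner_Integration.integrable_sum) auto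
  show "(\<lambda>x. indicator L x * norm (grad x) powr p) \<in> borel_measurable lborel" by measurable
  show "AE x in lborel. norm (indicator L x * norm (grad x) powr p)
    \<le> norm (real DIM('a) powr p * (\<Sum>e\<in>(Basis :: 'a set). indicator L x * \<bar>grad_comp e x\<bar> powr p))"
  proof (rule AE_I2)
    fix x
    have "norm (grad x) \<le> (\<Sum>e\<in>Basis. norm (grad_comp e x *\<^sub>R e))"
      unfolding grad_def by (rule norm_sum)
    also have "\<dots> = (\<Sum>e\<in>Basis. \<bar>grad_comp e x\<bar>)" by (intro sum.cong) auto
    finally have "norm (grad x) powr p \<le> (\<Sum>e\<in>Basis. \<bar>grad_comp e x\<bar>) powr p"
      using p by (intro powr_mono2) auto
    also have "\<dots> \<le> real DIM('a) powr p * (\<Sum>e\<in>(Basis :: 'a set). \<bar>grad_comp e x\<bar> powr p)"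
      using p by (intro sum_powr_le) auto
    finally have "norm (grad x) powr p \<le> real DIM('a) powr p * (\<Sum>e\<in>(Basis :: 'a set). \<bar>grad_comp e x\<bar> powr p)" .
    moreover have "0 \<le> (\<Sum>e\<in>(Basis :: 'a set). \<bar>grad_comp e x\<bar> powr p)" by (intro sum_nonneg) simp
    ultimately show "norm (indicator L x * norm (grad x) powr p)
      \<le> norm (real DIM('a) powr p * (\<Sum>e\<in>(Basis :: 'a set). indicator L x * \<bar>grad_comp e x\<bar> powr p))"
      by (cases "x \<in> L") (auto simp: abs_mult)
  qed
qed

lemma grad_in_Lp:
  assumes sp: "(p - 1) / p < s" and E: "compactly_contained E \<Omega>"
  shows "grad \<in> Lp_space p E" "grad \<in> Lp_space 1 E"
proof -
  have Em: "E \<in> sets borel" and L: "compact (closure E)" "closure E \<subseteq> \<Omega>"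
    using E by (auto simp: compactly_contained_def)
  note i = integrable_grad_compact[OF sp L]
  have ae: "AE x in lborel. grad x = grad x" by simp
  show "grad \<in> Lp_space p E"
    using integrable_indicator_subset[OF i closure_subset Em] Lp_space_iff[OF grad_measurable ae Em] by blast
  have "1 \<le> p" using p by simp
  then show "grad \<in> Lp_space 1 E"
    using integrable_indicator_subset[OF integrable_powr_one[OF L(1) i _ grad_measurable] closure_subset Em]
      Lp_space_iff[OF grad_measurable ae Em] by blast
qed

text \<open>Stated for an arbitrary open subset \<open>E\<close>, so that the same
  \<open>grad\<close> is the weak gradient on \<open>\<Omega>\<close> and on every compactly
  contained set; the support of the test function lets both integrals be taken over the whole
  space.\<close>

lemma weak_gradient_grad:
  assumes sp: "(p - 1) / p < s" and ae: "AE x in lborel. w x = u x" and E: "open E" "E \<subseteq> \<Omega>"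
  shows "weak_gradient E w grad"
  unfolding weak_gradient_def
proof (intro conjI ballI)
  have cc: "compactly_contained E' \<Omega>" "E' \<in> sets borel" if "compactly_contained E' E" for E'
    using that E by (auto simp: compactly_contained_def)
  show "w \<in> local_space (Lp_space 1) E"
    unfolding local_space_def using Lp_space_iff[OF u_measurable ae cc(2)] integrable_u[OF cc(1), of _ 1] by auto
  show "grad \<in> local_space (Lp_space 1) E"
    unfolding local_space_def using grad_in_Lp(2)[OF sp cc(1)] by blast
  fix \<phi> i assume \<phi>: "\<phi> \<in> test_functions E" and i: "i \<in> (Basis :: 'a set)"
  define S where "S = closure {x. \<phi> x \<noteq> 0}"
  have S: "compact S" "S \<subseteq> \<Omega>" "S \<subseteq> E" using \<phi> E by (auto simp: test_functions_def S_def)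
  note d = test_function_derivative(1)[OF \<phi>] test_function_derivative(2)[OF \<phi> i]
  have z: "\<phi> x = 0" "frechet_derivative \<phi> (at x) i = 0" if "x \<notin> S" for x
    using that closure_subset[of "{x. \<phi> x \<noteq> 0}"] test_function_derivative(3)[OF \<phi>, of x i] by (auto simp: S_def)
  have [measurable]: "(\<lambda>x. frechet_derivative \<phi> (at x) i) \<in> borel_measurable borel"
    using d(2) by (rule borel_measurable_continuous_onI)
  have "continuous_on UNIV \<phi>"
    using d(1) by (intro continuous_at_imp_continuous_on ballI) (rule has_derivative_continuous)
  then have [measurable]: "\<phi> \<in> borel_measurable borel" by (rule borel_measurable_continuous_onI)
  have EL: "E \<inter> space lebesgue \<in> sets lebesgue" using E by (simp add: borel_open sets_completionI_sets)
  have "(LINT x|lebesgue_on E. w x * frechet_derivative \<phi> (at x) i)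
    = (LINT x|lborel. u x * frechet_derivative \<phi> (at x) i)"
    unfolding integral_restrict_space[OF EL]
  proof (rule integral_lebesgue_eq_lborel(1))
    show "AE x in lborel. indicator E x *\<^sub>R (w x * frechet_derivative \<phi> (at x) i) = u x * frechet_derivative \<phi> (at x) i"
      using ae by eventually_elim (use z S in \<open>auto simp: indicator_def\<close>)
  qed measurable
  also have "\<dots> = - (LINT x|lborel. grad_comp i x * \<phi> x)"
    using i by (intro grad_comp_weak_derivative[OF sp _ S(1,2) d z]) auto
  also have "(LINT x|lborel. grad_comp i x * \<phi> x) = (LINT x|lebesgue_on E. (grad x \<bullet> i) * \<phi> x)"
    unfolding integral_restrict_space[OF EL]
  proof (rule integral_lebesgue_eq_lborel(1)[symmetric])
    show "AE x in lborel. indicator E x *\<^sub>R ((grad x \<bullet> i) * \<phi> x) = grad_comp i x * \<phi> x"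
      using z S by (intro AE_I2) (auto simp: indicator_def grad_inner[OF i])
  qed measurable
  finally show "(LINT x|lebesgue_on E. w x * frechet_derivative \<phi> (at x) i) = - (LINT x|lebesgue_on E. (grad x \<bullet> i) * \<phi> x)" .
qed

end

text \<open>In the second case one \<open>G\<close> has to serve every \<open>\<tau>\<close>. This
  works because \<open>grad\<close> is a pointwise limit whose definition does not mention the
  auxiliary order \<open>\<gamma>\<close>.\<close>

theorem corollary1p8:
  fixes p s \<Lambda> :: real
    and \<Omega> :: "'a::euclidean_space set"
    and K f u :: "'a \<Rightarrow> real"
  assumes "p \<ge> 2" and "0 < s" and "s < 1" and "\<Lambda> \<ge> 1"
    and "open \<Omega>"
    and "K \<in> borel_measurable lebesgue"
    and "\<And>z. K z \<ge> 0"
    and "\<And>z. 1 / \<Lambda> * norm z powr (real DIM('a) + s * p) \<le> K z"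
    and "\<And>z. K z \<le> \<Lambda> * norm z powr (real DIM('a) + s * p)"
    and "f \<in> local_space (fractional_W s (p / (p - 1))) \<Omega>"
    and "u \<in> local_space (fractional_W s p) \<Omega>"
    and "u \<in> L_infinity"
    and "local_weak_solution s p K \<Omega> f u"
  shows "(s \<le> (p - 1) / p \<longrightarrow>
            (\<forall>\<tau>. 0 < \<tau> \<and> \<tau> < s * p / (p - 1) \<longrightarrow> u \<in> local_space (fractional_W \<tau> p) \<Omega>))
       \<and> (s > (p - 1) / p \<longrightarrow>
            u \<in> local_space (W1 p) \<Omega> \<and>
            (\<exists>G. weak_gradient \<Omega> u G \<and>
               (\<forall>\<tau>. 0 < \<tau> \<and> \<tau> < s - (p - 1) / p \<longrightarrow> G \<in> local_space (fractional_W \<tau> p) \<Omega>)))"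
proof -
  obtain C where um: "u \<in> borel_measurable lebesgue" and C: "AE x in lebesgue. \<bar>u x\<bar> \<le> C"
    using assms(12) by (auto simp: L_infinity_def)
  obtain u0 where u0: "u0 \<in> borel_measurable lborel" "AE x in lborel. u x = u0 x"
    using completion_ex_borel_measurable_real[OF um] by blast
  define M where "M = max C 0"
  \<comment> \<open>Truncating the Borel representative at the essential bound makes the bound hold
    at every point and changes the function on a null set only.\<close>
  define v where "v x = max (- M) (min M (u0 x))" for x
  have vm: "v \<in> borel_measurable borel" unfolding v_def[abs_def] using u0(1) by measurable
  have M: "\<bar>v x\<bar> \<le> M" for x by (auto simp: v_def M_def)
  have "AE x in lborel. \<bar>u x\<bar> \<le> C" using C by (simp add: AE_completion_iff)
  then have uv: "AE x in lborel. u x = v x"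
    using u0(2) by eventually_elim (auto simp: v_def M_def)
  obtain K0 where K0: "K0 \<in> borel_measurable lborel" "AE x in lborel. K x = K0 x"
    using completion_ex_borel_measurable_real[OF assms(6)] by blast
  let ?n = "real DIM('a) + s * p"
  \<comment> \<open>Clamping \<open>1 / K0\<close> enforces both kernel bounds everywhere, including
    the null set where \<open>K0\<close> and \<open>K\<close> differ.\<close>
  define k where "k z = max (norm z powr (- ?n) / \<Lambda>) (min (\<Lambda> * norm z powr (- ?n)) (1 / K0 z))" for z
  have km: "k \<in> borel_measurable borel" unfolding k_def[abs_def] using K0(1) by measurable
  have \<Lambda>: "0 < \<Lambda>" using assms(4) by simp
  have k1: "norm z powr (- ?n) / \<Lambda> \<le> k z" for z by (simp add: k_def)
  have k2: "k z \<le> \<Lambda> * norm z powr (- ?n)" for z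
  proof -
    have "norm z powr (- ?n) / \<Lambda> \<le> norm z powr (- ?n) * \<Lambda>"
      using assms(4) mult_mono[of "1 / \<Lambda>" \<Lambda> "norm z powr (- ?n)" "norm z powr (- ?n)"]
      by (simp add: mult.commute order_trans[of _ 1])
    then show ?thesis by (simp add: k_def mult.commute)
  qed
  have kK: "AE z in lborel. 1 / K z = k z"
    \<comment> \<open>The origin is discarded, since the lower bound makes \<open>K\<close> positive
      only at nonzero points.\<close>
    using K0(2) AE_lborel_singleton[of 0]
  proof eventually_elim
    fix z :: 'a assume z: "K z = K0 z" "z \<noteq> 0"
    then have n: "0 < norm z powr ?n" by simp
    have "0 < 1 / \<Lambda> * norm z powr ?n" using n \<Lambda> by simp
    then have Kz: "0 < K z" using assms(8)[of z] by linarith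
    have "1 / K z \<le> \<Lambda> * norm z powr (- ?n)"
      using assms(8)[of z] Kz n \<Lambda> unfolding powr_minus_divide by (simp add: field_simps)
    moreover have "norm z powr (- ?n) / \<Lambda> \<le> 1 / K z"
      using assms(9)[of z] Kz n \<Lambda> unfolding powr_minus_divide by (simp add: field_simps)
    ultimately show "1 / K z = k z" using z by (simp add: k_def)
  qed
  interpret bounded_solution s p \<Lambda> M \<Omega> k v
    by (rule bounded_solution_of_local_weak_solution[OF assms(2,3,1) \<Lambda> assms(5) km vm k1 k2 kK M uv assms(10,11,13)])
  show ?thesis
  proof (intro conjI impI allI)
    fix \<tau> assume sle: "s \<le> (p - 1) / p" and \<tau>: "0 < \<tau> \<and> \<tau> < s * p / (p - 1)"
    then obtain \<sigma> where \<sigma>: "\<tau> < \<sigma>" "\<sigma> < s * p / (p - 1)" using dense by blast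
    \<comment> \<open>The case assumption puts the threshold at or below one, so
      \<open>\<sigma> < 1\<close> as \<open>nikolskii_below_threshold\<close> requires.\<close>
    have "s * p / (p - 1) \<le> 1" using sle p by (simp add: field_simps)
    then have "nikolskii \<Omega> p \<sigma> v" using \<sigma> \<tau> by (intro nikolskii_below_threshold) auto
    then show "u \<in> local_space (fractional_W \<tau> p) \<Omega>"
      using \<sigma> \<tau> uv vm integrable_u_compact by (intro fractional_W_of_nikolskii) auto
  next
    assume sp: "(p - 1) / p < s"
    show "u \<in> local_space (W1 p) \<Omega>"
      unfolding local_space_def W1_def
    proof (intro CollectI allI impI conjI)
      fix E assume E: "compactly_contained E \<Omega>"
      then have Em: "E \<in> sets borel" and E': "open E" "E \<subseteq> \<Omega>"
        using closure_subset[of E] by (auto simp: compactly_contained_def)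
      show "u \<in> Lp_space p E"
        using Lp_space_iff[OF vm uv Em, of p] integrable_u[OF E, of p] p by simp
      show "\<exists>G\<in>Lp_space p E. weak_gradient E u G"
        using grad_in_Lp(1)[OF sp E] weak_gradient_grad[OF sp uv E'] by blast
    qed
  next
    assume sp: "(p - 1) / p < s"
    have "grad \<in> local_space (fractional_W \<tau> p) \<Omega>" if \<tau>: "0 < \<tau>" "\<tau> < s - (p - 1) / p" for \<tau>
    proof -
      obtain \<gamma> where \<gamma>: "\<tau> < \<gamma>" "\<gamma> < s - (p - 1) / p" using dense \<tau> by blast
      have "nikolskii \<Omega> p \<gamma> grad"
        unfolding grad_def[abs_def]
        using \<tau> \<gamma> p by (intro nikolskii_sum_Basis nikolskii_grad_comp[OF sp]) auto
      then show ?thesis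
        using \<tau>(1) \<gamma>(1) by (rule fractional_W_of_nikolskii) (use integrable_grad_compact[OF sp] in auto)
    qed
    then show "\<exists>G. weak_gradient \<Omega> u G \<and>
               (\<forall>\<tau>. 0 < \<tau> \<and> \<tau> < s - (p - 1) / p \<longrightarrow> G \<in> local_space (fractional_W \<tau> p) \<Omega>)"
      using weak_gradient_grad[OF sp uv \<Omega> order_refl] by blast
  qed
qed

end
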